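(* Let $d\ge 1$, let $B_t$, $t\ge 0$, be a $d\times d$ matrix whose entries are independent standard real Brownian motions, and let $X_0\in\mathcal{S}_{d\times d}^{+}$ be an initial condition. Suppose that $g$, $f$ and $b$ are bounded functions $\mathbb{R}\to\mathbb{R}$ such that each of the induced functions $g,f,b:\mathcal{S}_{d\times d}\to\mathcal{S}_{d\times d}$ (defined through the spectral decomposition) is Lipschitz in matrix sense. Then the stochastic differential equation $$X_{t}=X_{0}+ \int_{0}^{t}b(X_{s})\,ds +\int_{0}^{t}g(X_{s})\,dB_{s}\,f(X_{s})+\int_{0}^{t}f(X_{s})\,dB_{s}^{T}\,g(X_{s})$$ has a unique strong solution in $\mathcal{S}_{d\times d}$.
   Context: $\mathcal{S}_{d\times d}$ is the set of real symmetric $d\times d$ matrices and $\mathcal{S}_{d\times d}^{+}$ the subset of positive semidefinite ones. Functions of matrices: for $h:\mathbb{R}\to\mathbb{R}$ and $A\in\mathcal{S}_{d\times d}$ with spectral decomposition $A=H\Lambda H^{T}$, where $H$ is orthogonal and $\Lambda$ is the diagonal matrix of the eigenvalues $\lambda_1\le\dots\le\lambda_d$ of $A$, one sets $h(A):=H h(\Lambda)H^{T}$, where $h(\Lambda)$ is the diagonal matrix with entries $h(\lambda_1),\dots,h(\lambda_d)$. Lipschitz in matrix sense: a function $h:\mathcal{S}_{d\times d}\to\mathcal{S}_{d\times d}$ is Lipschitz in matrix sense if there is a constant $c>0$ such that for all $A_1,A_2\in\mathcal{S}_{d\times d}$ and every unit vector $x\in\mathbb{R}^d$, $$x^{T}\left(h(A_1)-h(A_2)\right)^{2}x\le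 c\,x^{T}(A_1-A_2)^{2}x.$$ Matrix stochastic integrals: for matrix-valued processes $A_t,C_t$, the integral $\int_0^t A_s\,dB_s\,C_s$ is the $d\times d$ matrix whose $(i,j)$ entry is $\sum_{k=1}^{d}\sum_{r=1}^{d}\int_0^t A_s(i,k)C_s(r,j)\,dB_s(k,r)$ (Itô integrals), where $A_s(i,k)$, $C_s(r,j)$, $B_s(k,r)$ denote matrix entries. Similarly, $\int_0^t C_s\,dB_s^{T}A_s$ has $(i,j)$ entry $\sum_{k,r=1}^{d}\int_0^t C_s(i,k)A_s(r,j)\,dB_s(r,k)$. *)

theory Defs
  imports "HOL-Probability.Probability"
begin

section \<open>Functions of symmetric matrices\<close>

definition sym_mats :: "(real^'n^'n) set" where
  "sym_mats = {A. transpose A = A}"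

definition psd_mats :: "(real^'n^'n) set" where
  "psd_mats = {A \<in> sym_mats. \<forall>x. 0 \<le> x \<bullet> (A *v x)}"

definition diag_mat :: "('n \<Rightarrow> real) \<Rightarrow> real^'n^'n" where
  "diag_mat l = (\<chi> i j. if i = j then l i else 0)"

definition spectral_decomp :: "real^'n^'n \<Rightarrow> real^'n^'n \<Rightarrow> ('n \<Rightarrow> real) \<Rightarrow> bool" where
  "spectral_decomp A H l \<longleftrightarrow>
     orthogonal_matrix H \<and> A = H ** diag_mat l ** transpose H"

text \<open>The index type carries no order, so the eigenvalues are not listed increasingly. The matrix
  \<open>H ** diag_mat (h \<circ> l) ** transpose H\<close> is the same for every spectral decomposition of \<open>A\<close>; it is
  only meaningful for symmetric \<open>A\<close>.\<close>

definition mat_fun :: "(real \<Rightarrow> real) \<Rightarrow> real^'n^'n \<Rightarrow> real^'n^'n" where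
  "mat_fun h A =
     (SOME Y. \<exists>H l. spectral_decomp A H l \<and> Y = H ** diag_mat (h \<circ> l) ** transpose H)"

definition matrix_lipschitz :: "(real^'n^'n \<Rightarrow> real^'n^'n) \<Rightarrow> bool" where
  "matrix_lipschitz h \<longleftrightarrow>
     (\<exists>c>0. \<forall>A1\<in>sym_mats. \<forall>A2\<in>sym_mats. \<forall>x. norm x = 1 \<longrightarrow>
        x \<bullet> (((h A1 - h A2) ** (h A1 - h A2)) *v x)
          \<le> c * (x \<bullet> (((A1 - A2) ** (A1 - A2)) *v x)))"

section \<open>Brownian motion\<close>

text \<open>Processes are functions of a real time parameter; only nonnegative times matter.\<close>

definition standard_brownian :: "'w measure \<Rightarrow> (real \<Rightarrow> 'w \<Rightarrow> real) \<Rightarrow> bool" where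
  "standard_brownian M W \<longleftrightarrow>
     (\<forall>t\<ge>0. W t \<in> borel_measurable M) \<and>
     (AE \<omega> in M. W 0 \<omega> = 0) \<and>
     (AE \<omega> in M. continuous_on {0..} (\<lambda>t. W t \<omega>)) \<and>
     (\<forall>s t. 0 \<le> s \<longrightarrow> s < t \<longrightarrow>
        distributed M lborel (\<lambda>\<omega>. W t \<omega> - W s \<omega>) (normal_density 0 (sqrt (t - s)))) \<and>
     (\<forall>(n::nat) \<tau>. 0 \<le> \<tau> 0 \<longrightarrow> strict_mono_on {..n} \<tau> \<longrightarrow>
        prob_space.indep_vars M (\<lambda>_. borel) (\<lambda>i \<omega>. W (\<tau> (Suc i)) \<omega> - W (\<tau> i) \<omega>) {..<n})"

text \<open>Independence of the entries is independence of whole paths, seen as random elements of the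
  product space over \<open>{0..}\<close>.\<close>

definition matrix_brownian :: "'w measure \<Rightarrow> (real \<Rightarrow> 'w \<Rightarrow> real^'n^'n) \<Rightarrow> bool" where
  "matrix_brownian M B \<longleftrightarrow>
     (\<forall>i j. standard_brownian M (\<lambda>t \<omega>. B t \<omega> $ i $ j)) \<and>
     prob_space.indep_vars M (\<lambda>_. PiM {0..} (\<lambda>_. borel))
       (\<lambda>(i, j) \<omega>. restrict (\<lambda>t. B t \<omega> $ i $ j) {0..}) UNIV"

text \<open>The augmentation of the natural filtration of \<open>B\<close>. The space need not be complete: adjoining
  the measurable null sets is enough, and on a complete space these are all the negligible sets.\<close>

definition brownian_augmentation ::
    "'w measure \<Rightarrow> (real \<Rightarrow> 'w \<Rightarrow> real^'n^'n) \<Rightarrow> real \<Rightarrow> 'w measure" where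
  "brownian_augmentation M B t =
     sigma (space M)
       ({B s -` S \<inter> space M | s S. s \<in> {0..t} \<and> S \<in> sets borel} \<union> null_sets M)"

definition brownian_filtration ::
    "'w measure \<Rightarrow> (real \<Rightarrow> 'w measure) \<Rightarrow> (real \<Rightarrow> 'w \<Rightarrow> real^'n^'n) \<Rightarrow> bool" where
  "brownian_filtration M F B \<longleftrightarrow>
     filtration (space M) F \<and>
     (\<forall>t. subalgebra M (F t)) \<and>
     (\<forall>t\<ge>0. B t \<in> borel_measurable (F t)) \<and>
     (\<forall>s t. 0 \<le> s \<longrightarrow> s < t \<longrightarrow>
        prob_space.indep_set M (sets (F s))
          (sets (vimage_algebra (space M) (\<lambda>\<omega>. B t \<omega> - B s \<omega>) borel)))"

section \<open>The Ito integral\<close>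

text \<open>Data \<open>n, \<tau>, \<xi>\<close> of the elementary integrand
  \<open>\<Sum>i<n. \<xi> i * indicator {\<tau> i<..\<tau> (Suc i)}\<close>.\<close>

definition simple_integrand ::
    "'w measure \<Rightarrow> (real \<Rightarrow> 'w measure) \<Rightarrow> nat \<Rightarrow> (nat \<Rightarrow> real) \<Rightarrow> (nat \<Rightarrow> 'w \<Rightarrow> real) \<Rightarrow> bool" where
  "simple_integrand M F n \<tau> \<xi> \<longleftrightarrow>
     0 \<le> \<tau> 0 \<and> strict_mono_on {..n} \<tau> \<and>
     (\<forall>i<n. \<xi> i \<in> borel_measurable (F (\<tau> i)) \<and> bounded (\<xi> i ` space M))"

definition simple_process ::
    "nat \<Rightarrow> (nat \<Rightarrow> real) \<Rightarrow> (nat \<Rightarrow> 'w \<Rightarrow> real) \<Rightarrow> real \<Rightarrow> 'w \<Rightarrow> real" where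
  "simple_process n \<tau> \<xi> s \<omega> = (\<Sum>i<n. \<xi> i \<omega> * indicator {\<tau> i<..\<tau> (Suc i)} s)"

definition simple_ito ::
    "(real \<Rightarrow> 'w \<Rightarrow> real) \<Rightarrow> nat \<Rightarrow> (nat \<Rightarrow> real) \<Rightarrow> (nat \<Rightarrow> 'w \<Rightarrow> real) \<Rightarrow> real \<Rightarrow> 'w \<Rightarrow> real" where
  "simple_ito W n \<tau> \<xi> t \<omega> =
     (\<Sum>i<n. \<xi> i \<omega> * (W (min t (\<tau> (Suc i))) \<omega> - W (min t (\<tau> i)) \<omega>))"

text \<open>\<open>is_ito_integral M F W H Y\<close>: the process \<open>Y\<close> is a continuous version of
  \<open>t \<mapsto> \<integral>\<^sub>0\<^sup>t H dW\<close>, for a measurable adapted integrand \<open>H\<close> that is square integrable on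
  \<open>[0,T] \<times> \<Omega>\<close> for every \<open>T\<close>; its value at \<open>T\<close> is the mean square limit of the integrals of
  elementary integrands which approximate \<open>H\<close> in mean square on \<open>[0,T] \<times> \<Omega>\<close>.\<close>

definition is_ito_integral ::
    "'w measure \<Rightarrow> (real \<Rightarrow> 'w measure) \<Rightarrow> (real \<Rightarrow> 'w \<Rightarrow> real) \<Rightarrow>
     (real \<Rightarrow> 'w \<Rightarrow> real) \<Rightarrow> (real \<Rightarrow> 'w \<Rightarrow> real) \<Rightarrow> bool" where
  "is_ito_integral M F W H Y \<longleftrightarrow>
     (\<lambda>(s, \<omega>). H s \<omega>) \<in> borel_measurable (restrict_space borel {0..} \<Otimes>\<^sub>M M) \<and>
     (\<forall>s\<ge>0. H s \<in> borel_measurable (F s)) \<and>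
     (\<forall>T\<ge>0. (\<integral>\<^sup>+\<omega>. (\<integral>\<^sup>+s\<in>{0..T}. ennreal ((H s \<omega>)\<^sup>2) \<partial>lborel) \<partial>M) < \<infinity>) \<and>
     (\<forall>t\<ge>0. Y t \<in> borel_measurable M) \<and>
     (\<forall>\<omega>\<in>space M. continuous_on {0..} (\<lambda>t. Y t \<omega>)) \<and>
     (\<forall>T\<ge>0. \<exists>n \<tau> \<xi>.
        (\<forall>m::nat. simple_integrand M F (n m) (\<tau> m) (\<xi> m)) \<and>
        (\<lambda>m. \<integral>\<^sup>+\<omega>. (\<integral>\<^sup>+s\<in>{0..T}.
             ennreal ((H s \<omega> - simple_process (n m) (\<tau> m) (\<xi> m) s \<omega>)\<^sup>2) \<partial>lborel) \<partial>M)
          \<longlonglongrightarrow> 0 \<and>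
        (\<lambda>m. \<integral>\<^sup>+\<omega>. ennreal ((Y T \<omega> - simple_ito W (n m) (\<tau> m) (\<xi> m) T \<omega>)\<^sup>2) \<partial>M)
          \<longlonglongrightarrow> 0)"

text \<open>The matrix integral \<open>\<integral> A dW C\<close>. For \<open>\<integral> C dB\<^sup>T A\<close> one takes the transpose of \<open>B\<close> as
  integrator.\<close>

definition is_matrix_ito_integral ::
    "'w measure \<Rightarrow> (real \<Rightarrow> 'w measure) \<Rightarrow> (real \<Rightarrow> 'w \<Rightarrow> real^'n^'n) \<Rightarrow>
     (real \<Rightarrow> 'w \<Rightarrow> real^'n^'n) \<Rightarrow> (real \<Rightarrow> 'w \<Rightarrow> real^'n^'n) \<Rightarrow>
     (real \<Rightarrow> 'w \<Rightarrow> real^'n^'n) \<Rightarrow> bool" where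
  "is_matrix_ito_integral M F A W C J \<longleftrightarrow>
     (\<exists>Y. (\<forall>i j k r. is_ito_integral M F (\<lambda>s \<omega>. W s \<omega> $ k $ r)
              (\<lambda>s \<omega>. A s \<omega> $ i $ k * C s \<omega> $ r $ j) (Y i j k r)) \<and>
          (\<forall>t\<ge>0. \<forall>\<omega>\<in>space M. \<forall>i j. J t \<omega> $ i $ j = (\<Sum>k\<in>UNIV. \<Sum>r\<in>UNIV. Y i j k r t \<omega>)))"

section \<open>Solutions\<close>

text \<open>The coefficients \<open>b, g, f\<close> are functions on symmetric matrices. A solution is a continuous,
  adapted process with values in the symmetric matrices.\<close>

definition sde_solution ::
    "'w measure \<Rightarrow> (real \<Rightarrow> 'w measure) \<Rightarrow> (real \<Rightarrow> 'w \<Rightarrow> real^'n^'n) \<Rightarrow>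
     (real^'n^'n \<Rightarrow> real^'n^'n) \<Rightarrow> (real^'n^'n \<Rightarrow> real^'n^'n) \<Rightarrow> (real^'n^'n \<Rightarrow> real^'n^'n) \<Rightarrow>
     real^'n^'n \<Rightarrow> (real \<Rightarrow> 'w \<Rightarrow> real^'n^'n) \<Rightarrow> bool" where
  "sde_solution M F B b g f X0 X \<longleftrightarrow>
     (\<forall>t\<ge>0. X t \<in> borel_measurable (F t)) \<and>
     (\<forall>\<omega>\<in>space M. continuous_on {0..} (\<lambda>t. X t \<omega>)) \<and>
     (\<forall>t\<ge>0. \<forall>\<omega>\<in>space M. X t \<omega> \<in> sym_mats) \<and>
     (\<exists>J K.
        is_matrix_ito_integral M F
          (\<lambda>s \<omega>. g (X s \<omega>)) B (\<lambda>s \<omega>. f (X s \<omega>)) J \<and>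
        is_matrix_ito_integral M F
          (\<lambda>s \<omega>. f (X s \<omega>)) (\<lambda>s \<omega>. transpose (B s \<omega>)) (\<lambda>s \<omega>. g (X s \<omega>)) K \<and>
        (AE \<omega> in M. \<forall>t\<ge>0.
           set_integrable lborel {0..t} (\<lambda>s. b (X s \<omega>)) \<and>
           X t \<omega> = X0 + (LINT s:{0..t}|lborel. b (X s \<omega>)) + J t \<omega> + K t \<omega>))"

definition strong_solution ::
    "'w measure \<Rightarrow> (real \<Rightarrow> 'w \<Rightarrow> real^'n^'n) \<Rightarrow>
     (real^'n^'n \<Rightarrow> real^'n^'n) \<Rightarrow> (real^'n^'n \<Rightarrow> real^'n^'n) \<Rightarrow> (real^'n^'n \<Rightarrow> real^'n^'n) \<Rightarrow>
     real^'n^'n \<Rightarrow> (real \<Rightarrow> 'w \<Rightarrow> real^'n^'n) \<Rightarrow> bool" where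
  "strong_solution M B b g f X0 X \<longleftrightarrow>
     sde_solution M (brownian_augmentation M B) B b g f X0 X"

definition indistinguishable ::
    "'w measure \<Rightarrow> (real \<Rightarrow> 'w \<Rightarrow> 'e) \<Rightarrow> (real \<Rightarrow> 'w \<Rightarrow> 'e) \<Rightarrow> bool" where
  "indistinguishable M X Y \<longleftrightarrow> (AE \<omega> in M. \<forall>t\<ge>0. X t \<omega> = Y t \<omega>)"

end

theory Submission
  imports Defs
begin

text \<open>This is Ito's existence and uniqueness theorem, transported to symmetric matrices, and it rests on
one inequality. For an input process \<open>X\<close> let \<open>P\<close> be the right-hand side of the equation evaluated
along \<open>X\<close>. If \<open>X, X'\<close> are two inputs with outputs \<open>P, P'\<close>, then
\<open>E \<bar>P t - P' t\<bar>\<^sup>2 \<le> C * \<integral>\<^sub>0\<^sup>t E (min 1 \<bar>X s - X' s\<bar>)\<^sup>2 ds\<close> with \<open>C\<close> locally bounded in \<open>t\<close>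
(\<open>sde_step_difference\<close>). The truncation at 1 can be afforded because the coefficients are bounded,
and it makes the right-hand side finite before any moment of a solution is known. If \<open>X\<close> and \<open>X'\<close>
both solve the equation, iterating the inequality bounds their distance by \<open>(C t)^n / n!\<close> for every
\<open>n\<close>, so they agree (\<open>sde_unique\<close>). If they are successive Picard iterates, the same computation bounds
the mean squares of the truncated increments of the iteration by \<open>(C t)^n / n!\<close>; Kolmogorov's maximal inequality and the
Borel-Cantelli lemma then give almost surely locally uniform convergence, and the limit is a fixed
point (\<open>sde_exists\<close>).

The matrix hypotheses reduce to the usual ones. For symmetric \<open>D\<close> one has \<open>x \<bullet> (D\<^sup>2 x) = \<bar>D x\<bar>\<^sup>2\<close>, so the
matrix Lipschitz condition, tested on the coordinate vectors and added up, is the Lipschitz condition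
in the Frobenius norm (\<open>matrix_lipschitz_imp_lipschitz\<close>); by the spectral theorem a bounded function of
a symmetric matrix is a symmetric matrix with bounded entries (\<open>mat_fun_entry_bound\<close>). Precomposing with
the projection \<open>sym_part\<close> extends the coefficients to all matrices, so that the iteration runs in a
vector space. The iterates stay symmetric because the second stochastic integral is the transpose of
the first one.

The Ito integral is accessible only through approximating elementary integrands. Its isometry is
proved as a bilinear identity between two elementary integrals with unrelated partitions, which avoids
common refinements (\<open>simple_ito_product\<close>). For general integrals the estimate
\<open>E (Y T - Y' T)\<^sup>2 \<le> 9 * E \<integral>\<^sub>0\<^sup>T (H - H')\<^sup>2 ds\<close> is enough; the factor 9 comes from applying
\<open>(a + b + c)\<^sup>2 \<le> 3 * (a\<^sup>2 + b\<^sup>2 + c\<^sup>2)\<close> twice. The integral of a bounded adapted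
integrand with continuous paths is the almost sure limit of elementary integrals along dyadic grids
(\<open>ito_integral_exists\<close>).

All of this takes place in a filtration that contains the null sets and for which the increments of
each entry of \<open>B\<close> are independent of the past. The augmentation of the natural filtration is of this
kind (\<open>adapted_brownian_augmentation\<close>): independence of the increments within an entry is extended to
the past of all entries by the independence of the entries. A solution adapted to some other Brownian
filtration \<open>F\<close> is compared with the strong solution in the augmentation of \<open>F\<close>, to which both are adapted.\<close>

section \<open>Spectral theorem for symmetric matrices\<close>

text \<open>A maximiser of the Rayleigh quotient on the unit sphere of the subspace is an eigenvector.\<close>

lemma exists_eigenvector_in_invariant_subspace:
  fixes f :: "'a::euclidean_space \<Rightarrow> 'a"
  assumes f: "linear f" and sa: "\<And>x y. f x \<bullet> y = x \<bullet> f y"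
    and S: "subspace S" and inv: "f ` S \<subseteq> S" and ne: "S \<noteq> {0}"
  shows "\<exists>v\<in>S. norm v = 1 \<and> (\<exists>l. f v = l *\<^sub>R v)"
proof -
  have "0 \<in> S" using S by (rule subspace_0)
  with ne obtain u where u: "u \<in> S" "u \<noteq> 0" by blast
  define K where "K = S \<inter> sphere 0 1"
  have "closed S" using S by (rule closed_subspace)
  then have K: "compact K" unfolding K_def by (simp add: closed_Int_compact)
  have "u /\<^sub>R norm u \<in> K" using u S by (auto simp: K_def subspace_scale)
  then have "K \<noteq> {}" by blast
  moreover have "continuous_on K (\<lambda>x. x \<bullet> f x)"
    by (intro continuous_intros linear_continuous_on_compose[OF _ f])
  ultimately obtain v where v: "v \<in> K" and max: "\<And>y. y \<in> K \<Longrightarrow> y \<bullet> f y \<le> v \<bullet> f v"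
    using continuous_attains_sup[OF K] by metis
  define l where "l = v \<bullet> f v"
  have vS: "v \<in> S" and nv: "norm v = 1" using v by (auto simp: K_def)
  have rayleigh: "y \<bullet> f y \<le> l * (y \<bullet> y)" if "y \<in> S" for y
  proof (cases "y = 0")
    case False
    have "y /\<^sub>R norm y \<in> K" using that S False by (auto simp: K_def subspace_scale)
    from max[OF this] have "(y \<bullet> f y) / (norm y * norm y) \<le> l"
      using f by (simp add: l_def linear_scale divide_inverse mult_ac)
    then show ?thesis using False
      by (simp add: divide_le_eq power2_norm_eq_inner[symmetric] power2_eq_square[symmetric])
  qed simp
  define r where "r = f v - l *\<^sub>R v"
  have rS: "r \<in> S" using vS inv S by (auto simp: r_def subspace_diff subspace_scale)
  define C where "C = l * (r \<bullet> r) - r \<bullet> f r"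
  \<comment> \<open>The first-order condition at the maximiser, tested in the direction of the residual.\<close>
  have first_order: "2 * t * (r \<bullet> r) \<le> t\<^sup>2 * C" for t
  proof -
    have 1: "(v + t *\<^sub>R r) \<bullet> f (v + t *\<^sub>R r) \<le> l * ((v + t *\<^sub>R r) \<bullet> (v + t *\<^sub>R r))"
      by (rule rayleigh) (use vS rS S in \<open>auto simp: subspace_add subspace_scale\<close>)
    have 2: "v \<bullet> f r = r \<bullet> f v" using sa[of v r] by (simp add: inner_commute)
    have 3: "v \<bullet> v = 1" using nv by (simp add: dot_square_norm)
    have 4: "f v = r + l *\<^sub>R v" by (simp add: r_def)
    have 5: "v \<bullet> f v = l" by (simp add: l_def)
    have 6: "r \<bullet> f v = r \<bullet> r + l * (r \<bullet> v)" by (simp add: 4 inner_add_right)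
    have "l + 2 * t * (r \<bullet> f v) + t\<^sup>2 * (r \<bullet> f r) \<le> l * (1 + 2 * t * (r \<bullet> v) + t\<^sup>2 * (r \<bullet> r))"
      using 1 f by (simp add: linear_add linear_scale inner_add_left inner_add_right 2 3 5
          inner_commute[of v r] power2_eq_square algebra_simps)
    then show ?thesis unfolding 6 C_def by (simp add: algebra_simps)
  qed
  have "r = 0"
  proof (rule ccontr)
    assume "r \<noteq> 0"
    then have a: "r \<bullet> r > 0" by simp
    \<comment> \<open>For small positive \<open>t\<close> the linear term of the first-order condition dominates.\<close>
    define t where "t = (r \<bullet> r) / (\<bar>C\<bar> + 1)"
    have t: "t > 0" using a by (simp add: t_def add_nonneg_pos)
    have "t * (2 * (r \<bullet> r)) \<le> t * (t * C)"
      using first_order[of t] by (simp add: power2_eq_square algebra_simps)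
    then have "2 * (r \<bullet> r) \<le> t * C" using t by simp
    also have "\<dots> \<le> t * (\<bar>C\<bar> + 1)" using t by (intro mult_left_mono) auto
    also have "\<dots> = r \<bullet> r" by (simp add: t_def)
    finally show False using a by simp
  qed
  then show ?thesis using vS nv by (auto simp: r_def intro!: bexI[of _ v] exI[of _ l])
qed

text \<open>Induction on the dimension: the orthogonal complement of an eigenvector inside the invariant
subspace is again invariant, because the map is self-adjoint.\<close>

lemma exists_orthonormal_eigenbasis:
  fixes f :: "'a::euclidean_space \<Rightarrow> 'a"
  assumes f: "linear f" and sa: "\<And>x y. f x \<bullet> y = x \<bullet> f y"
    and S: "subspace S" and inv: "f ` S \<subseteq> S"
  shows "\<exists>B. pairwise orthogonal B \<and> (\<forall>v\<in>B. norm v = 1 \<and> (\<exists>l. f v = l *\<^sub>R v)) \<and> span B = S"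
  using S inv
proof (induction "dim S" arbitrary: S rule: less_induct)
  case less
  show ?case
  proof (cases "S = {0}")
    case True
    then show ?thesis by (intro exI[of _ "{}"]) (auto simp: pairwise_empty)
  next
    case False
    obtain v l where v: "v \<in> S" "norm v = 1" and l: "f v = l *\<^sub>R v"
      using exists_eigenvector_in_invariant_subspace[OF f sa less.prems False] by blast
    define T where "T = {x \<in> S. x \<bullet> v = 0}"
    have vv: "v \<bullet> v = 1" using v(2) by (simp add: dot_square_norm)
    have T: "subspace T"
      using less.prems(1) by (auto simp: T_def subspace_def inner_add_left)
    have invT: "f ` T \<subseteq> T"
      using less.prems(2) sa l by (auto simp: T_def)
    have "v \<notin> T" using vv by (simp add: T_def)
    moreover have "T \<subseteq> S" by (auto simp: T_def)
    ultimately have "T \<subset> S" using v(1) by blast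
    then have "dim T < dim S"
      using T less.prems(1) by (metis dim_psubset span_eq_iff)
    from less.hyps[OF this T invT] obtain B where B: "pairwise orthogonal B"
      "\<forall>v\<in>B. norm v = 1 \<and> (\<exists>l. f v = l *\<^sub>R v)" "span B = T" by blast
    have BT: "B \<subseteq> T" using B(3) span_superset by blast
    have "pairwise orthogonal (insert v B)"
      using B(1) BT by (auto simp: pairwise_insert T_def orthogonal_def inner_commute)
    moreover have "span (insert v B) = S"
    proof
      show "span (insert v B) \<subseteq> S"
        using BT v less.prems(1) by (intro span_minimal) (auto simp: T_def)
      show "S \<subseteq> span (insert v B)"
      proof
        fix x assume x: "x \<in> S"
        have "x - (x \<bullet> v) *\<^sub>R v \<in> T" using x v less.prems(1) vv
          by (auto simp: T_def subspace_diff subspace_scale inner_diff_left)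
        then show "x \<in> span (insert v B)" using B(3) by (auto simp: span_insert)
      qed
    qed
    ultimately show ?thesis using B(2) v l by (intro exI[of _ "insert v B"]) auto
  qed
qed

lemma symmetric_matrix_spectral_decomp:
  fixes A :: "real^'n^'n"
  assumes A: "A \<in> sym_mats"
  shows "\<exists>H l. spectral_decomp A H l"
proof -
  have tA: "transpose A = A" using A by (simp add: sym_mats_def)
  have sa: "(A *v x) \<bullet> y = x \<bullet> (A *v y)" for x y
    using dot_lmul_matrix[of x A y] transpose_matrix_vector[of A x] tA by simp
  obtain B :: "(real^'n) set" where B: "pairwise orthogonal B"
    "\<And>v. v \<in> B \<Longrightarrow> norm v = 1 \<and> (\<exists>l. A *v v = l *\<^sub>R v)" "span B = UNIV"
    using exists_orthonormal_eigenbasis[OF matrix_vector_mul_linear sa subspace_UNIV subset_UNIV]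
    by blast
  have "0 \<notin> B" using B(2) by force
  then have ind: "independent B" using B(1) by (intro pairwise_orthogonal_independent)
  have "card B = CARD('n)" using basis_card_eq_dim[of B UNIV] B(3) ind by (simp add: dim_UNIV)
  moreover have "finite B" using ind by (rule independent_imp_finite)
  ultimately obtain e :: "'n \<Rightarrow> real^'n" where e: "bij_betw e UNIV B"
    by (metis finite finite_same_card_bij)
  have eB: "e j \<in> B" for j using e by (auto simp: bij_betw_def)
  then have "\<forall>j. \<exists>l. A *v e j = l *\<^sub>R e j" using B(2) by blast
  then obtain l where l: "\<And>j. A *v e j = l j *\<^sub>R e j" by (auto dest!: choice)
  define H :: "real^'n^'n" where "H = (\<chi> i j. e j $ i)"
  have col: "column j H = e j" for j by (simp add: column_def H_def vec_eq_iff)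
  have inj: "e i \<noteq> e j" if "i \<noteq> j" for i j using e that by (auto simp: bij_betw_def inj_on_def)
  have H: "orthogonal_matrix H"
    unfolding orthogonal_matrix_orthonormal_columns col
    using B(1,2) eB inj by (auto simp: pairwise_def)
  have "(A ** H) $ i $ j = (H ** diag_mat l) $ i $ j" for i j
  proof -
    have "(A ** H) $ i $ j = (A *v e j) $ i"
      by (simp add: matrix_matrix_mult_def matrix_vector_mult_def H_def)
    also have "\<dots> = (H ** diag_mat l) $ i $ j"
      by (simp add: l matrix_matrix_mult_def diag_mat_def H_def if_distrib cong: if_cong)
    finally show ?thesis .
  qed
  then have AH: "A ** H = H ** diag_mat l" by (simp add: vec_eq_iff)
  have "A = A ** (H ** transpose H)" using H by (simp add: orthogonal_matrix_def)
  also have "\<dots> = H ** diag_mat l ** transpose H" by (simp add: matrix_mul_assoc AH)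
  finally show ?thesis using H unfolding spectral_decomp_def by blast
qed

lemma transpose_diag_mat [simp]: "transpose (diag_mat l) = diag_mat l"
  by (auto simp: diag_mat_def transpose_def vec_eq_iff)

text \<open>All properties of \<open>mat_fun h A\<close> below are read off from this form, which holds for whichever
decomposition the choice operator picks.\<close>

lemma mat_fun_eq:
  assumes "A \<in> sym_mats"
  shows "\<exists>H l. orthogonal_matrix H \<and> mat_fun h A = H ** diag_mat (h \<circ> l) ** transpose H"
proof -
  have "\<exists>Y H l. spectral_decomp A H l \<and> Y = H ** diag_mat (h \<circ> l) ** transpose H"
    using symmetric_matrix_spectral_decomp[OF assms] by blast
  from someI_ex[OF this] have "\<exists>H l. spectral_decomp A H l \<and>
      mat_fun h A = H ** diag_mat (h \<circ> l) ** transpose H"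
    unfolding mat_fun_def .
  then show ?thesis unfolding spectral_decomp_def by blast
qed

lemma mat_fun_symmetric: "A \<in> sym_mats \<Longrightarrow> mat_fun h A \<in> sym_mats"
  using mat_fun_eq[of A h] by (auto simp: sym_mats_def matrix_transpose_mul matrix_mul_assoc)

lemma orthogonal_matrix_entry_le_1:
  fixes H :: "real^'n^'n"
  assumes "orthogonal_matrix H" shows "\<bar>H $ i $ j\<bar> \<le> 1"
proof -
  have "norm (row i H) = 1"
    using assms by (simp add: orthogonal_matrix_orthonormal_rows)
  then show ?thesis using component_le_norm_cart[of "row i H" j] by (simp add: row_def)
qed

lemma mat_fun_entry_bound:
  fixes A :: "real^'n^'n" and K :: real
  assumes "A \<in> sym_mats" and h: "\<And>x. \<bar>h x\<bar> \<le> K"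
  shows "\<bar>mat_fun h A $ i $ j\<bar> \<le> CARD('n) * K"
proof -
  obtain H l where H: "orthogonal_matrix H" and
    eq: "mat_fun h A = H ** diag_mat (h \<circ> l) ** transpose H"
    using mat_fun_eq[OF assms(1)] by blast
  have "mat_fun h A $ i $ j = (\<Sum>k\<in>UNIV. H $ i $ k * h (l k) * H $ j $ k)"
    unfolding eq
    by (simp add: matrix_matrix_mult_def diag_mat_def transpose_def if_distrib cong: if_cong)
  also have "\<bar>\<dots>\<bar> \<le> (\<Sum>k\<in>UNIV. \<bar>H $ i $ k * h (l k) * H $ j $ k\<bar>)" by (rule sum_abs)
  also have "\<dots> \<le> (\<Sum>k\<in>(UNIV::'n set). K)"
  proof (rule sum_mono)
    fix k :: 'n
    have "\<bar>H $ i $ k\<bar> * \<bar>h (l k)\<bar> * \<bar>H $ j $ k\<bar> \<le> 1 * K * 1"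
      using orthogonal_matrix_entry_le_1[OF H] h order_trans[OF abs_ge_zero h]
      by (intro mult_mono) auto
    then show "\<bar>H $ i $ k * h (l k) * H $ j $ k\<bar> \<le> K" by (simp add: abs_mult)
  qed
  finally show ?thesis by simp
qed

section \<open>Lipschitz functions of symmetric matrices\<close>

lemma norm_matrix_sq: "(norm (A::real^'n^'m))\<^sup>2 = (\<Sum>i\<in>UNIV. \<Sum>j\<in>UNIV. (A $ i $ j)\<^sup>2)"
  unfolding power2_norm_eq_inner inner_vec_def by (simp add: power2_eq_square)

lemma symmetric_quadratic_form_sq:
  assumes "D \<in> sym_mats" shows "x \<bullet> ((D ** D) *v x) = (norm (D *v x))\<^sup>2"
proof -
  have "x v* D = D *v x"
    using assms transpose_matrix_vector[of D x] by (simp add: sym_mats_def)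
  then show ?thesis
    using dot_lmul_matrix[of x D "D *v x"]
    by (simp only: matrix_vector_mul_assoc power2_norm_eq_inner)
qed

lemma sym_mats_diff: "A \<in> sym_mats \<Longrightarrow> B \<in> sym_mats \<Longrightarrow> A - B \<in> sym_mats"
  by (simp add: sym_mats_def transpose_def vec_eq_iff)

text \<open>Testing the matrix inequality on the coordinate vectors bounds the columns of \<open>h A - h B\<close> one by one.
Adding up gives the Frobenius norm, which is the norm of the type \<^typ>\<open>real^'n^'n\<close>.\<close>

lemma matrix_lipschitz_imp_lipschitz:
  fixes h :: "real^'n^'n \<Rightarrow> real^'n^'n"
  assumes lip: "matrix_lipschitz h" and sym: "\<And>A. A \<in> sym_mats \<Longrightarrow> h A \<in> sym_mats"
  shows "\<exists>L\<ge>0. \<forall>A\<in>sym_mats. \<forall>B\<in>sym_mats. norm (h A - h B) \<le> L * norm (A - B)"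
proof -
  obtain c where c: "c > 0" and lip: "\<And>A B x. A \<in> sym_mats \<Longrightarrow> B \<in> sym_mats \<Longrightarrow> norm x = 1 \<Longrightarrow>
      x \<bullet> (((h A - h B) ** (h A - h B)) *v x) \<le> c * (x \<bullet> (((A - B) ** (A - B)) *v x))"
    using lip unfolding matrix_lipschitz_def by blast
  have cols: "(norm D)\<^sup>2 = (\<Sum>j\<in>UNIV. (norm (D *v axis j 1))\<^sup>2)" for D :: "real^'n^'n"
    unfolding norm_matrix_sq matrix_vector_mul_component power2_norm_eq_inner[of "_ *v _"]
      inner_vec_def
    by (subst sum.swap)
      (simp add: power2_eq_square matrix_vector_mult_def axis_def if_distrib cong: if_cong)
  have "norm (h A - h B) \<le> sqrt c * norm (A - B)" if AB: "A \<in> sym_mats" "B \<in> sym_mats" for A B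
  proof -
    have "(norm (h A - h B))\<^sup>2 \<le> (\<Sum>j\<in>UNIV. c * (norm ((A - B) *v axis j 1))\<^sup>2)"
      unfolding cols[of "h A - h B"]
      using lip[OF AB, of "axis _ 1"]
      by (intro sum_mono) (simp add: symmetric_quadratic_form_sq sym_mats_diff AB sym)
    also have "\<dots> = (sqrt c * norm (A - B))\<^sup>2"
      using c by (simp add: cols[of "A - B"] sum_distrib_left power_mult_distrib)
    finally show ?thesis by (rule power2_le_imp_le) (use c in simp)
  qed
  then show ?thesis using c by (intro exI[of _ "sqrt c"]) auto
qed

text \<open>The orthogonal projection onto the symmetric matrices. It does not increase distances, hence it
extends Lipschitz functions on \<open>sym_mats\<close> to all matrices.\<close>

definition sym_part :: "real^'n^'n \<Rightarrow> real^'n^'n" where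
  "sym_part A = (1/2) *\<^sub>R (A + transpose A)"

lemma sym_part_in_sym_mats [simp]: "sym_part A \<in> sym_mats"
  by (simp add: sym_part_def sym_mats_def transpose_def vec_eq_iff)

lemma sym_part_ident [simp]: "A \<in> sym_mats \<Longrightarrow> sym_part A = A"
  by (simp add: sym_part_def sym_mats_def scaleR_half_double)

lemma norm_transpose: "norm (transpose A) = norm (A::real^'n^'n)"
proof (rule power2_eq_imp_eq)
  show "(norm (transpose A))\<^sup>2 = (norm A)\<^sup>2"
    unfolding norm_matrix_sq transpose_def vec_lambda_beta by (rule sum.swap)
qed (rule norm_ge_zero)+

lemma norm_sym_part_diff_le: "norm (sym_part A - sym_part B) \<le> norm (A - B)"
proof -
  have "sym_part A - sym_part B = (1/2) *\<^sub>R ((A - B) + transpose (A - B))"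
    unfolding sym_part_def transpose_def vec_eq_iff by (simp add: field_simps)
  then have "norm (sym_part A - sym_part B) = 1/2 * norm ((A - B) + transpose (A - B))" by simp
  also have "\<dots> \<le> 1/2 * (norm (A - B) + norm (transpose (A - B)))"
    by (intro mult_left_mono norm_triangle_ineq) simp
  finally show ?thesis by (simp add: norm_transpose)
qed

definition lipschitz_coefficient :: "(real^'n^'n \<Rightarrow> real^'n^'n) \<Rightarrow> bool" where
  "lipschitz_coefficient h \<longleftrightarrow> (\<forall>A. transpose (h A) = h A) \<and>
     (\<exists>K. \<forall>A i j. \<bar>h A $ i $ j\<bar> \<le> K) \<and> (\<exists>L\<ge>0. \<forall>A B. norm (h A - h B) \<le> L * norm (A - B))"

lemma lipschitz_coefficient_mat_fun:
  fixes h :: "real \<Rightarrow> real"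
  assumes "bounded (range h)" "matrix_lipschitz (mat_fun h :: real^'n^'n \<Rightarrow> real^'n^'n)"
  shows "lipschitz_coefficient (\<lambda>A. mat_fun h (sym_part A) :: real^'n^'n)"
proof -
  obtain K where "\<forall>x\<in>range h. \<bar>x\<bar> \<le> K" using assms(1) unfolding bounded_real by blast
  then have K: "\<bar>h x\<bar> \<le> K" for x by blast
  have "\<exists>L\<ge>0. \<forall>A\<in>sym_mats. \<forall>B\<in>sym_mats.
      norm (mat_fun h A - mat_fun h B :: real^'n^'n) \<le> L * norm (A - B)"
    by (rule matrix_lipschitz_imp_lipschitz[OF assms(2)]) (rule mat_fun_symmetric)
  then obtain L where L: "L \<ge> 0" "\<And>A B. A\<in>sym_mats \<Longrightarrow> B\<in>sym_mats \<Longrightarrow>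
      norm (mat_fun h A - mat_fun h B :: real^'n^'n) \<le> L * norm (A - B)"
    by blast
  have "transpose (mat_fun h (sym_part A)) = mat_fun h (sym_part A)" for A :: "real^'n^'n"
    using mat_fun_symmetric[OF sym_part_in_sym_mats, of h A] unfolding sym_mats_def by blast
  moreover have "norm (mat_fun h (sym_part A) - mat_fun h (sym_part B)) \<le> L * norm (A - B)"
    for A B :: "real^'n^'n"
    by (rule order_trans[OF L(2)[OF sym_part_in_sym_mats sym_part_in_sym_mats]
          mult_left_mono[OF norm_sym_part_diff_le L(1)]])
  moreover have "\<bar>mat_fun h (sym_part A) $ i $ j\<bar> \<le> CARD('n) * K" for A :: "real^'n^'n" and i j
    by (rule mat_fun_entry_bound[OF sym_part_in_sym_mats K])
  ultimately show ?thesis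
    unfolding lipschitz_coefficient_def using L(1) by blast
qed

section \<open>Moments of Brownian increments\<close>

locale filtered_prob_space = prob_space M for M :: "'w measure" +
  fixes F :: "real \<Rightarrow> 'w measure"
  assumes filtered: "filtration (space M) F"
    and subalg: "\<And>t. subalgebra M (F t)"
begin

lemma measurable_F_mono: "s \<le> t \<Longrightarrow> f \<in> measurable (F s) N \<Longrightarrow> f \<in> measurable (F t) N"
  using filtration.sets_F_mono[OF filtered, of s t] filtration.space_F[OF filtered]
  by (auto simp: measurable_def)

lemma measurable_F_M: "f \<in> measurable (F s) N \<Longrightarrow> f \<in> measurable M N"
  by (rule measurable_from_subalg[OF subalg])

lemma space_F [simp]: "space (F t) = space M"
  using filtration.space_F[OF filtered] .

lemma sets_F_M: "A \<in> sets (F t) \<Longrightarrow> A \<in> sets M"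
  using subalg by (auto simp: subalgebra_def)

end

text \<open>What the scalar stochastic calculus uses of a Brownian motion: Gaussian increments which are
independent of the past described by \<open>F\<close>, and continuous paths.\<close>

locale adapted_brownian = filtered_prob_space M F
  for M :: "'w measure" and F :: "real \<Rightarrow> 'w measure" +
  fixes W :: "real \<Rightarrow> 'w \<Rightarrow> real"
  assumes adapted: "\<And>t. 0 \<le> t \<Longrightarrow> W t \<in> borel_measurable (F t)"
    and increment_normal: "\<And>s t. 0 \<le> s \<Longrightarrow> s < t \<Longrightarrow>
      distributed M lborel (\<lambda>\<omega>. W t \<omega> - W s \<omega>) (normal_density 0 (sqrt (t - s)))"
    and increment_indep: "\<And>s t. 0 \<le> s \<Longrightarrow> s < t \<Longrightarrow>
      indep_set (sets (F s)) (sets (vimage_algebra (space M) (\<lambda>\<omega>. W t \<omega> - W s \<omega>) borel))"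
    and continuous_paths: "AE \<omega> in M. continuous_on {0..} (\<lambda>t. W t \<omega>)"
begin

lemma W_measurable [measurable]: "0 \<le> t \<Longrightarrow> W t \<in> borel_measurable M"
  using adapted measurable_F_M by blast

lemma W_measurable_F: "0 \<le> s \<Longrightarrow> s \<le> t \<Longrightarrow> W s \<in> borel_measurable (F t)"
  using adapted measurable_F_mono by blast

lemma increment_moments:
  assumes "0 \<le> s" "s < t"
  shows "integrable M (\<lambda>\<omega>. W t \<omega> - W s \<omega>)" "expectation (\<lambda>\<omega>. W t \<omega> - W s \<omega>) = 0"
    and "integrable M (\<lambda>\<omega>. (W t \<omega> - W s \<omega>)\<^sup>2)" "expectation (\<lambda>\<omega>. (W t \<omega> - W s \<omega>)\<^sup>2) = t - s"
proof -
  have pos: "sqrt (t - s) > 0" using assms by simp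
  note D = increment_normal[OF assms]
  have nn: "\<And>x. 0 \<le> normal_density 0 (sqrt (t - s)) x" by simp
  note int = distributed_integrable[OF D _ nn] and ex = distributed_integral[OF D _ nn]
  show "integrable M (\<lambda>\<omega>. W t \<omega> - W s \<omega>)"
    using int[of "\<lambda>x. x"] integrable_normal_moment[OF pos, of 0 1] by simp
  show "expectation (\<lambda>\<omega>. W t \<omega> - W s \<omega>) = 0"
    using ex[of "\<lambda>x. x"] integral_normal_moment_odd[OF pos, of 0 0] by simp
  show "integrable M (\<lambda>\<omega>. (W t \<omega> - W s \<omega>)\<^sup>2)"
    using int[of "\<lambda>x. x\<^sup>2"] integrable_normal_moment[OF pos, of 0 2] by simp
  show "expectation (\<lambda>\<omega>. (W t \<omega> - W s \<omega>)\<^sup>2) = t - s"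
    using ex[of "\<lambda>x. x\<^sup>2"] integral_normal_moment_even[OF pos, of 0 1] assms by simp
qed

lemma indep_var_increment:
  assumes "0 \<le> s" "s < t" and Z: "Z \<in> borel_measurable (F s)"
    and g: "g \<in> borel_measurable borel"
  shows "indep_var borel Z borel (\<lambda>\<omega>. g (W t \<omega> - W s \<omega>) :: real)"
proof -
  let ?D = "\<lambda>\<omega>. W t \<omega> - W s \<omega>"
  have D: "?D \<in> borel_measurable M" using assms by simp
  have "sigma_sets (space M) {Z -` A \<inter> space M |A. A \<in> sets borel} \<subseteq> sets (F s)"
    using measurable_sets[OF Z] sets.sigma_sets_subset[of "{Z -` A \<inter> space M |A. A \<in> sets borel}" "F s"]
    by auto
  moreover have "sigma_sets (space M) {?D -` A \<inter> space M |A. A \<in> sets borel}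
      \<subseteq> sets (vimage_algebra (space M) ?D borel)"
    by (simp add: sets_vimage_algebra)
  ultimately have "indep_set (sigma_sets (space M) {Z -` A \<inter> space M |A. A \<in> sets borel})
      (sigma_sets (space M) {?D -` A \<inter> space M |A. A \<in> sets borel})"
    using increment_indep[OF assms(1,2)] unfolding indep_sets2_eq by blast
  then have "indep_var borel Z borel ?D"
    unfolding indep_var_eq using D measurable_F_M[OF Z] by simp
  from indep_var_compose[OF this measurable_ident g] show ?thesis
    by (simp add: comp_def id_def)
qed

lemma increment_orthogonal:
  assumes "0 \<le> s" "s \<le> t" and Z: "Z \<in> borel_measurable (F s)" "integrable M Z"
  shows "integrable M (\<lambda>\<omega>. Z \<omega> * (W t \<omega> - W s \<omega>))"
    and "expectation (\<lambda>\<omega>. Z \<omega> * (W t \<omega> - W s \<omega>)) = 0"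
proof -
  have "integrable M (\<lambda>\<omega>. Z \<omega> * (W t \<omega> - W s \<omega>)) \<and> expectation (\<lambda>\<omega>. Z \<omega> * (W t \<omega> - W s \<omega>)) = 0"
  proof (cases "s = t")
    case False
    then have st: "s < t" using assms by simp
    note ind = indep_var_increment[OF assms(1) st Z(1), of "\<lambda>x. x"]
    show ?thesis
      using indep_var_integrable[OF ind Z(2)] indep_var_lebesgue_integral[OF ind Z(2)]
        increment_moments[OF assms(1) st] by simp
  qed simp
  then show "integrable M (\<lambda>\<omega>. Z \<omega> * (W t \<omega> - W s \<omega>))"
    and "expectation (\<lambda>\<omega>. Z \<omega> * (W t \<omega> - W s \<omega>)) = 0" by auto
qed

lemma increment_square:
  assumes "0 \<le> s" "s \<le> t" and Z: "Z \<in> borel_measurable (F s)" "integrable M Z"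
  shows "integrable M (\<lambda>\<omega>. Z \<omega> * (W t \<omega> - W s \<omega>)\<^sup>2)"
    and "expectation (\<lambda>\<omega>. Z \<omega> * (W t \<omega> - W s \<omega>)\<^sup>2) = expectation Z * (t - s)"
proof -
  have "integrable M (\<lambda>\<omega>. Z \<omega> * (W t \<omega> - W s \<omega>)\<^sup>2) \<and>
    expectation (\<lambda>\<omega>. Z \<omega> * (W t \<omega> - W s \<omega>)\<^sup>2) = expectation Z * (t - s)"
  proof (cases "s = t")
    case False
    then have st: "s < t" using assms by simp
    note ind = indep_var_increment[OF assms(1) st Z(1), of "\<lambda>x. x\<^sup>2"]
    show ?thesis
      using indep_var_integrable[OF ind Z(2)] indep_var_lebesgue_integral[OF ind Z(2)]
        increment_moments[OF assms(1) st] by simp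
  qed simp
  then show "integrable M (\<lambda>\<omega>. Z \<omega> * (W t \<omega> - W s \<omega>)\<^sup>2)"
    and "expectation (\<lambda>\<omega>. Z \<omega> * (W t \<omega> - W s \<omega>)\<^sup>2) = expectation Z * (t - s)" by auto
qed

text \<open>Everything known at time \<open>c\<close> is absorbed into the factor \<open>\<zeta>\<close>. The increment over \<open>{a<..b}\<close> is cut at
\<open>c\<close> and at \<open>min b d\<close>; every product with a piece of increment lying after all its other factors has
mean zero, and only the square of the increment over the common interval survives.\<close>

lemma covariance_adapted_increments_ordered:
  assumes ab: "0 \<le> a" "a \<le> b" and cd: "a \<le> c" "c \<le> d"
    and \<zeta>: "\<zeta> \<in> borel_measurable (F c)" "\<And>\<omega>. \<omega> \<in> space M \<Longrightarrow> \<bar>\<zeta> \<omega>\<bar> \<le> K"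
  shows "has_bochner_integral M (\<lambda>\<omega>. \<zeta> \<omega> * (W b \<omega> - W a \<omega>) * (W d \<omega> - W c \<omega>))
    (expectation \<zeta> * max 0 (min b d - c))"
proof -
  have c0: "0 \<le> c" using ab cd by simp
  have bdd: "integrable M (\<lambda>\<omega>. \<zeta> \<omega> * (W v \<omega> - W u \<omega>))" if "0 \<le> u" "u \<le> v" for u v
  proof (cases "u = v")
    case False
    have [measurable]: "\<zeta> \<in> borel_measurable M" using \<zeta> measurable_F_M by blast
    have "integrable M (\<lambda>\<omega>. K * (W v \<omega> - W u \<omega>))"
      using increment_moments(1)[of u v] False that by simp
    then show ?thesis
      by (rule Bochner_Integration.integrable_bound)
        (use that \<zeta>(2) in \<open>auto simp: abs_mult intro!: AE_I2 mult_right_mono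
          intro: order_trans[OF _ abs_ge_self]\<close>)
  qed simp
  have int\<zeta>: "integrable M \<zeta>"
    using \<zeta> measurable_F_M by (intro integrable_const_bound[of _ K]) auto
  show ?thesis
  proof (cases "b \<le> c")
    case True
    have "(\<lambda>\<omega>. \<zeta> \<omega> * (W b \<omega> - W a \<omega>)) \<in> borel_measurable (F c)"
      using \<zeta>(1) W_measurable_F[of a c] W_measurable_F[of b c] ab cd True by simp
    from increment_orthogonal[OF c0 cd(2) this bdd] ab show ?thesis
      using True cd by (simp add: has_bochner_integral_iff mult.assoc)
  next
    case False
    define m where "m = min b d"
    define N where "N = max b d"
    have m: "c \<le> m" "m \<le> N" "0 \<le> m" using False cd c0 by (auto simp: m_def N_def)
    have 1: "has_bochner_integral M (\<lambda>\<omega>. (\<zeta> \<omega> * (W c \<omega> - W a \<omega>)) * (W d \<omega> - W c \<omega>)) 0"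
    proof -
      have "(\<lambda>\<omega>. \<zeta> \<omega> * (W c \<omega> - W a \<omega>)) \<in> borel_measurable (F c)"
        using \<zeta>(1) W_measurable_F[of a c] W_measurable_F[of c c] ab cd c0 by simp
      from increment_orthogonal[OF c0 cd(2) this bdd] ab cd show ?thesis
        by (simp add: has_bochner_integral_iff)
    qed
    have 2: "has_bochner_integral M (\<lambda>\<omega>. \<zeta> \<omega> * (W m \<omega> - W c \<omega>)\<^sup>2) (expectation \<zeta> * (m - c))"
      using increment_square[OF c0 m(1) \<zeta>(1) int\<zeta>] by (simp add: has_bochner_integral_iff)
    have 3: "has_bochner_integral M (\<lambda>\<omega>. (\<zeta> \<omega> * (W m \<omega> - W c \<omega>)) * (W N \<omega> - W m \<omega>)) 0"
    proof -
      have "(\<lambda>\<omega>. \<zeta> \<omega> * (W m \<omega> - W c \<omega>)) \<in> borel_measurable (F m)"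
        using measurable_F_mono[OF m(1) \<zeta>(1)] W_measurable_F[of m m] W_measurable_F[of c m] m c0
        by simp
      from increment_orthogonal[OF m(3) m(2) this bdd[OF c0 m(1)]] show ?thesis
        by (simp add: has_bochner_integral_iff)
    qed
    have "\<zeta> \<omega> * (W b \<omega> - W a \<omega>) * (W d \<omega> - W c \<omega>) =
        \<zeta> \<omega> * (W c \<omega> - W a \<omega>) * (W d \<omega> - W c \<omega>) +
        (\<zeta> \<omega> * (W m \<omega> - W c \<omega>)\<^sup>2 + \<zeta> \<omega> * (W m \<omega> - W c \<omega>) * (W N \<omega> - W m \<omega>))" for \<omega>
    proof -
      have "(W b \<omega> - W c \<omega>) * (W d \<omega> - W c \<omega>) = (W m \<omega> - W c \<omega>) * (W N \<omega> - W c \<omega>)"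
        by (simp add: m_def N_def min_def max_def)
      then have "\<zeta> \<omega> * ((W b \<omega> - W c \<omega>) * (W d \<omega> - W c \<omega>)) =
          \<zeta> \<omega> * ((W m \<omega> - W c \<omega>) * (W N \<omega> - W c \<omega>))" by simp
      then show ?thesis by (simp add: power2_eq_square algebra_simps)
    qed
    then show ?thesis
      using has_bochner_integral_add[OF 1 has_bochner_integral_add[OF 2 3]] m(1) m_def by simp
  qed
qed

text \<open>The length of the intersection of the two intervals appears on the right, which is exactly the
integral of the product of their indicators. This is what makes the isometry insensitive to the
choice of the partitions.\<close>

lemma covariance_adapted_increments:
  assumes ab: "0 \<le> a" "a \<le> b" and cd: "0 \<le> c" "c \<le> d"
    and \<xi>: "\<xi> \<in> borel_measurable (F a)" "bounded (\<xi> ` space M)"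
    and \<eta>: "\<eta> \<in> borel_measurable (F c)" "bounded (\<eta> ` space M)"
  shows "has_bochner_integral M
      (\<lambda>\<omega>. (\<xi> \<omega> * (W b \<omega> - W a \<omega>)) * (\<eta> \<omega> * (W d \<omega> - W c \<omega>)))
      (expectation (\<lambda>\<omega>. \<xi> \<omega> * \<eta> \<omega>) * max 0 (min b d - max a c))"
proof -
  obtain K L where K: "\<And>\<omega>. \<omega> \<in> space M \<Longrightarrow> \<bar>\<xi> \<omega>\<bar> \<le> K" and L: "\<And>\<omega>. \<omega> \<in> space M \<Longrightarrow> \<bar>\<eta> \<omega>\<bar> \<le> L"
    using \<xi>(2) \<eta>(2) by (auto simp: bounded_real)
  have KL: "\<bar>\<xi> \<omega> * \<eta> \<omega>\<bar> \<le> K * L" if "\<omega> \<in> space M" for \<omega>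
    using K[OF that] L[OF that] unfolding abs_mult by (intro mult_mono) auto
  show ?thesis
  proof (cases "a \<le> c")
    case True
    then have "(\<lambda>\<omega>. \<xi> \<omega> * \<eta> \<omega>) \<in> borel_measurable (F c)"
      using measurable_F_mono[OF _ \<xi>(1)] \<eta>(1) by simp
    from covariance_adapted_increments_ordered[OF ab True cd(2) this KL] True show ?thesis
      by (simp add: ac_simps max_absorb2)
  next
    case False
    then have ca: "c \<le> a" by simp
    then have "(\<lambda>\<omega>. \<xi> \<omega> * \<eta> \<omega>) \<in> borel_measurable (F a)"
      using measurable_F_mono[OF _ \<eta>(1)] \<xi>(1) by simp
    from covariance_adapted_increments_ordered[OF cd ca ab(2) this KL] ca show ?thesis
      by (simp add: ac_simps max_absorb1)
  qed
qed

end

section \<open>Isometry for elementary integrands\<close>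

lemma simple_integrandD:
  assumes "simple_integrand M F n \<tau> \<xi>" "i < n"
  shows "0 \<le> \<tau> i" "\<tau> i < \<tau> (Suc i)" "\<xi> i \<in> borel_measurable (F (\<tau> i))" "bounded (\<xi> i ` space M)"
proof -
  have mono: "strict_mono_on {..n} \<tau>" and "0 \<le> \<tau> 0"
    using assms by (auto simp: simple_integrand_def)
  then show "0 \<le> \<tau> i" using assms(2)
    by (cases "i = 0") (auto dest!: strict_mono_onD[of _ _ 0 i] simp: le_less_trans less_imp_le)
  show "\<tau> i < \<tau> (Suc i)" using strict_mono_onD[OF mono, of i "Suc i"] assms(2) by auto
qed (use assms in \<open>auto simp: simple_integrand_def\<close>)

lemma lborel_integral_interval_overlap:
  fixes a b c d T :: real
  assumes "0 \<le> T" "0 \<le> a" "a \<le> b" "0 \<le> c" "c \<le> d"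
  shows "has_bochner_integral lborel
    (\<lambda>s. indicator {0..T} s * (indicator {a<..b} s * indicator {c<..d} s))
    (max 0 (min (min T b) (min T d) - max (min T a) (min T c)))"
proof -
  have eq: "(\<lambda>s. indicator {0..T} s * (indicator {a<..b} s * indicator {c<..d} s)) =
      (indicator {max a c<..min T (min b d)} :: real \<Rightarrow> real)"
    using assms by (auto simp: indicator_def fun_eq_iff)
  have "has_bochner_integral lborel (indicator {max a c<..min T (min b d)} :: real \<Rightarrow> real)
      (measure lborel {max a c<..min T (min b d)})"
  proof (rule has_bochner_integral_real_indicator)
    show "emeasure lborel {max a c<..min T (min b d)} < \<infinity>"
      by (cases "max a c \<le> min T (min b d)") auto
  qed simp
  moreover have "measure lborel {max a c<..min T (min b d)} =
      max 0 (min (min T b) (min T d) - max (min T a) (min T c))"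
  proof -
    have "measure lborel {u<..v} = max 0 (v - u)" for u v :: real by (cases "u \<le> v") auto
    moreover have "max 0 (min T (min b d) - max a c) =
        max 0 (min (min T b) (min T d) - max (min T a) (min T c))"
    proof -
      have "max (min T a) (min T c) = min T (max a c)" "min (min T b) (min T d) = min T (min b d)"
        by (auto simp: min_def max_def)
      moreover have "max 0 (min T v - u) = max 0 (min T v - min T u)" for u v
        by (auto simp: min_def max_def)
      ultimately show ?thesis by (simp only:)
    qed
    ultimately show ?thesis by (simp only:)
  qed
  ultimately show ?thesis unfolding eq by (simp only:)
qed

lemma simple_process_product_integral:
  assumes S: "simple_integrand M F n \<tau> \<xi>" and S': "simple_integrand M F n' \<tau>' \<xi>'" and T: "0 \<le> T"
  shows "has_bochner_integral lborel
    (\<lambda>s. indicator {0..T} s * (simple_process n \<tau> \<xi> s \<omega> * simple_process n' \<tau>' \<xi>' s \<omega>))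
    (\<Sum>i<n. \<Sum>j<n'. \<xi> i \<omega> * \<xi>' j \<omega> * max 0 (min (min T (\<tau> (Suc i))) (min T (\<tau>' (Suc j)))
        - max (min T (\<tau> i)) (min T (\<tau>' j))))"
proof -
  have "has_bochner_integral lborel
    (\<lambda>s. \<Sum>i<n. \<Sum>j<n'. \<xi> i \<omega> * \<xi>' j \<omega> *
      (indicator {0..T} s * (indicator {\<tau> i<..\<tau> (Suc i)} s * indicator {\<tau>' j<..\<tau>' (Suc j)} s)))
    (\<Sum>i<n. \<Sum>j<n'. \<xi> i \<omega> * \<xi>' j \<omega> * max 0 (min (min T (\<tau> (Suc i))) (min T (\<tau>' (Suc j)))
        - max (min T (\<tau> i)) (min T (\<tau>' j))))"
    by (intro has_bochner_integral_sum has_bochner_integral_mult_right lborel_integral_interval_overlap T)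
      (use simple_integrandD[OF S] simple_integrandD[OF S'] in \<open>auto intro: less_imp_le\<close>)
  also have "(\<lambda>s. \<Sum>i<n. \<Sum>j<n'. \<xi> i \<omega> * \<xi>' j \<omega> *
      (indicator {0..T} s * (indicator {\<tau> i<..\<tau> (Suc i)} s * indicator {\<tau>' j<..\<tau>' (Suc j)} s))) =
    (\<lambda>s. indicator {0..T} s * (simple_process n \<tau> \<xi> s \<omega> * simple_process n' \<tau>' \<xi>' s \<omega>))"
    unfolding simple_process_def sum_product unfolding sum_distrib_left
    by (intro ext sum.cong refl) (simp only: ac_simps)
  finally show ?thesis .
qed

context adapted_brownian
begin

lemma simple_ito_adapted:
  assumes S: "simple_integrand M F n \<tau> \<xi>" and t: "0 \<le> t"
  shows "simple_ito W n \<tau> \<xi> t \<in> borel_measurable (F t)"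
proof -
  have "(\<lambda>\<omega>. \<xi> i \<omega> * (W (min t (\<tau> (Suc i))) \<omega> - W (min t (\<tau> i)) \<omega>)) \<in> borel_measurable (F t)"
    if i: "i < n" for i
  proof (cases "\<tau> i \<le> t")
    case True
    have [measurable]: "\<xi> i \<in> borel_measurable (F t)"
      using measurable_F_mono[OF True] simple_integrandD(3)[OF S i] by blast
    have [measurable]: "W (min t (\<tau> (Suc i))) \<in> borel_measurable (F t)"
      "W (min t (\<tau> i)) \<in> borel_measurable (F t)"
      using simple_integrandD(1,2)[OF S i] t by (auto intro!: W_measurable_F)
    show ?thesis by measurable
  next
    case False
    then show ?thesis using simple_integrandD(2)[OF S i] by (simp add: min_absorb1)
  qed
  then show ?thesis unfolding simple_ito_def[abs_def] by (intro borel_measurable_sum) auto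
qed

text \<open>The bilinear form of the isometry. Both sides expand into the same double sum over pairs of
partition intervals, by \<open>covariance_adapted_increments\<close> on the left and
\<open>simple_process_product_integral\<close> on the right.\<close>

lemma simple_ito_product:
  assumes S: "simple_integrand M F n \<tau> \<xi>" and S': "simple_integrand M F n' \<tau>' \<xi>'" and T: "0 \<le> T"
  shows "integrable M (\<lambda>\<omega>. simple_ito W n \<tau> \<xi> T \<omega> * simple_ito W n' \<tau>' \<xi>' T \<omega>)"
    and "integrable M (\<lambda>\<omega>. LINT s|lborel.
      indicator {0..T} s * (simple_process n \<tau> \<xi> s \<omega> * simple_process n' \<tau>' \<xi>' s \<omega>))"
    and "expectation (\<lambda>\<omega>. simple_ito W n \<tau> \<xi> T \<omega> * simple_ito W n' \<tau>' \<xi>' T \<omega>) =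
      expectation (\<lambda>\<omega>. LINT s|lborel.
        indicator {0..T} s * (simple_process n \<tau> \<xi> s \<omega> * simple_process n' \<tau>' \<xi>' s \<omega>))"
proof -
  let ?len = "\<lambda>i j. max 0 (min (min T (\<tau> (Suc i))) (min T (\<tau>' (Suc j)))
        - max (min T (\<tau> i)) (min T (\<tau>' j)))"
  let ?X = "\<lambda>i \<omega>. \<xi> i \<omega> * (W (min T (\<tau> (Suc i))) \<omega> - W (min T (\<tau> i)) \<omega>)"
  let ?X' = "\<lambda>i \<omega>. \<xi>' i \<omega> * (W (min T (\<tau>' (Suc i))) \<omega> - W (min T (\<tau>' i)) \<omega>)"
  have int: "integrable M (\<lambda>\<omega>. \<xi> i \<omega> * \<xi>' j \<omega>)" if ij: "i < n" "j < n'" for i j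
  proof -
    obtain K L where K: "\<And>\<omega>. \<omega> \<in> space M \<Longrightarrow> \<bar>\<xi> i \<omega>\<bar> \<le> K" and L: "\<And>\<omega>. \<omega> \<in> space M \<Longrightarrow> \<bar>\<xi>' j \<omega>\<bar> \<le> L"
      using simple_integrandD(4)[OF S ij(1)] simple_integrandD(4)[OF S' ij(2)]
      by (auto simp: bounded_real)
    have "\<bar>\<xi> i \<omega> * \<xi>' j \<omega>\<bar> \<le> K * L" if "\<omega> \<in> space M" for \<omega>
      using K[OF that] L[OF that] unfolding abs_mult by (intro mult_mono) auto
    then show ?thesis
      using measurable_F_M[OF simple_integrandD(3)[OF S ij(1)]]
        measurable_F_M[OF simple_integrandD(3)[OF S' ij(2)]]
      by (intro integrable_const_bound[of _ "K * L"]) auto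
  qed
  have cov: "has_bochner_integral M (\<lambda>\<omega>. ?X i \<omega> * ?X' j \<omega>)
      (expectation (\<lambda>\<omega>. \<xi> i \<omega> * \<xi>' j \<omega>) * ?len i j)" if ij: "i < n" "j < n'" for i j
  proof (cases "\<tau> i \<le> T \<and> \<tau>' j \<le> T")
    case True
    then show ?thesis
      using covariance_adapted_increments[of "min T (\<tau> i)" "min T (\<tau> (Suc i))"
          "min T (\<tau>' j)" "min T (\<tau>' (Suc j))" "\<xi> i" "\<xi>' j"]
        simple_integrandD[OF S ij(1)] simple_integrandD[OF S' ij(2)] T
      by (simp add: min_absorb2)
  next
    case False
    then have "(\<lambda>\<omega>. ?X i \<omega> * ?X' j \<omega>) = (\<lambda>_. 0)" and "?len i j = 0"
      using simple_integrandD(2)[OF S ij(1)] simple_integrandD(2)[OF S' ij(2)] by auto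
    then show ?thesis by (simp add: has_bochner_integral_zero)
  qed
  have "has_bochner_integral M (\<lambda>\<omega>. \<Sum>i<n. \<Sum>j<n'. ?X i \<omega> * ?X' j \<omega>)
    (\<Sum>i<n. \<Sum>j<n'. expectation (\<lambda>\<omega>. \<xi> i \<omega> * \<xi>' j \<omega>) * ?len i j)"
    by (intro has_bochner_integral_sum cov) auto
  then have 1: "has_bochner_integral M
      (\<lambda>\<omega>. simple_ito W n \<tau> \<xi> T \<omega> * simple_ito W n' \<tau>' \<xi>' T \<omega>)
      (\<Sum>i<n. \<Sum>j<n'. expectation (\<lambda>\<omega>. \<xi> i \<omega> * \<xi>' j \<omega>) * ?len i j)"
    by (simp add: simple_ito_def sum_product)
  have eq: "(LINT s|lborel. indicator {0..T} s * (simple_process n \<tau> \<xi> s \<omega> * simple_process n' \<tau>' \<xi>' s \<omega>))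
      = (\<Sum>i<n. \<Sum>j<n'. \<xi> i \<omega> * \<xi>' j \<omega> * ?len i j)" for \<omega>
    by (rule has_bochner_integral_integral_eq[OF simple_process_product_integral[OF S S' T]])
  have 2: "has_bochner_integral M (\<lambda>\<omega>. \<Sum>i<n. \<Sum>j<n'. \<xi> i \<omega> * \<xi>' j \<omega> * ?len i j)
    (\<Sum>i<n. \<Sum>j<n'. expectation (\<lambda>\<omega>. \<xi> i \<omega> * \<xi>' j \<omega>) * ?len i j)"
    by (intro has_bochner_integral_sum has_bochner_integral_mult_left has_bochner_integral_integrable int) auto
  show "integrable M (\<lambda>\<omega>. simple_ito W n \<tau> \<xi> T \<omega> * simple_ito W n' \<tau>' \<xi>' T \<omega>)"
    using 1 by (simp add: has_bochner_integral_iff)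
  show "integrable M (\<lambda>\<omega>. LINT s|lborel.
      indicator {0..T} s * (simple_process n \<tau> \<xi> s \<omega> * simple_process n' \<tau>' \<xi>' s \<omega>))"
    using 2 unfolding eq by (simp add: has_bochner_integral_iff)
  show "expectation (\<lambda>\<omega>. simple_ito W n \<tau> \<xi> T \<omega> * simple_ito W n' \<tau>' \<xi>' T \<omega>) =
      expectation (\<lambda>\<omega>. LINT s|lborel.
        indicator {0..T} s * (simple_process n \<tau> \<xi> s \<omega> * simple_process n' \<tau>' \<xi>' s \<omega>))"
    using 1 2 unfolding eq by (simp add: has_bochner_integral_iff)
qed

text \<open>Expanding the square reduces this to three instances of the bilinear identity.\<close>

lemma simple_ito_isometry:
  assumes S: "simple_integrand M F n \<tau> \<xi>" and S': "simple_integrand M F n' \<tau>' \<xi>'" and T: "0 \<le> T"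
  shows "(\<integral>\<^sup>+\<omega>. ennreal ((simple_ito W n \<tau> \<xi> T \<omega> - simple_ito W n' \<tau>' \<xi>' T \<omega>)\<^sup>2) \<partial>M) =
    (\<integral>\<^sup>+\<omega>. (\<integral>\<^sup>+s\<in>{0..T}.
       ennreal ((simple_process n \<tau> \<xi> s \<omega> - simple_process n' \<tau>' \<xi>' s \<omega>)\<^sup>2) \<partial>lborel) \<partial>M)"
proof -
  let ?I = "simple_ito W n \<tau> \<xi> T" and ?I' = "simple_ito W n' \<tau>' \<xi>' T"
  let ?S = "simple_process n \<tau> \<xi>" and ?S' = "simple_process n' \<tau>' \<xi>'"
  let ?q = "\<lambda>X Y \<omega>. LINT s|lborel. indicator {0..T} s * (X s \<omega> * Y s \<omega> :: real)"
  note p = simple_ito_product[OF S S T] simple_ito_product[OF S' S' T] simple_ito_product[OF S S' T]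
  note q = simple_process_product_integral[OF S S T] simple_process_product_integral[OF S' S' T]
    simple_process_product_integral[OF S S' T]
  have q': "integrable lborel (\<lambda>s. indicator {0..T} s * (?S s \<omega> * ?S s \<omega>))"
    "integrable lborel (\<lambda>s. indicator {0..T} s * (?S' s \<omega> * ?S' s \<omega>))"
    "integrable lborel (\<lambda>s. indicator {0..T} s * (?S s \<omega> * ?S' s \<omega>))" for \<omega>
    using q by (auto simp: has_bochner_integral_iff)
  have sq: "(a - b)\<^sup>2 = a * a - 2 * (a * b) + b * b" for a b :: real
    by (simp add: power2_eq_square algebra_simps)
  have ind: "indicator {0..T} s * (a - b)\<^sup>2 = indicator {0..T} s * (a * a) -
      2 * (indicator {0..T} s * (a * b)) + indicator {0..T} s * (b * b)" for a b s :: real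
    unfolding sq by (simp add: algebra_simps)
  have inner_int: "integrable lborel (\<lambda>s. indicator {0..T} s * (?S s \<omega> - ?S' s \<omega>)\<^sup>2)" for \<omega>
    unfolding ind by (intro Bochner_Integration.integrable_add Bochner_Integration.integrable_diff integrable_mult_right q')
  have inner: "(LINT s|lborel. indicator {0..T} s * (?S s \<omega> - ?S' s \<omega>)\<^sup>2) =
      ?q ?S ?S \<omega> - 2 * ?q ?S ?S' \<omega> + ?q ?S' ?S' \<omega>" for \<omega>
    unfolding ind using q' by simp
  have outer_int: "integrable M (\<lambda>\<omega>. (LINT s|lborel. indicator {0..T} s * (?S s \<omega> - ?S' s \<omega>)\<^sup>2))"
    unfolding inner by (intro Bochner_Integration.integrable_add Bochner_Integration.integrable_diff integrable_mult_right p)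
  have "integrable M (\<lambda>\<omega>. (?I \<omega> - ?I' \<omega>)\<^sup>2)"
    unfolding sq by (intro Bochner_Integration.integrable_add Bochner_Integration.integrable_diff integrable_mult_right p)
  then have "(\<integral>\<^sup>+\<omega>. ennreal ((?I \<omega> - ?I' \<omega>)\<^sup>2) \<partial>M) = ennreal (expectation (\<lambda>\<omega>. (?I \<omega> - ?I' \<omega>)\<^sup>2))"
    by (intro nn_integral_eq_integral) auto
  also have "expectation (\<lambda>\<omega>. (?I \<omega> - ?I' \<omega>)\<^sup>2) =
      expectation (\<lambda>\<omega>. ?I \<omega> * ?I \<omega>) - 2 * expectation (\<lambda>\<omega>. ?I \<omega> * ?I' \<omega>) + expectation (\<lambda>\<omega>. ?I' \<omega> * ?I' \<omega>)"
    unfolding sq using p by simp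
  also have "\<dots> = expectation (\<lambda>\<omega>. (LINT s|lborel. indicator {0..T} s * (?S s \<omega> - ?S' s \<omega>)\<^sup>2))"
    unfolding inner using p by simp
  also have "ennreal \<dots> = (\<integral>\<^sup>+\<omega>. ennreal (LINT s|lborel. indicator {0..T} s * (?S s \<omega> - ?S' s \<omega>)\<^sup>2) \<partial>M)"
    by (intro nn_integral_eq_integral[symmetric] outer_int AE_I2 integral_nonneg_AE) auto
  also have "\<dots> = (\<integral>\<^sup>+\<omega>. (\<integral>\<^sup>+s\<in>{0..T}. ennreal ((?S s \<omega> - ?S' s \<omega>)\<^sup>2) \<partial>lborel) \<partial>M)"
  proof (rule nn_integral_cong)
    fix \<omega>
    have "(\<integral>\<^sup>+s\<in>{0..T}. ennreal ((?S s \<omega> - ?S' s \<omega>)\<^sup>2) \<partial>lborel) =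
        (\<integral>\<^sup>+s. ennreal (indicator {0..T} s * (?S s \<omega> - ?S' s \<omega>)\<^sup>2) \<partial>lborel)"
      by (intro nn_integral_cong) (auto simp: indicator_def)
    also have "\<dots> = ennreal (LINT s|lborel. indicator {0..T} s * (?S s \<omega> - ?S' s \<omega>)\<^sup>2)"
      by (intro nn_integral_eq_integral inner_int) auto
    finally show "ennreal (LINT s|lborel. indicator {0..T} s * (?S s \<omega> - ?S' s \<omega>)\<^sup>2) =
      (\<integral>\<^sup>+s\<in>{0..T}. ennreal ((?S s \<omega> - ?S' s \<omega>)\<^sup>2) \<partial>lborel)" by simp
  qed
  finally show ?thesis .
qed

end

section \<open>Mean square distances of processes\<close>

lemma sq_sum2_le: "((a::real) + b)\<^sup>2 \<le> 2 * (a\<^sup>2 + b\<^sup>2)"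
  using sum_squares_bound[of a b] by (simp add: power2_sum)

lemma sq_diff2_le: "((a::real) - b)\<^sup>2 \<le> 2 * (a\<^sup>2 + b\<^sup>2)"
  using sq_sum2_le[of a "- b"] by simp

lemma sq_sum3_le: "((a::real) + b + c)\<^sup>2 \<le> 3 * (a\<^sup>2 + b\<^sup>2 + c\<^sup>2)"
  using sum_squares_bound[of a b] sum_squares_bound[of a c] sum_squares_bound[of b c]
  by (simp add: power2_eq_square algebra_simps)

text \<open>The measurability required of integrands by \<open>is_ito_integral\<close>, for values in any topological space.\<close>

definition jointly_measurable ::
    "'w measure \<Rightarrow> (real \<Rightarrow> 'w \<Rightarrow> 'e::topological_space) \<Rightarrow> bool" where
  "jointly_measurable M H \<longleftrightarrow>
     (\<lambda>(s, \<omega>). H s \<omega>) \<in> borel_measurable (restrict_space borel {0..} \<Otimes>\<^sub>M M)"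

text \<open>Replacing \<open>s\<close> by \<open>max 0 s\<close> turns measurability on the half-line into measurability on the whole line,
where the theorems on product measures apply.\<close>

lemma jointly_measurable_clamped:
  assumes "jointly_measurable M H"
  shows "(\<lambda>(s, \<omega>). H (max 0 s) \<omega>) \<in> borel_measurable (borel \<Otimes>\<^sub>M M)"
proof -
  have "(\<lambda>(s, \<omega>). (max 0 s, \<omega>)) \<in> borel \<Otimes>\<^sub>M M \<rightarrow>\<^sub>M restrict_space borel {0::real..} \<Otimes>\<^sub>M M"
    by (auto simp: case_prod_beta' intro!: measurable_Pair measurable_restrict_space2)
  from measurable_compose[OF this assms[unfolded jointly_measurable_def]] show ?thesis
    by (simp add: case_prod_beta')
qed

text \<open>The squared norm of \<open>H\<close> in \<open>L\<^sup>2([0,T] \<times> \<Omega>)\<close>. Extended nonnegative values make it total, so that no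
integrability has to be checked in the estimates.\<close>

definition energy :: "'w measure \<Rightarrow> real \<Rightarrow> (real \<Rightarrow> 'w \<Rightarrow> real) \<Rightarrow> ennreal" where
  "energy M T H = (\<integral>\<^sup>+\<omega>. (\<integral>\<^sup>+s\<in>{0..T}. ennreal ((H s \<omega>)\<^sup>2) \<partial>lborel) \<partial>M)"

lemma clamp_nn_integral:
  "(\<integral>\<^sup>+s\<in>{0..T}. f s \<partial>lborel) = (\<integral>\<^sup>+s\<in>{0..T}. f (max 0 s) \<partial>lborel)" for T :: real
  by (intro nn_integral_cong) (auto simp: indicator_def)

lemma jointly_measurable_inner:
  fixes H :: "real \<Rightarrow> 'w \<Rightarrow> real"
  assumes "jointly_measurable M H"
  shows "(\<lambda>\<omega>. \<integral>\<^sup>+s\<in>{0..T}. ennreal ((H s \<omega>)\<^sup>2) \<partial>lborel) \<in> borel_measurable M"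
    and "\<omega> \<in> space M \<Longrightarrow> (\<lambda>s. ennreal ((H (max 0 s) \<omega>)\<^sup>2) * indicator {0..T} s) \<in> borel_measurable lborel"
proof -
  note [measurable] = jointly_measurable_clamped[OF assms]
  have 1: "(\<lambda>(\<omega>, s). ennreal ((H (max 0 s) \<omega>)\<^sup>2) * indicator {0..T} s) \<in> borel_measurable (M \<Otimes>\<^sub>M lborel)"
    by measurable
  show "(\<lambda>\<omega>. \<integral>\<^sup>+s\<in>{0..T}. ennreal ((H s \<omega>)\<^sup>2) \<partial>lborel) \<in> borel_measurable M"
    unfolding clamp_nn_integral[where f="\<lambda>s. ennreal ((H s _)\<^sup>2)"]
    using sigma_finite_measure.borel_measurable_nn_integral[OF sigma_finite_lborel 1] by simp
  show "(\<lambda>s. ennreal ((H (max 0 s) \<omega>)\<^sup>2) * indicator {0..T} s) \<in> borel_measurable lborel"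
    if "\<omega> \<in> space M"
    using measurable_compose[OF measurable_Pair1'[OF that, of lborel] 1] by simp
qed

lemma energy_add3_le:
  assumes "jointly_measurable M U" "jointly_measurable M V" "jointly_measurable M Z"
  shows "energy M T (\<lambda>s \<omega>. U s \<omega> + V s \<omega> + Z s \<omega>) \<le> 3 * (energy M T U + energy M T V + energy M T Z)"
proof -
  note m = jointly_measurable_inner[OF assms(1), where T=T] jointly_measurable_inner[OF assms(2), where T=T]
    jointly_measurable_inner[OF assms(3), where T=T]
  note c = clamp_nn_integral[where f="\<lambda>s. ennreal ((U s _)\<^sup>2)"]
    clamp_nn_integral[where f="\<lambda>s. ennreal ((V s _)\<^sup>2)"]
    clamp_nn_integral[where f="\<lambda>s. ennreal ((Z s _)\<^sup>2)"]
    clamp_nn_integral[where f="\<lambda>s. ennreal ((U s _ + V s _ + Z s _)\<^sup>2)"]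
  have "energy M T (\<lambda>s \<omega>. U s \<omega> + V s \<omega> + Z s \<omega>) \<le>
    (\<integral>\<^sup>+\<omega>. 3 * ((\<integral>\<^sup>+s\<in>{0..T}. ennreal ((U s \<omega>)\<^sup>2) \<partial>lborel) + (\<integral>\<^sup>+s\<in>{0..T}. ennreal ((V s \<omega>)\<^sup>2) \<partial>lborel)
      + (\<integral>\<^sup>+s\<in>{0..T}. ennreal ((Z s \<omega>)\<^sup>2) \<partial>lborel)) \<partial>M)"
    unfolding energy_def
  proof (rule nn_integral_mono)
    fix \<omega> assume \<omega>: "\<omega> \<in> space M"
    have "(\<integral>\<^sup>+s\<in>{0..T}. ennreal ((U s \<omega> + V s \<omega> + Z s \<omega>)\<^sup>2) \<partial>lborel) \<le>
      (\<integral>\<^sup>+s. 3 * (ennreal ((U (max 0 s) \<omega>)\<^sup>2) * indicator {0..T} s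
         + ennreal ((V (max 0 s) \<omega>)\<^sup>2) * indicator {0..T} s
         + ennreal ((Z (max 0 s) \<omega>)\<^sup>2) * indicator {0..T} s) \<partial>lborel)"
      unfolding c
    proof (rule nn_integral_mono)
      fix s
      have "ennreal ((a + b + c)\<^sup>2) \<le> 3 * (ennreal (a\<^sup>2) + ennreal (b\<^sup>2) + ennreal (c\<^sup>2))" for a b c :: real
      proof -
        have "ennreal ((a + b + c)\<^sup>2) \<le> ennreal (3 * (a\<^sup>2 + b\<^sup>2 + c\<^sup>2))"
          by (intro ennreal_leI sq_sum3_le)
        then show ?thesis by (simp add: ennreal_mult ennreal_plus)
      qed
      then show "ennreal ((U (max 0 s) \<omega> + V (max 0 s) \<omega> + Z (max 0 s) \<omega>)\<^sup>2) * indicator {0..T} s \<le>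
        3 * (ennreal ((U (max 0 s) \<omega>)\<^sup>2) * indicator {0..T} s
         + ennreal ((V (max 0 s) \<omega>)\<^sup>2) * indicator {0..T} s
         + ennreal ((Z (max 0 s) \<omega>)\<^sup>2) * indicator {0..T} s)"
        by (auto simp: indicator_def)
    qed
    also have "\<dots> = 3 * ((\<integral>\<^sup>+s\<in>{0..T}. ennreal ((U s \<omega>)\<^sup>2) \<partial>lborel) + (\<integral>\<^sup>+s\<in>{0..T}. ennreal ((V s \<omega>)\<^sup>2) \<partial>lborel)
      + (\<integral>\<^sup>+s\<in>{0..T}. ennreal ((Z s \<omega>)\<^sup>2) \<partial>lborel))"
      unfolding c using m(2,4,6)[OF \<omega>]
      by (subst nn_integral_cmult, simp, subst nn_integral_add, simp, simp, subst nn_integral_add, auto)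
    finally show "(\<integral>\<^sup>+s\<in>{0..T}. ennreal ((U s \<omega> + V s \<omega> + Z s \<omega>)\<^sup>2) \<partial>lborel) \<le> \<dots>" .
  qed
  also have "\<dots> = 3 * (energy M T U + energy M T V + energy M T Z)"
    unfolding energy_def using m(1,3,5)
    by (subst nn_integral_cmult, simp, subst nn_integral_add, simp, simp, subst nn_integral_add, auto)
  finally show ?thesis .
qed

lemma energy_diff_commute: "energy M T (\<lambda>s \<omega>. H s \<omega> - H' s \<omega>) = energy M T (\<lambda>s \<omega>. H' s \<omega> - H s \<omega>)"
  unfolding energy_def by (simp add: power2_commute)

lemma jointly_measurable_diff:
  fixes U V :: "real \<Rightarrow> 'w \<Rightarrow> real"
  assumes "jointly_measurable M U" "jointly_measurable M V"
  shows "jointly_measurable M (\<lambda>s \<omega>. U s \<omega> - V s \<omega>)"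
  using assms unfolding jointly_measurable_def by (simp add: case_prod_beta')

lemma energy_diff_triangle3:
  assumes "jointly_measurable M U" "jointly_measurable M V" "jointly_measurable M U'" "jointly_measurable M V'"
  shows "energy M T (\<lambda>s \<omega>. U s \<omega> - U' s \<omega>) \<le> 3 * (energy M T (\<lambda>s \<omega>. U s \<omega> - V s \<omega>)
    + energy M T (\<lambda>s \<omega>. V s \<omega> - V' s \<omega>) + energy M T (\<lambda>s \<omega>. V' s \<omega> - U' s \<omega>))"
  using energy_add3_le[OF jointly_measurable_diff[OF assms(1,2)]
      jointly_measurable_diff[OF assms(2,4)] jointly_measurable_diff[OF assms(4,3)]] by simp

lemma mean_sq_triangle3:
  fixes U V U' V' :: "'w \<Rightarrow> real"
  assumes [measurable]: "U \<in> borel_measurable M" "V \<in> borel_measurable M"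
    "U' \<in> borel_measurable M" "V' \<in> borel_measurable M"
  shows "(\<integral>\<^sup>+\<omega>. ennreal ((U \<omega> - U' \<omega>)\<^sup>2) \<partial>M) \<le> 3 * ((\<integral>\<^sup>+\<omega>. ennreal ((U \<omega> - V \<omega>)\<^sup>2) \<partial>M)
    + (\<integral>\<^sup>+\<omega>. ennreal ((V \<omega> - V' \<omega>)\<^sup>2) \<partial>M) + (\<integral>\<^sup>+\<omega>. ennreal ((V' \<omega> - U' \<omega>)\<^sup>2) \<partial>M))"
proof -
  have "(\<integral>\<^sup>+\<omega>. ennreal ((U \<omega> - U' \<omega>)\<^sup>2) \<partial>M) \<le>
    (\<integral>\<^sup>+\<omega>. 3 * (ennreal ((U \<omega> - V \<omega>)\<^sup>2) + ennreal ((V \<omega> - V' \<omega>)\<^sup>2) + ennreal ((V' \<omega> - U' \<omega>)\<^sup>2)) \<partial>M)"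
  proof (rule nn_integral_mono)
    fix \<omega>
    have "(U \<omega> - U' \<omega>)\<^sup>2 \<le> 3 * ((U \<omega> - V \<omega>)\<^sup>2 + (V \<omega> - V' \<omega>)\<^sup>2 + (V' \<omega> - U' \<omega>)\<^sup>2)"
      using sq_sum3_le[of "U \<omega> - V \<omega>" "V \<omega> - V' \<omega>" "V' \<omega> - U' \<omega>"] by simp
    from ennreal_leI[OF this] show "ennreal ((U \<omega> - U' \<omega>)\<^sup>2) \<le>
      3 * (ennreal ((U \<omega> - V \<omega>)\<^sup>2) + ennreal ((V \<omega> - V' \<omega>)\<^sup>2) + ennreal ((V' \<omega> - U' \<omega>)\<^sup>2))"
      by (simp add: ennreal_mult ennreal_plus)
  qed
  also have "\<dots> = 3 * ((\<integral>\<^sup>+\<omega>. ennreal ((U \<omega> - V \<omega>)\<^sup>2) \<partial>M)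
    + (\<integral>\<^sup>+\<omega>. ennreal ((V \<omega> - V' \<omega>)\<^sup>2) \<partial>M) + (\<integral>\<^sup>+\<omega>. ennreal ((V' \<omega> - U' \<omega>)\<^sup>2) \<partial>M))"
    by (simp add: nn_integral_cmult nn_integral_add)
  finally show ?thesis .
qed

context filtered_prob_space
begin

lemma jointly_measurable_simple_process:
  assumes S: "simple_integrand M F n \<tau> \<xi>"
  shows "jointly_measurable M (simple_process n \<tau> \<xi>)"
proof -
  have [measurable]: "\<xi> i \<in> borel_measurable M" if "i \<in> {..<n}" for i
    using measurable_F_M[OF simple_integrandD(3)[OF S]] that by simp
  show ?thesis
    unfolding jointly_measurable_def simple_process_def[abs_def] case_prod_beta'
  proof (intro borel_measurable_sum borel_measurable_times)
    fix i assume "i \<in> {..<n}"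
    then show "(\<lambda>x. \<xi> i (snd x)) \<in> borel_measurable (restrict_space borel {0..} \<Otimes>\<^sub>M M)" by simp
    have "(\<lambda>x. x) \<in> restrict_space borel {0::real..} \<rightarrow>\<^sub>M borel"
      by (rule measurable_restrict_space1) simp
    from measurable_compose[OF measurable_fst this]
    have [measurable]: "fst \<in> restrict_space borel {0..} \<Otimes>\<^sub>M M \<rightarrow>\<^sub>M (borel :: real measure)" .
    show "(\<lambda>x. indicator {\<tau> i<..\<tau> (Suc i)} (fst x) :: real)
        \<in> borel_measurable (restrict_space borel {0..} \<Otimes>\<^sub>M M)"
      by measurable
  qed
qed

end

context adapted_brownian
begin

text \<open>Both integrals are compared with their elementary approximations, for which the isometry is
available; the approximation errors vanish in the limit.\<close>

theorem ito_integral_difference_estimate: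
  assumes Y: "is_ito_integral M F W H Y" and Y': "is_ito_integral M F W H' Y'" and T: "0 \<le> T"
  shows "(\<integral>\<^sup>+\<omega>. ennreal ((Y T \<omega> - Y' T \<omega>)\<^sup>2) \<partial>M) \<le> 9 * energy M T (\<lambda>s \<omega>. H s \<omega> - H' s \<omega>)"
proof -
  have H: "jointly_measurable M H" "jointly_measurable M H'"
    and [measurable]: "Y T \<in> borel_measurable M" "Y' T \<in> borel_measurable M"
    using Y Y' T by (auto simp: is_ito_integral_def jointly_measurable_def)
  obtain n \<tau> \<xi> where S: "\<And>m::nat. simple_integrand M F (n m) (\<tau> m) (\<xi> m)"
    and b: "(\<lambda>m. energy M T (\<lambda>s \<omega>. H s \<omega> - simple_process (n m) (\<tau> m) (\<xi> m) s \<omega>)) \<longlonglongrightarrow> 0"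
    and a: "(\<lambda>m. \<integral>\<^sup>+\<omega>. ennreal ((Y T \<omega> - simple_ito W (n m) (\<tau> m) (\<xi> m) T \<omega>)\<^sup>2) \<partial>M) \<longlonglongrightarrow> 0"
    using Y T unfolding is_ito_integral_def energy_def by blast
  obtain n' \<tau>' \<xi>' where S': "\<And>m::nat. simple_integrand M F (n' m) (\<tau>' m) (\<xi>' m)"
    and b': "(\<lambda>m. energy M T (\<lambda>s \<omega>. H' s \<omega> - simple_process (n' m) (\<tau>' m) (\<xi>' m) s \<omega>)) \<longlonglongrightarrow> 0"
    and a': "(\<lambda>m. \<integral>\<^sup>+\<omega>. ennreal ((Y' T \<omega> - simple_ito W (n' m) (\<tau>' m) (\<xi>' m) T \<omega>)\<^sup>2) \<partial>M) \<longlonglongrightarrow> 0"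
    using Y' T unfolding is_ito_integral_def energy_def by blast
  let ?I = "\<lambda>m. simple_ito W (n m) (\<tau> m) (\<xi> m) T" and ?I' = "\<lambda>m. simple_ito W (n' m) (\<tau>' m) (\<xi>' m) T"
  let ?S = "\<lambda>m. simple_process (n m) (\<tau> m) (\<xi> m)" and ?S' = "\<lambda>m. simple_process (n' m) (\<tau>' m) (\<xi>' m)"
  let ?\<alpha> = "\<lambda>m. \<integral>\<^sup>+\<omega>. ennreal ((Y T \<omega> - ?I m \<omega>)\<^sup>2) \<partial>M" and ?\<alpha>' = "\<lambda>m. \<integral>\<^sup>+\<omega>. ennreal ((Y' T \<omega> - ?I' m \<omega>)\<^sup>2) \<partial>M"
  let ?\<beta> = "\<lambda>m. energy M T (\<lambda>s \<omega>. H s \<omega> - ?S m s \<omega>)" and ?\<beta>' = "\<lambda>m. energy M T (\<lambda>s \<omega>. H' s \<omega> - ?S' m s \<omega>)"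
  let ?D = "energy M T (\<lambda>s \<omega>. H s \<omega> - H' s \<omega>)"
  have bound: "(\<integral>\<^sup>+\<omega>. ennreal ((Y T \<omega> - Y' T \<omega>)\<^sup>2) \<partial>M)
      \<le> 3 * (?\<alpha> m + 3 * (?\<beta> m + ?D + ?\<beta>' m) + ?\<alpha>' m)" for m
  proof -
    have [measurable]: "?I m \<in> borel_measurable M" "?I' m \<in> borel_measurable M"
      using simple_ito_adapted[OF S T] simple_ito_adapted[OF S' T] measurable_F_M by blast+
    have "(\<integral>\<^sup>+\<omega>. ennreal ((Y T \<omega> - Y' T \<omega>)\<^sup>2) \<partial>M) \<le> 3 * (?\<alpha> m
        + (\<integral>\<^sup>+\<omega>. ennreal ((?I m \<omega> - ?I' m \<omega>)\<^sup>2) \<partial>M) + (\<integral>\<^sup>+\<omega>. ennreal ((?I' m \<omega> - Y' T \<omega>)\<^sup>2) \<partial>M))"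
      by (rule mean_sq_triangle3) auto
    also have "(\<integral>\<^sup>+\<omega>. ennreal ((?I m \<omega> - ?I' m \<omega>)\<^sup>2) \<partial>M) = energy M T (\<lambda>s \<omega>. ?S m s \<omega> - ?S' m s \<omega>)"
      unfolding energy_def by (rule simple_ito_isometry[OF S S' T])
    also have "\<dots> \<le> 3 * (?\<beta> m + ?D + ?\<beta>' m)"
    proof -
      have "energy M T (\<lambda>s \<omega>. ?S m s \<omega> - H s \<omega>) = ?\<beta> m" by (rule energy_diff_commute)
      then show ?thesis
        using energy_diff_triangle3[OF jointly_measurable_simple_process[OF S[of m]] H(1)
          jointly_measurable_simple_process[OF S'[of m]] H(2), of T] by (simp only:)
    qed
    finally show ?thesis
      by (simp add: power2_commute[of "Y' T _"] add_left_mono add_right_mono mult_left_mono)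
  qed
  have "(\<lambda>m. 3 * (?\<alpha> m + 3 * (?\<beta> m + ?D + ?\<beta>' m) + ?\<alpha>' m)) \<longlonglongrightarrow> 3 * (0 + 3 * (0 + ?D + 0) + 0)"
    by (intro tendsto_add ennreal_tendsto_cmult a b a' b' tendsto_const) auto
  then have "(\<integral>\<^sup>+\<omega>. ennreal ((Y T \<omega> - Y' T \<omega>)\<^sup>2) \<partial>M) \<le> 3 * (0 + 3 * (0 + ?D + 0) + 0)"
    by (rule LIMSEQ_le_const) (use bound in auto)
  also have "\<dots> = 9 * ?D" by (simp add: mult.assoc[symmetric])
  finally show ?thesis .
qed

end

section \<open>Square integrable martingales\<close>

lemma integrable_mult_sq:
  fixes f g :: "'w \<Rightarrow> real"
  assumes [measurable]: "f \<in> borel_measurable M" "g \<in> borel_measurable M"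
    and "integrable M (\<lambda>x. (f x)\<^sup>2)" "integrable M (\<lambda>x. (g x)\<^sup>2)"
  shows "integrable M (\<lambda>x. f x * g x)"
proof (rule Bochner_Integration.integrable_bound)
  show "integrable M (\<lambda>x. (f x)\<^sup>2 + (g x)\<^sup>2)" using assms by simp
  have "\<bar>a * b\<bar> \<le> a\<^sup>2 + b\<^sup>2" for a b :: real
  proof -
    have "2 * (\<bar>a\<bar> * \<bar>b\<bar>) \<le> a\<^sup>2 + b\<^sup>2" using sum_squares_bound[of "\<bar>a\<bar>" "\<bar>b\<bar>"] by (simp add: mult.assoc)
    moreover have "0 \<le> \<bar>a\<bar> * \<bar>b\<bar>" by simp
    ultimately show ?thesis unfolding abs_mult by linarith
  qed
  then show "AE x in M. norm (f x * g x) \<le> norm ((f x)\<^sup>2 + (g x)\<^sup>2)" by simp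
qed simp

lemma integrable_diff_sq:
  fixes f g :: "'w \<Rightarrow> real"
  assumes [measurable]: "f \<in> borel_measurable M" "g \<in> borel_measurable M"
    and "integrable M (\<lambda>x. (f x)\<^sup>2)" "integrable M (\<lambda>x. (g x)\<^sup>2)"
  shows "integrable M (\<lambda>x. (f x - g x)\<^sup>2)"
  using assms integrable_mult_sq[OF assms] by (simp add: power2_diff mult.assoc)

lemma dyadic_floor_tendsto:
  fixes s :: real
  assumes "0 \<le> s"
  shows "(\<lambda>m. real (nat \<lfloor>s * 2^m\<rfloor>) / 2^m) \<longlonglongrightarrow> s"
proof (rule tendsto_sandwich)
  have fl: "real (nat \<lfloor>s * 2^m\<rfloor>) \<le> s * 2^m" "s * 2^m < real (nat \<lfloor>s * 2^m\<rfloor>) + 1" for m :: nat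
    using assms by auto
  show "\<forall>\<^sub>F m in sequentially. s - (1/2)^m \<le> real (nat \<lfloor>s * 2^m\<rfloor>) / 2^m"
  proof (intro always_eventually allI)
    fix m
    have "s \<le> (real (nat \<lfloor>s * 2^m\<rfloor>) + 1) / 2^m" using fl(2)[of m] by (simp add: pos_le_divide_eq)
    then show "s - (1/2)^m \<le> real (nat \<lfloor>s * 2^m\<rfloor>) / 2^m" by (simp add: add_divide_distrib power_one_over)
  qed
  show "\<forall>\<^sub>F m in sequentially. real (nat \<lfloor>s * 2^m\<rfloor>) / 2^m \<le> s"
    using fl(1) by (intro always_eventually allI) (simp add: pos_divide_le_eq)
  have "(\<lambda>m. s - (1/2)^m) \<longlonglongrightarrow> s - 0" by (intro tendsto_intros LIMSEQ_power_zero) auto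
  then show "(\<lambda>m. s - (1/2)^m) \<longlonglongrightarrow> s" by simp
qed simp

context filtered_prob_space
begin

text \<open>Orthogonality of the increments to every square integrable variable of the past, rather than a
condition on conditional expectations. In this form the notion visibly passes to differences and to
mean square limits, and \<open>V\<close> may be chosen as \<open>Z s\<close> times an indicator in the maximal inequality.\<close>

definition L2_martingale :: "(real \<Rightarrow> 'w \<Rightarrow> real) \<Rightarrow> bool" where
  "L2_martingale Z \<longleftrightarrow>
     (\<forall>t\<ge>0. Z t \<in> borel_measurable (F t)) \<and>
     (\<forall>t\<ge>0. integrable M (\<lambda>\<omega>. (Z t \<omega>)\<^sup>2)) \<and>
     (\<forall>s t V. 0 \<le> s \<longrightarrow> s \<le> t \<longrightarrow> V \<in> borel_measurable (F s) \<longrightarrow> integrable M (\<lambda>\<omega>. (V \<omega>)\<^sup>2) \<longrightarrow>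
        expectation (\<lambda>\<omega>. V \<omega> * (Z t \<omega> - Z s \<omega>)) = 0)"

lemma L2_martingaleD:
  assumes "L2_martingale Z" "0 \<le> t"
  shows "Z t \<in> borel_measurable (F t)" "Z t \<in> borel_measurable M" "integrable M (\<lambda>\<omega>. (Z t \<omega>)\<^sup>2)"
  using assms measurable_F_M unfolding L2_martingale_def by blast+

lemma L2_martingale_orthogonal:
  assumes "L2_martingale Z" "0 \<le> s" "s \<le> t" "V \<in> borel_measurable (F s)" "integrable M (\<lambda>\<omega>. (V \<omega>)\<^sup>2)"
  shows "expectation (\<lambda>\<omega>. V \<omega> * (Z t \<omega> - Z s \<omega>)) = 0"
  using assms unfolding L2_martingale_def by blast

lemma L2_martingale_diff:
  assumes Z: "L2_martingale Z" and Z': "L2_martingale Z'"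
  shows "L2_martingale (\<lambda>t \<omega>. Z t \<omega> - Z' t \<omega>)"
  unfolding L2_martingale_def
proof (intro conjI allI impI)
  fix t :: real assume t: "0 \<le> t"
  show "(\<lambda>\<omega>. Z t \<omega> - Z' t \<omega>) \<in> borel_measurable (F t)"
    using L2_martingaleD(1)[OF Z t] L2_martingaleD(1)[OF Z' t] by simp
  show "integrable M (\<lambda>\<omega>. (Z t \<omega> - Z' t \<omega>)\<^sup>2)"
    using L2_martingaleD(2,3)[OF Z t] L2_martingaleD(2,3)[OF Z' t] by (intro integrable_diff_sq)
next
  fix s t :: real and V :: "'w \<Rightarrow> real" assume st: "0 \<le> s" "s \<le> t" and V: "V \<in> borel_measurable (F s)" "integrable M (\<lambda>\<omega>. (V \<omega>)\<^sup>2)"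
  have t: "0 \<le> t" using st by simp
  have VM: "V \<in> borel_measurable M" using V measurable_F_M by blast
  have int: "integrable M (\<lambda>\<omega>. V \<omega> * (Y t \<omega> - Y s \<omega>))" if Y: "L2_martingale Y" for Y
    using L2_martingaleD[OF Y st(1)] L2_martingaleD[OF Y t] VM V
    by (intro integrable_mult_sq integrable_diff_sq) auto
  have "expectation (\<lambda>\<omega>. V \<omega> * (Z t \<omega> - Z' t \<omega> - (Z s \<omega> - Z' s \<omega>))) =
      expectation (\<lambda>\<omega>. V \<omega> * (Z t \<omega> - Z s \<omega>) - V \<omega> * (Z' t \<omega> - Z' s \<omega>))"
    by (rule Bochner_Integration.integral_cong) (auto simp: algebra_simps)
  also have "\<dots> = 0"
    using int[OF Z] int[OF Z'] L2_martingale_orthogonal[OF Z st V] L2_martingale_orthogonal[OF Z' st V] by simp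
  finally show "expectation (\<lambda>\<omega>. V \<omega> * (Z t \<omega> - Z' t \<omega> - (Z s \<omega> - Z' s \<omega>))) = 0" .
qed

text \<open>For fixed \<open>V\<close> the orthogonality relation is continuous in mean square; \<open>\<bar>V D\<bar> \<le> \<delta> V\<^sup>2 + D\<^sup>2 / \<delta>\<close> serves as
a substitute for the Cauchy-Schwarz inequality.\<close>

lemma L2_martingale_limit:
  assumes Zm: "\<And>m::nat. L2_martingale (Zm m)"
    and Z: "\<And>t. 0 \<le> t \<Longrightarrow> Z t \<in> borel_measurable (F t)"
    and lim: "\<And>t. 0 \<le> t \<Longrightarrow> (\<lambda>m. \<integral>\<^sup>+\<omega>. ennreal ((Z t \<omega> - Zm m t \<omega>)\<^sup>2) \<partial>M) \<longlonglongrightarrow> 0"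
  shows "L2_martingale Z"
proof -
  have ZM: "Z t \<in> borel_measurable M" if "0 \<le> t" for t using Z[OF that] measurable_F_M by blast
  have fin: "\<forall>\<^sub>F m in sequentially. integrable M (\<lambda>\<omega>. (Z t \<omega> - Zm m t \<omega>)\<^sup>2)" if t: "0 \<le> t" for t
  proof -
    have "\<forall>\<^sub>F m in sequentially. (\<integral>\<^sup>+\<omega>. ennreal ((Z t \<omega> - Zm m t \<omega>)\<^sup>2) \<partial>M) < 1"
      using lim[OF t] by (rule order_tendstoD) simp
    then show ?thesis
    proof (rule eventually_mono)
      fix m assume "(\<integral>\<^sup>+\<omega>. ennreal ((Z t \<omega> - Zm m t \<omega>)\<^sup>2) \<partial>M) < 1"
      then have "(\<integral>\<^sup>+\<omega>. ennreal ((Z t \<omega> - Zm m t \<omega>)\<^sup>2) \<partial>M) < \<infinity>"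
        by (rule less_trans) simp
      then show "integrable M (\<lambda>\<omega>. (Z t \<omega> - Zm m t \<omega>)\<^sup>2)"
        using ZM[OF t] L2_martingaleD(2)[OF Zm t] by (intro integrableI_nonneg) auto
    qed
  qed
  have sq: "integrable M (\<lambda>\<omega>. (Z t \<omega>)\<^sup>2)" if t: "0 \<le> t" for t
  proof -
    obtain m where "integrable M (\<lambda>\<omega>. (Z t \<omega> - Zm m t \<omega>)\<^sup>2)"
      using eventually_happens'[OF sequentially_bot fin[OF t]] by blast
    then have "integrable M (\<lambda>\<omega>. 2 * ((Z t \<omega> - Zm m t \<omega>)\<^sup>2 + (Zm m t \<omega>)\<^sup>2))"
      using L2_martingaleD(3)[OF Zm t] by simp
    then show ?thesis
    proof (rule Bochner_Integration.integrable_bound)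
      show "AE \<omega> in M. norm ((Z t \<omega>)\<^sup>2) \<le> norm (2 * ((Z t \<omega> - Zm m t \<omega>)\<^sup>2 + (Zm m t \<omega>)\<^sup>2))"
      proof (rule AE_I2)
        fix \<omega>
        show "norm ((Z t \<omega>)\<^sup>2) \<le> norm (2 * ((Z t \<omega> - Zm m t \<omega>)\<^sup>2 + (Zm m t \<omega>)\<^sup>2))"
          using sq_sum2_le[of "Z t \<omega> - Zm m t \<omega>" "Zm m t \<omega>"] by simp
      qed
    qed (use ZM[OF t] in simp)
  qed
  have conv: "(\<lambda>m. expectation (\<lambda>\<omega>. (Z t \<omega> - Zm m t \<omega>)\<^sup>2)) \<longlonglongrightarrow> 0" if t: "0 \<le> t" for t
  proof -
    have eq: "(\<integral>\<^sup>+\<omega>. ennreal ((Z t \<omega> - Zm m t \<omega>)\<^sup>2) \<partial>M) = ennreal (expectation (\<lambda>\<omega>. (Z t \<omega> - Zm m t \<omega>)\<^sup>2))" for m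
      using ZM[OF t] sq[OF t] L2_martingaleD(2,3)[OF Zm t]
      by (intro nn_integral_eq_integral integrable_diff_sq) auto
    show ?thesis
      using lim[OF t] unfolding eq ennreal_0[symmetric]
      by (subst (asm) tendsto_ennreal_iff) (auto intro!: integral_nonneg_AE)
  qed
  show ?thesis
    unfolding L2_martingale_def
  proof (intro conjI allI impI Z sq)
    fix s t :: real and V :: "'w \<Rightarrow> real" assume st: "0 \<le> s" "s \<le> t" and V: "V \<in> borel_measurable (F s)" "integrable M (\<lambda>\<omega>. (V \<omega>)\<^sup>2)"
    have t: "0 \<le> t" using st by simp
    have VM[measurable]: "V \<in> borel_measurable M" using V measurable_F_M by blast
    note [measurable] = ZM[OF t] ZM[OF st(1)]
    let ?x = "expectation (\<lambda>\<omega>. V \<omega> * (Z t \<omega> - Z s \<omega>))"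
    let ?A = "expectation (\<lambda>\<omega>. (V \<omega>)\<^sup>2)"
    have A: "0 \<le> ?A" by (intro integral_nonneg_AE) auto
    have key: "\<bar>?x\<bar> \<le> \<delta> * ?A" if \<delta>: "\<delta> > 0" for \<delta>
    proof -
      have "\<bar>?x\<bar> \<le> \<delta> * ?A + (2 / \<delta>) * (expectation (\<lambda>\<omega>. (Z t \<omega> - Zm m t \<omega>)\<^sup>2) + expectation (\<lambda>\<omega>. (Z s \<omega> - Zm m s \<omega>)\<^sup>2))" for m
      proof -
        note [measurable] = L2_martingaleD(2)[OF Zm[of m] t] L2_martingaleD(2)[OF Zm[of m] st(1)]
        let ?D = "\<lambda>\<omega>. (Z t \<omega> - Zm m t \<omega>) - (Z s \<omega> - Zm m s \<omega>)"
        have i1: "integrable M (\<lambda>\<omega>. (Z t \<omega> - Zm m t \<omega>)\<^sup>2)" "integrable M (\<lambda>\<omega>. (Z s \<omega> - Zm m s \<omega>)\<^sup>2)"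
          using sq[OF t] sq[OF st(1)] L2_martingaleD(3)[OF Zm t] L2_martingaleD(3)[OF Zm st(1)]
          by (auto intro!: integrable_diff_sq)
        have i2: "integrable M (\<lambda>\<omega>. (?D \<omega>)\<^sup>2)" by (rule integrable_diff_sq[OF _ _ i1]) auto
        have i3: "integrable M (\<lambda>\<omega>. V \<omega> * ?D \<omega>)" using i2 V by (intro integrable_mult_sq) auto
        have i4: "integrable M (\<lambda>\<omega>. V \<omega> * (Zm m t \<omega> - Zm m s \<omega>))"
          using L2_martingaleD(3)[OF Zm t] L2_martingaleD(3)[OF Zm st(1)] V
          by (intro integrable_mult_sq integrable_diff_sq) auto
        have "?x = expectation (\<lambda>\<omega>. V \<omega> * ?D \<omega> + V \<omega> * (Zm m t \<omega> - Zm m s \<omega>))"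
          by (rule Bochner_Integration.integral_cong) (auto simp: algebra_simps)
        also have "\<dots> = expectation (\<lambda>\<omega>. V \<omega> * ?D \<omega>)"
          using i3 i4 L2_martingale_orthogonal[OF Zm st V] by simp
        also have "\<bar>\<dots>\<bar> \<le> expectation (\<lambda>\<omega>. \<bar>V \<omega> * ?D \<omega>\<bar>)" by (rule integral_abs_bound)
        also have "\<dots> \<le> expectation (\<lambda>\<omega>. \<delta> * (V \<omega>)\<^sup>2 + (2 / \<delta>) * ((Z t \<omega> - Zm m t \<omega>)\<^sup>2 + (Z s \<omega> - Zm m s \<omega>)\<^sup>2))"
        proof (rule integral_mono)
          fix \<omega>
          have young: "\<bar>v * d\<bar> \<le> \<delta> * v\<^sup>2 + d\<^sup>2 / \<delta>" for v d :: real
          proof -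
            have "2 * (\<delta> * \<bar>v\<bar>) * \<bar>d\<bar> \<le> (\<delta> * \<bar>v\<bar>)\<^sup>2 + \<bar>d\<bar>\<^sup>2" by (rule sum_squares_bound)
            then have "2 * (\<delta> * \<bar>v * d\<bar>) \<le> \<delta> * (\<delta> * v\<^sup>2) + d\<^sup>2"
              by (simp add: abs_mult power2_eq_square algebra_simps)
            moreover have "0 \<le> \<delta> * \<bar>v * d\<bar>" using \<delta> by simp
            ultimately have "\<delta> * \<bar>v * d\<bar> \<le> \<delta> * (\<delta> * v\<^sup>2) + d\<^sup>2" by linarith
            also have "\<dots> = \<delta> * (\<delta> * v\<^sup>2 + d\<^sup>2 / \<delta>)" using \<delta> by (simp add: distrib_left)
            finally show ?thesis using \<delta> by simp
          qed
          have "(?D \<omega>)\<^sup>2 \<le> 2 * ((Z t \<omega> - Zm m t \<omega>)\<^sup>2 + (Z s \<omega> - Zm m s \<omega>)\<^sup>2)"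
            by (rule sq_diff2_le)
          then have "(?D \<omega>)\<^sup>2 / \<delta> \<le> (2 / \<delta>) * ((Z t \<omega> - Zm m t \<omega>)\<^sup>2 + (Z s \<omega> - Zm m s \<omega>)\<^sup>2)"
            using \<delta> by (simp add: field_simps)
          with young[of "V \<omega>" "?D \<omega>"]
          show "\<bar>V \<omega> * ?D \<omega>\<bar> \<le> \<delta> * (V \<omega>)\<^sup>2 + (2 / \<delta>) * ((Z t \<omega> - Zm m t \<omega>)\<^sup>2 + (Z s \<omega> - Zm m s \<omega>)\<^sup>2)"
            by simp
        qed (use i1 i3 V in auto)
        also have "\<dots> = \<delta> * ?A + (2 / \<delta>) * (expectation (\<lambda>\<omega>. (Z t \<omega> - Zm m t \<omega>)\<^sup>2) + expectation (\<lambda>\<omega>. (Z s \<omega> - Zm m s \<omega>)\<^sup>2))"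
          using i1 V by simp
        finally show ?thesis .
      qed
      moreover have "(\<lambda>m. \<delta> * ?A + (2 / \<delta>) * (expectation (\<lambda>\<omega>. (Z t \<omega> - Zm m t \<omega>)\<^sup>2)
          + expectation (\<lambda>\<omega>. (Z s \<omega> - Zm m s \<omega>)\<^sup>2))) \<longlonglongrightarrow> \<delta> * ?A + (2 / \<delta>) * (0 + 0)"
        by (intro tendsto_intros conv t st)
      ultimately have "\<bar>?x\<bar> \<le> \<delta> * ?A + (2 / \<delta>) * (0 + 0)"
        by (intro LIMSEQ_le_const[of "\<lambda>m. \<delta> * ?A + (2 / \<delta>) * (expectation (\<lambda>\<omega>. (Z t \<omega> - Zm m t \<omega>)\<^sup>2)
          + expectation (\<lambda>\<omega>. (Z s \<omega> - Zm m s \<omega>)\<^sup>2))"]) auto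
      then show ?thesis by simp
    qed
    have vanish: "x = 0" if "0 \<le> a" and key: "\<And>\<delta>. \<delta> > 0 \<Longrightarrow> \<bar>x\<bar> \<le> \<delta> * a" for x a :: real
    proof (rule ccontr)
      assume x: "x \<noteq> 0"
      define \<delta> where "\<delta> = \<bar>x\<bar> / (2 * (a + 1))"
      have \<delta>: "\<delta> > 0" using x that(1) by (simp add: \<delta>_def)
      have "\<bar>x\<bar> \<le> \<delta> * a" by (rule key[OF \<delta>])
      also have "\<dots> < \<delta> * (2 * (a + 1))" using \<delta> that(1) by (intro mult_strict_left_mono) auto
      also have "\<dots> = \<bar>x\<bar>" using that(1) by (simp add: \<delta>_def)
      finally show False by simp
    qed
    show "?x = 0" by (rule vanish[OF A key])
  qed
qed

text \<open>The squares form a submartingale: in \<open>(Z t)\<^sup>2 = (Z s)\<^sup>2 + 2 Z s (Z t - Z s) + (Z t - Z s)\<^sup>2\<close> the mixed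
term has mean zero on every event of the past.\<close>

lemma L2_martingale_sq_mono:
  assumes Z: "L2_martingale Z" and st: "0 \<le> s" "s \<le> t" and A: "A \<in> sets (F s)"
  shows "expectation (\<lambda>\<omega>. indicator A \<omega> * (Z s \<omega>)\<^sup>2) \<le> expectation (\<lambda>\<omega>. indicator A \<omega> * (Z t \<omega>)\<^sup>2)"
proof -
  have t: "0 \<le> t" using st by simp
  have AM[measurable]: "A \<in> sets M" using A sets_F_M by blast
  note [measurable] = L2_martingaleD(2)[OF Z st(1)] L2_martingaleD(2)[OF Z t]
  have ind: "integrable M (\<lambda>\<omega>. indicator A \<omega> * f \<omega>)" if "integrable M f" for f :: "'w \<Rightarrow> real"
    using integrable_real_mult_indicator[OF AM that] by (simp add: mult.commute)
  have V: "(\<lambda>\<omega>. indicator A \<omega> * Z s \<omega>) \<in> borel_measurable (F s)"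
    using A L2_martingaleD(1)[OF Z st(1)] by simp
  have V2: "integrable M (\<lambda>\<omega>. (indicator A \<omega> * Z s \<omega>)\<^sup>2)"
  proof -
    have "(indicator A \<omega> * Z s \<omega>)\<^sup>2 = indicator A \<omega> * (Z s \<omega>)\<^sup>2" for \<omega> by (simp add: indicator_def)
    then show ?thesis using ind[OF L2_martingaleD(3)[OF Z st(1)]] by simp
  qed
  have d: "integrable M (\<lambda>\<omega>. (Z t \<omega> - Z s \<omega>)\<^sup>2)"
    using L2_martingaleD(3)[OF Z st(1)] L2_martingaleD(3)[OF Z t] by (intro integrable_diff_sq) auto
  have c: "integrable M (\<lambda>\<omega>. indicator A \<omega> * Z s \<omega> * (Z t \<omega> - Z s \<omega>))"
    using V2 d by (intro integrable_mult_sq) auto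
  have "expectation (\<lambda>\<omega>. indicator A \<omega> * (Z t \<omega>)\<^sup>2) =
      expectation (\<lambda>\<omega>. indicator A \<omega> * (Z s \<omega>)\<^sup>2 + 2 * (indicator A \<omega> * Z s \<omega> * (Z t \<omega> - Z s \<omega>))
        + indicator A \<omega> * (Z t \<omega> - Z s \<omega>)\<^sup>2)"
    by (rule Bochner_Integration.integral_cong) (auto simp: power2_eq_square algebra_simps)
  also have "\<dots> = expectation (\<lambda>\<omega>. indicator A \<omega> * (Z s \<omega>)\<^sup>2)
      + 2 * expectation (\<lambda>\<omega>. indicator A \<omega> * Z s \<omega> * (Z t \<omega> - Z s \<omega>))
      + expectation (\<lambda>\<omega>. indicator A \<omega> * (Z t \<omega> - Z s \<omega>)\<^sup>2)"
    using ind[OF L2_martingaleD(3)[OF Z st(1)]] c ind[OF d] by simp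
  also have "\<dots> \<ge> expectation (\<lambda>\<omega>. indicator A \<omega> * (Z s \<omega>)\<^sup>2)"
    using L2_martingale_orthogonal[OF Z st V V2] by (simp add: integral_nonneg_AE)
  finally show ?thesis .
qed

text \<open>The event is split according to the first grid point at which the threshold is exceeded; this piece
belongs to the past of that point, so the second moment on it can only grow until \<open>T\<close>.\<close>

lemma kolmogorov_inequality_on_grid:
  fixes \<tau> :: "nat \<Rightarrow> real"
  assumes Z: "L2_martingale Z" and \<epsilon>: "\<epsilon> > 0"
    and \<tau>: "\<And>i j. i \<le> j \<Longrightarrow> j < n \<Longrightarrow> \<tau> i \<le> \<tau> j" "\<And>i. i < n \<Longrightarrow> 0 \<le> \<tau> i \<and> \<tau> i \<le> T"
  shows "\<epsilon>\<^sup>2 * prob (\<Union>i<n. {\<omega> \<in> space M. \<epsilon> < \<bar>Z (\<tau> i) \<omega>\<bar>}) \<le> expectation (\<lambda>\<omega>. (Z T \<omega>)\<^sup>2)"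
proof (cases "n = 0")
  case True
  then show ?thesis by (simp add: integral_nonneg_AE)
next
  case False
  then have T: "0 \<le> T" using \<tau>(2)[of 0] by simp
  define E where "E = (\<lambda>i. {\<omega> \<in> space M. \<epsilon> < \<bar>Z (\<tau> i) \<omega>\<bar>})"
  define D where "D = disjointed E"
  have E: "E j \<in> sets (F (\<tau> i))" if "j \<le> i" "i < n" for i j
  proof -
    have "Z (\<tau> j) \<in> borel_measurable (F (\<tau> i))"
      by (rule measurable_F_mono[OF \<tau>(1)[OF that] L2_martingaleD(1)[OF Z]])
        (use \<tau>(2)[of j] that in auto)
    then have "{\<omega> \<in> space (F (\<tau> i)). \<epsilon> < \<bar>Z (\<tau> j) \<omega>\<bar>} \<in> sets (F (\<tau> i))" by measurable
    then show ?thesis by (simp add: E_def)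
  qed
  have DF: "D i \<in> sets (F (\<tau> i))" if "i < n" for i
    unfolding D_def disjointed_def using E that by (intro sets.Diff sets.finite_UN) auto
  then have DM: "D i \<in> sets M" if "i < n" for i using that sets_F_M by blast
  have ZT: "integrable M (\<lambda>\<omega>. (Z T \<omega>)\<^sup>2)" using L2_martingaleD(3)[OF Z T] .
  have int: "integrable M (\<lambda>\<omega>. indicator (D i) \<omega> * (Z t \<omega>)\<^sup>2)" if "i < n" "0 \<le> t" for i t
    using integrable_real_mult_indicator[OF DM[OF that(1)] L2_martingaleD(3)[OF Z that(2)]]
    by (simp add: mult.commute)
  have step: "\<epsilon>\<^sup>2 * prob (D i) \<le> expectation (\<lambda>\<omega>. indicator (D i) \<omega> * (Z T \<omega>)\<^sup>2)" if i: "i < n" for i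
  proof -
    have "\<epsilon>\<^sup>2 * prob (D i) = expectation (\<lambda>\<omega>. \<epsilon>\<^sup>2 * indicator (D i) \<omega>)"
      using DM[OF i] by (simp add: Int_absorb1 sets.sets_into_space)
    also have "\<dots> \<le> expectation (\<lambda>\<omega>. indicator (D i) \<omega> * (Z (\<tau> i) \<omega>)\<^sup>2)"
    proof (rule integral_mono)
      show "integrable M (\<lambda>\<omega>. \<epsilon>\<^sup>2 * indicator (D i) \<omega>)"
        using DM[OF i] by (intro integrable_mult_right) (simp add: emeasure_eq_measure)
      fix \<omega>
      show "\<epsilon>\<^sup>2 * indicator (D i) \<omega> \<le> indicator (D i) \<omega> * (Z (\<tau> i) \<omega>)\<^sup>2"
      proof (cases "\<omega> \<in> D i")
        case True
        then have "\<epsilon> \<le> \<bar>Z (\<tau> i) \<omega>\<bar>" by (auto simp: D_def disjointed_def E_def)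
        then have "\<epsilon>\<^sup>2 \<le> \<bar>Z (\<tau> i) \<omega>\<bar>\<^sup>2" using \<epsilon> by (intro power_mono) auto
        then show ?thesis using True by simp
      qed simp
    qed (use int[OF i] \<tau>(2)[OF i] in auto)
    also have "\<dots> \<le> expectation (\<lambda>\<omega>. indicator (D i) \<omega> * (Z T \<omega>)\<^sup>2)"
      by (rule L2_martingale_sq_mono[OF Z _ _ DF[OF i]]) (use \<tau>(2)[OF i] in auto)
    finally show ?thesis .
  qed
  have disj: "disjoint_family D" unfolding D_def by (rule disjoint_family_disjointed)
  have "(\<Union>i<n. E i) = (\<Union>i<n. D i)"
    using finite_UN_disjointed_eq[of E n] by (simp add: D_def atLeast0LessThan)
  then have "\<epsilon>\<^sup>2 * prob (\<Union>i<n. E i) = (\<Sum>i<n. \<epsilon>\<^sup>2 * prob (D i))"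
    using DM disj by (simp add: finite_measure_finite_Union sum_distrib_left disjoint_family_on_mono[of _ UNIV] image_subset_iff)
  also have "\<dots> \<le> (\<Sum>i<n. expectation (\<lambda>\<omega>. indicator (D i) \<omega> * (Z T \<omega>)\<^sup>2))"
    by (intro sum_mono step) auto
  also have "\<dots> = expectation (\<lambda>\<omega>. \<Sum>i<n. indicator (D i) \<omega> * (Z T \<omega>)\<^sup>2)"
    using int T by (subst Bochner_Integration.integral_sum) auto
  also have "\<dots> \<le> expectation (\<lambda>\<omega>. (Z T \<omega>)\<^sup>2)"
  proof (rule integral_mono[OF _ ZT])
    show "integrable M (\<lambda>\<omega>. \<Sum>i<n. indicator (D i) \<omega> * (Z T \<omega>)\<^sup>2)"
      using int T by (intro Bochner_Integration.integrable_sum) auto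
    fix \<omega>
    have "disjoint_family_on D {..<n}" using disj by (rule disjoint_family_on_mono[rotated]) simp
    then have "(\<Sum>i<n. indicator (D i) \<omega> :: real) = indicator (\<Union>i<n. D i) \<omega>"
      by (intro indicator_UN_disjoint[symmetric]) auto
    then show "(\<Sum>i<n. indicator (D i) \<omega> * (Z T \<omega>)\<^sup>2) \<le> (Z T \<omega>)\<^sup>2"
      by (simp add: sum_distrib_right[symmetric] indicator_def)
  qed
  finally show ?thesis unfolding E_def .
qed

text \<open>Dyadic grids are nested, so their exceptional events increase to an event with the same probability
bound; off that event continuity extends the bound from dyadic times to all times. Naming the
exceptional event avoids measurability questions about the supremum of a path.\<close>

theorem kolmogorov_maximal_inequality:
  assumes Z: "L2_martingale Z" and \<epsilon>: "\<epsilon> > 0" and T: "0 \<le> T"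
    and cont: "\<And>\<omega>. \<omega> \<in> space M - N \<Longrightarrow> continuous_on {0..T} (\<lambda>t. Z t \<omega>)"
  shows "\<exists>A\<in>sets M. \<epsilon>\<^sup>2 * prob A \<le> expectation (\<lambda>\<omega>. (Z T \<omega>)\<^sup>2) \<and>
    (\<forall>\<omega>\<in>space M - A - N. \<forall>t\<in>{0..T}. \<bar>Z t \<omega>\<bar> \<le> \<epsilon>)"
proof -
  define E where "E = (\<lambda>t. {\<omega> \<in> space M. \<epsilon> < \<bar>Z t \<omega>\<bar>})"
  define A where "A = (\<lambda>k::nat. \<Union>i<2^k + 1. E (T * (real i / 2^k)))"
  have E: "E t \<in> sets M" if "0 \<le> t" for t
    using L2_martingaleD(2)[OF Z that] unfolding E_def by measurable
  have AM: "A k \<in> sets M" for k unfolding A_def using T by (intro sets.finite_UN E) auto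
  have bound: "\<epsilon>\<^sup>2 * prob (A k) \<le> expectation (\<lambda>\<omega>. (Z T \<omega>)\<^sup>2)" for k
    unfolding A_def E_def
  proof (rule kolmogorov_inequality_on_grid[OF Z \<epsilon>])
    show "T * (real i / 2^k) \<le> T * (real j / 2^k)" if "i \<le> j" for i j
      using that T by (intro mult_left_mono divide_right_mono) auto
    show "0 \<le> T * (real i / 2^k) \<and> T * (real i / 2^k) \<le> T" if "i < 2^k + 1" for i
    proof -
      have "real i / 2^k \<le> 1" using that by (simp add: divide_le_eq)
      from mult_left_mono[OF this T] have "T * (real i / 2^k) \<le> T" by (simp only: mult_1_right)
      then show ?thesis using T by simp
    qed
  qed
  have inc: "incseq A"
  proof (rule incseq_SucI)
    fix k
    show "A k \<le> A (Suc k)"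
    proof
      fix \<omega> assume "\<omega> \<in> A k"
      then obtain i where "i < 2^k + 1" "\<omega> \<in> E (T * (real i / 2^k))" by (auto simp: A_def)
      then have "2 * i < 2^Suc k + 1" "\<omega> \<in> E (T * (real (2 * i) / 2^Suc k))" by auto
      then show "\<omega> \<in> A (Suc k)" unfolding A_def by blast
    qed
  qed
  have "(\<lambda>k. \<epsilon>\<^sup>2 * prob (A k)) \<longlonglongrightarrow> \<epsilon>\<^sup>2 * prob (\<Union>k. A k)"
    using AM inc by (intro tendsto_mult tendsto_const finite_Lim_measure_incseq) auto
  then have "\<epsilon>\<^sup>2 * prob (\<Union>k. A k) \<le> expectation (\<lambda>\<omega>. (Z T \<omega>)\<^sup>2)"
    by (rule LIMSEQ_le_const2) (use bound in auto)
  moreover have "\<bar>Z t \<omega>\<bar> \<le> \<epsilon>" if \<omega>: "\<omega> \<in> space M - (\<Union>k. A k) - N" and t: "t \<in> {0..T}" for \<omega> t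
  proof -
    define r where "r = t / T"
    have r: "0 \<le> r" "r \<le> 1" "T * r = t" using t T by (auto simp: r_def divide_le_eq)
    define i where "i = (\<lambda>k::nat. nat \<lfloor>r * 2^k\<rfloor>)"
    have ri: "real (i k) \<le> r * 2^k" for k
      using r by (auto simp: i_def)
    have i: "i k < 2^k + 1" for k
    proof -
      have "real (i k) \<le> 2^k" using ri[of k] r by (meson mult_left_le_one_le order_trans zero_le_numeral zero_le_power)
      then show ?thesis by (metis Suc_eq_plus1 less_Suc_eq_le of_nat_le_iff of_nat_numeral of_nat_power)
    qed
    have lim: "(\<lambda>k. real (i k) / 2^k) \<longlonglongrightarrow> r"
      unfolding i_def by (rule dyadic_floor_tendsto[OF r(1)])
    have mem: "T * (real (i k) / 2^k) \<in> {0..T}" for k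
    proof -
      have "real (i k) / 2^k \<le> 1" using i[of k] by (simp add: divide_le_eq)
      from mult_left_mono[OF this T] have "T * (real (i k) / 2^k) \<le> T" by (simp only: mult_1_right)
      then show ?thesis using T by simp
    qed
    have "(\<lambda>k. T * (real (i k) / 2^k)) \<longlonglongrightarrow> t"
      using tendsto_mult[OF tendsto_const[of T] lim] r(3) by simp
    then have "(\<lambda>k. Z (T * (real (i k) / 2^k)) \<omega>) \<longlonglongrightarrow> Z t \<omega>"
      using cont[of \<omega>] \<omega> t mem by (intro continuous_on_tendsto_compose[where f="\<lambda>t. Z t \<omega>" and s="{0..T}"]) auto
    then have "(\<lambda>k. \<bar>Z (T * (real (i k) / 2^k)) \<omega>\<bar>) \<longlonglongrightarrow> \<bar>Z t \<omega>\<bar>" by (rule tendsto_rabs)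
    moreover have "\<bar>Z (T * (real (i k) / 2^k)) \<omega>\<bar> \<le> \<epsilon>" for k
    proof -
      have "\<omega> \<notin> E (T * (real (i k) / 2^k))" using \<omega> i[of k] unfolding A_def by blast
      then show ?thesis using \<omega> by (auto simp: E_def)
    qed
    ultimately show ?thesis by (intro LIMSEQ_le_const2) auto
  qed
  ultimately show ?thesis using AM by (intro bexI[of _ "\<Union>k. A k"]) auto
qed

end

context adapted_brownian
begin

text \<open>The increment of each summand between \<open>s\<close> and \<open>t\<close> is the coefficient times the increment of \<open>W\<close> over
the part of the partition interval between \<open>s\<close> and \<open>t\<close>, whose left endpoint lies after \<open>s\<close> and after
the time at which the coefficient is known.\<close>

lemma L2_martingale_simple_ito:
  assumes S: "simple_integrand M F n \<tau> \<xi>"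
  shows "L2_martingale (simple_ito W n \<tau> \<xi>)"
  unfolding L2_martingale_def
proof (intro conjI allI impI)
  fix t :: real assume t: "0 \<le> t"
  show "simple_ito W n \<tau> \<xi> t \<in> borel_measurable (F t)" by (rule simple_ito_adapted[OF S t])
  show "integrable M (\<lambda>\<omega>. (simple_ito W n \<tau> \<xi> t \<omega>)\<^sup>2)"
    using simple_ito_product(1)[OF S S t] by (simp add: power2_eq_square)
next
  fix s t :: real and V :: "'w \<Rightarrow> real"
  assume st: "0 \<le> s" "s \<le> t" and V: "V \<in> borel_measurable (F s)" "integrable M (\<lambda>\<omega>. (V \<omega>)\<^sup>2)"
  have VM[measurable]: "V \<in> borel_measurable M" using V measurable_F_M by blast
  have V1: "integrable M V" using integrable_mult_sq[OF VM _ V(2), of "\<lambda>_. 1"] by simp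
  have cov: "has_bochner_integral M (\<lambda>\<omega>. V \<omega> * (\<xi> i \<omega> * (W (min t (\<tau> (Suc i))) \<omega> - W (min t (\<tau> i)) \<omega>)
      - \<xi> i \<omega> * (W (min s (\<tau> (Suc i))) \<omega> - W (min s (\<tau> i)) \<omega>))) 0" if i: "i < n" for i
  proof (cases "\<tau> (Suc i) \<le> s \<or> t \<le> \<tau> i")
    case True
    then have "(min t (\<tau> (Suc i)) = min s (\<tau> (Suc i)) \<and> min t (\<tau> i) = min s (\<tau> i)) \<or>
        (min t (\<tau> (Suc i)) = min t (\<tau> i) \<and> min s (\<tau> (Suc i)) = min s (\<tau> i))"
      using st simple_integrandD(2)[OF S i] by auto
    then have "(\<lambda>\<omega>. V \<omega> * (\<xi> i \<omega> * (W (min t (\<tau> (Suc i))) \<omega> - W (min t (\<tau> i)) \<omega>)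
      - \<xi> i \<omega> * (W (min s (\<tau> (Suc i))) \<omega> - W (min s (\<tau> i)) \<omega>))) = (\<lambda>_. 0)"
      by auto
    then show ?thesis by (simp only: has_bochner_integral_zero)
  next
    case False
    \<comment> \<open>The part of the interval of index \<open>i\<close> that lies between \<open>s\<close> and \<open>t\<close> is \<open>{c<..e}\<close>.\<close>
    define c where "c = max s (\<tau> i)"
    define e where "e = min t (\<tau> (Suc i))"
    have ce: "0 \<le> c" "c \<le> e" "s \<le> c" "\<tau> i \<le> c"
      using False st simple_integrandD(2)[OF S i] by (auto simp: c_def e_def)
    have m: "(\<lambda>\<omega>. V \<omega> * \<xi> i \<omega>) \<in> borel_measurable (F c)"
      using measurable_F_mono[OF ce(3) V(1)] measurable_F_mono[OF ce(4) simple_integrandD(3)[OF S i]] by simp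
    obtain K where K: "\<And>\<omega>. \<omega> \<in> space M \<Longrightarrow> \<bar>\<xi> i \<omega>\<bar> \<le> K"
      using simple_integrandD(4)[OF S i] by (auto simp: bounded_real)
    have "integrable M (\<lambda>\<omega>. V \<omega> * K)" using V1 by simp
    then have "integrable M (\<lambda>\<omega>. V \<omega> * \<xi> i \<omega>)"
      by (rule Bochner_Integration.integrable_bound)
        (use m measurable_F_M K in \<open>auto simp: abs_mult intro!: mult_left_mono AE_I2 intro: order_trans[OF _ abs_ge_self]\<close>)
    from increment_orthogonal[OF ce(1,2) m this]
    have "has_bochner_integral M (\<lambda>\<omega>. V \<omega> * \<xi> i \<omega> * (W e \<omega> - W c \<omega>)) 0"
      by (simp add: has_bochner_integral_iff)
    moreover have "V \<omega> * (\<xi> i \<omega> * (W (min t (\<tau> (Suc i))) \<omega> - W (min t (\<tau> i)) \<omega>)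
      - \<xi> i \<omega> * (W (min s (\<tau> (Suc i))) \<omega> - W (min s (\<tau> i)) \<omega>)) = V \<omega> * \<xi> i \<omega> * (W e \<omega> - W c \<omega>)" for \<omega>
    proof -
      have 1: "min t (\<tau> i) = \<tau> i" "min s (\<tau> (Suc i)) = s" using False by auto
      have "W (min t (\<tau> (Suc i))) \<omega> - W (min t (\<tau> i)) \<omega> - (W (min s (\<tau> (Suc i))) \<omega> - W (min s (\<tau> i)) \<omega>)
        = W e \<omega> - W c \<omega>"
        unfolding 1 by (simp add: c_def e_def max_def min_def)
      then show ?thesis by (simp add: right_diff_distrib[symmetric] mult.assoc)
    qed
    ultimately show ?thesis by (simp only:)
  qed
  have "has_bochner_integral M (\<lambda>\<omega>. \<Sum>i<n. V \<omega> * (\<xi> i \<omega> * (W (min t (\<tau> (Suc i))) \<omega> - W (min t (\<tau> i)) \<omega>)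
      - \<xi> i \<omega> * (W (min s (\<tau> (Suc i))) \<omega> - W (min s (\<tau> i)) \<omega>))) (\<Sum>i<n. 0)"
    by (intro has_bochner_integral_sum cov) auto
  also have "(\<lambda>\<omega>. \<Sum>i<n. V \<omega> * (\<xi> i \<omega> * (W (min t (\<tau> (Suc i))) \<omega> - W (min t (\<tau> i)) \<omega>)
      - \<xi> i \<omega> * (W (min s (\<tau> (Suc i))) \<omega> - W (min s (\<tau> i)) \<omega>)))
      = (\<lambda>\<omega>. V \<omega> * (simple_ito W n \<tau> \<xi> t \<omega> - simple_ito W n \<tau> \<xi> s \<omega>))"
    by (simp add: simple_ito_def sum_subtractf[symmetric] sum_distrib_left)
  finally show "expectation (\<lambda>\<omega>. V \<omega> * (simple_ito W n \<tau> \<xi> t \<omega> - simple_ito W n \<tau> \<xi> s \<omega>)) = 0"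
    by (simp add: has_bochner_integral_iff)
qed

end

section \<open>Limits of continuous processes\<close>

lemma continuous_on_halfline:
  fixes f :: "real \<Rightarrow> 'e::topological_space"
  assumes "\<And>k::nat. continuous_on {0..real k} f"
  shows "continuous_on {0..} f"
  unfolding continuous_on_eq_continuous_within
proof
  fix t :: real assume t: "t \<in> {0..}"
  obtain k :: nat where k: "t < real k" using reals_Archimedean2 by blast
  have "continuous (at t within {0..real k}) f"
    using assms[of k] t k by (auto simp: continuous_on_eq_continuous_within)
  moreover have "at t within {0..real k} = at t within {0..}"
    by (rule at_within_nhd[of _ "{..<real k}"]) (use k in auto)
  ultimately show "continuous (at t within {0..}) f" by (simp add: continuous_within)
qed

lemma uniformly_Cauchy_on_geometric:
  fixes f :: "nat \<Rightarrow> 'x \<Rightarrow> 'e::metric_space"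
  assumes step: "\<And>n x. n0 \<le> n \<Longrightarrow> x \<in> X \<Longrightarrow> dist (f n x) (f (Suc n) x) \<le> (1/2)^n"
  shows "uniformly_Cauchy_on X f"
proof -
  have tele: "dist (f m x) (f (m + k) x) \<le> 2 * (1/2)^m - 2 * (1/2)^(m + k)" if "n0 \<le> m" "x \<in> X" for m k x
  proof (induction k)
    case (Suc k)
    have "dist (f m x) (f (m + Suc k) x) \<le> dist (f m x) (f (m + k) x) + dist (f (m + k) x) (f (Suc (m + k)) x)"
      using dist_triangle by auto
    also have "\<dots> \<le> (2 * (1/2)^m - 2 * (1/2)^(m + k)) + (1/2)^(m + k)"
      using Suc step[of "m + k" x] that by (intro add_mono) auto
    also have "\<dots> = 2 * (1/2)^m - 2 * (1/2)^(m + Suc k)" by simp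
    finally show ?case .
  qed simp
  have close: "dist (f m x) (f n x) \<le> 2 * (1/2)^m" if "n0 \<le> m" "m \<le> n" "x \<in> X" for m n x
  proof -
    have "dist (f m x) (f n x) \<le> 2 * (1/2)^m - 2 * (1/2)^n"
      using tele[OF that(1,3), of "n - m"] that(2) by simp
    moreover have "(0::real) \<le> 2 * (1/2)^n" by simp
    ultimately show ?thesis by linarith
  qed
  show ?thesis
    unfolding uniformly_Cauchy_on_def
  proof (intro allI impI)
    fix e :: real assume e: "e > 0"
    obtain K where K: "(1/2::real)^K < e / 4" using real_arch_pow_inv[of "e/4" "1/2"] e by auto
    have "dist (f m x) (f n x) < e" if "x \<in> X" "max n0 K \<le> m" "max n0 K \<le> n" for x m n
    proof -
      let ?k = "max n0 K"
      have "dist (f m x) (f n x) \<le> dist (f ?k x) (f m x) + dist (f ?k x) (f n x)"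
        by (rule dist_triangle3)
      also have "\<dots> \<le> 2 * (1/2)^?k + 2 * (1/2)^?k"
        using that by (intro add_mono close) auto
      also have "\<dots> \<le> 4 * (1/2)^K"
        using power_decreasing[of K ?k "1/2::real"] by simp
      finally show ?thesis using K by simp
    qed
    then show "\<exists>M. \<forall>x\<in>X. \<forall>m\<ge>M. \<forall>n\<ge>M. dist (f m x) (f n x) < e" by blast
  qed
qed

text \<open>Mean square bounds survive almost sure limits.\<close>

lemma fatou_bound:
  assumes [measurable]: "\<And>k::nat. g k \<in> borel_measurable M"
    and lim: "AE \<omega> in M. (\<lambda>k. g k \<omega>) \<longlonglongrightarrow> h \<omega>"
    and bound: "\<forall>\<^sub>F k in sequentially. (\<integral>\<^sup>+\<omega>. g k \<omega> \<partial>M) \<le> (c :: ennreal)"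
  shows "(\<integral>\<^sup>+\<omega>. h \<omega> \<partial>M) \<le> c"
proof -
  have "(\<integral>\<^sup>+\<omega>. h \<omega> \<partial>M) = (\<integral>\<^sup>+\<omega>. liminf (\<lambda>k. g k \<omega>) \<partial>M)"
    by (intro nn_integral_cong_AE eventually_mono[OF lim]) (simp add: lim_imp_Liminf)
  also have "\<dots> \<le> liminf (\<lambda>k. \<integral>\<^sup>+\<omega>. g k \<omega> \<partial>M)" by (rule nn_integral_liminf) simp
  also have "\<dots> \<le> liminf (\<lambda>k. c)" by (rule Liminf_mono[OF bound])
  also have "\<dots> = c" by (simp add: Liminf_const)
  finally show ?thesis .
qed

context filtered_prob_space
begin

text \<open>Where the increments are eventually dominated by a geometric series, locally uniformly in time, the
processes form a uniform Cauchy sequence on every compact interval. On the remaining null set the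
limit is set to a constant; since the filtration contains the null sets this keeps it adapted, and
it makes every path continuous.\<close>

lemma fast_convergent_processes:
  fixes Zn :: "nat \<Rightarrow> real \<Rightarrow> 'w \<Rightarrow> 'e::euclidean_space"
  assumes null: "\<And>t. 0 \<le> t \<Longrightarrow> null_sets M \<subseteq> sets (F t)"
    and meas: "\<And>n t. 0 \<le> t \<Longrightarrow> Zn n t \<in> borel_measurable (F t)"
    and N0: "N0 \<in> null_sets M"
    and cont: "\<And>n \<omega>. \<omega> \<in> space M - N0 \<Longrightarrow> continuous_on {0..} (\<lambda>t. Zn n t \<omega>)"
    and step: "\<And>k::nat. AE \<omega> in M. \<forall>\<^sub>F n in sequentially.
      \<forall>t\<in>{0..real k}. dist (Zn n t \<omega>) (Zn (Suc n) t \<omega>) \<le> (1/2)^n"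
  shows "\<exists>Z N. N \<in> null_sets M \<and> (\<forall>t\<ge>0. Z t \<in> borel_measurable (F t)) \<and>
    (\<forall>\<omega>. continuous_on {0..} (\<lambda>t. Z t \<omega>)) \<and>
    (\<forall>\<omega>\<in>space M - N. \<forall>t\<ge>0. (\<lambda>n. Zn n t \<omega>) \<longlonglongrightarrow> Z t \<omega>) \<and>
    (\<forall>\<omega>. \<omega> \<notin> space M - N \<longrightarrow> (\<forall>t. Z t \<omega> = z0))"
proof -
  have "AE \<omega> in M. \<forall>k. \<forall>\<^sub>F n in sequentially.
      \<forall>t\<in>{0..real k}. dist (Zn n t \<omega>) (Zn (Suc n) t \<omega>) \<le> (1/2)^n"
    unfolding AE_all_countable using step by blast
  then obtain N1 where N1: "N1 \<in> null_sets M"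
    "\<And>\<omega> k. \<omega> \<in> space M - N1 \<Longrightarrow> \<forall>\<^sub>F n in sequentially.
      \<forall>t\<in>{0..real k}. dist (Zn n t \<omega>) (Zn (Suc n) t \<omega>) \<le> (1/2)^n"
    by (auto elim!: AE_E3)
  define N where "N = N0 \<union> N1"
  have N: "N \<in> null_sets M" unfolding N_def using N0 N1(1) by (rule null_sets.Un)
  define Z where "Z = (\<lambda>t \<omega>. if \<omega> \<in> space M - N then lim (\<lambda>n. Zn n t \<omega>) else z0)"
  have unif: "uniform_limit {0..real k} (\<lambda>n t. Zn n t \<omega>) (\<lambda>t. Z t \<omega>) sequentially"
    if \<omega>: "\<omega> \<in> space M - N" for \<omega> k
  proof -
    obtain n1 where n1: "\<And>n t. n1 \<le> n \<Longrightarrow> t \<in> {0..real k} \<Longrightarrow>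
        dist (Zn n t \<omega>) (Zn (Suc n) t \<omega>) \<le> (1/2)^n"
      using N1(2)[of \<omega> k] \<omega> unfolding eventually_sequentially N_def by blast
    have "uniformly_Cauchy_on {0..real k} (\<lambda>n t. Zn n t \<omega>)"
      by (rule uniformly_Cauchy_on_geometric[of n1]) (rule n1)
    then have "uniform_limit {0..real k} (\<lambda>n t. Zn n t \<omega>) (\<lambda>t. lim (\<lambda>n. Zn n t \<omega>)) sequentially"
      by (simp add: Cauchy_uniformly_convergent uniformly_convergent_uniform_limit_iff[symmetric])
    moreover have "(\<lambda>t. Z t \<omega>) = (\<lambda>t. lim (\<lambda>n. Zn n t \<omega>))" using \<omega> by (simp add: Z_def)
    ultimately show ?thesis by simp
  qed
  have lim: "(\<lambda>n. Zn n t \<omega>) \<longlonglongrightarrow> Z t \<omega>" if \<omega>: "\<omega> \<in> space M - N" and t: "0 \<le> t" for \<omega> t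
  proof -
    obtain k :: nat where "t < real k" using reals_Archimedean2 by blast
    then show ?thesis using tendsto_uniform_limitI[OF unif[OF \<omega>, of k], of t] t by simp
  qed
  have "continuous_on {0..} (\<lambda>t. Z t \<omega>)" for \<omega>
  proof (cases "\<omega> \<in> space M - N")
    case True
    show ?thesis
    proof (rule continuous_on_halfline, rule uniform_limit_theorem[OF _ unif[OF True]])
      fix k
      show "\<forall>\<^sub>F n in sequentially. continuous_on {0..real k} (\<lambda>t. Zn n t \<omega>)"
        using True by (intro always_eventually allI continuous_on_subset[OF cont]) (auto simp: N_def)
    qed simp
  next
    case False
    then have "Z t \<omega> = z0" for t by (auto simp: Z_def)
    then show ?thesis by (simp only: continuous_on_const)
  qed
  moreover have "Z t \<in> borel_measurable (F t)" if t: "0 \<le> t" for t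
  proof (rule borel_measurable_LIMSEQ_metric)
    have [measurable]: "N \<in> sets (F t)" using null[OF t] N by blast
    note [measurable] = meas[OF t]
    show "(\<lambda>\<omega>. if \<omega> \<in> N then z0 else Zn n t \<omega>) \<in> borel_measurable (F t)" for n by measurable
    fix \<omega> assume "\<omega> \<in> space (F t)"
    then show "(\<lambda>n. if \<omega> \<in> N then z0 else Zn n t \<omega>) \<longlonglongrightarrow> Z t \<omega>"
      using lim[of \<omega> t] t by (cases "\<omega> \<in> N") (auto simp: Z_def)
  qed
  ultimately show ?thesis using N lim by (intro exI[of _ Z] exI[of _ N]) (auto simp: Z_def)
qed

end

text \<open>The process is the limit of its values at the dyadic times to the left, which depend on time through
a countable parameter only.\<close>

lemma jointly_measurable_continuous:
  fixes H :: "real \<Rightarrow> 'w \<Rightarrow> 'e::metric_space"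
  assumes meas: "\<And>s. 0 \<le> s \<Longrightarrow> H s \<in> borel_measurable M"
    and cont: "\<And>\<omega>. \<omega> \<in> space M \<Longrightarrow> continuous_on {0..} (\<lambda>s. H s \<omega>)"
  shows "jointly_measurable M H"
  unfolding jointly_measurable_def
proof (rule borel_measurable_LIMSEQ_metric[where
      f="\<lambda>m p. H (real (nat \<lfloor>fst p * 2^m\<rfloor>) / 2^m) (snd p)"])
  let ?P = "restrict_space borel {0::real..} \<Otimes>\<^sub>M M"
  fix m :: nat
  have "(\<lambda>x. x) \<in> restrict_space borel {0::real..} \<rightarrow>\<^sub>M borel"
    by (rule measurable_restrict_space1) simp
  from measurable_compose[OF measurable_fst this]
  have [measurable]: "fst \<in> borel_measurable ?P" .
  show "(\<lambda>p. H (real (nat \<lfloor>fst p * 2^m\<rfloor>) / 2^m) (snd p)) \<in> borel_measurable ?P"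
  proof (rule measurable_compose_countable[where f="\<lambda>i p. H (real i / 2^m) (snd p)"
        and g="\<lambda>p. nat \<lfloor>fst p * 2^m\<rfloor>"])
    show "(\<lambda>p. H (real i / 2^m) (snd p)) \<in> borel_measurable ?P" for i
      using meas[of "real i / 2^m"] by measurable
  qed measurable
next
  fix p :: "real \<times> 'w" assume p: "p \<in> space (restrict_space borel {0..} \<Otimes>\<^sub>M M)"
  obtain s \<omega> where so: "p = (s, \<omega>)" by (cases p)
  have s: "0 \<le> s" and \<omega>: "\<omega> \<in> space M" using p so by (auto simp: space_pair_measure space_restrict_space)
  have "(\<lambda>m. real (nat \<lfloor>s * 2^m\<rfloor>) / 2^m) \<longlonglongrightarrow> s"
    using s by (rule dyadic_floor_tendsto)
  then have "(\<lambda>m. H (real (nat \<lfloor>s * 2^m\<rfloor>) / 2^m) \<omega>) \<longlonglongrightarrow> H s \<omega>"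
    using cont[OF \<omega>] s by (intro continuous_on_tendsto_compose[where f="\<lambda>s. H s \<omega>" and s="{0..}"]) auto
  then show "(\<lambda>m. H (real (nat \<lfloor>fst p * 2^m\<rfloor>) / 2^m) (snd p)) \<longlonglongrightarrow> (case p of (s, \<omega>) \<Rightarrow> H s \<omega>)"
    by (simp add: so)
qed

lemma energy_mono_time: "T \<le> T' \<Longrightarrow> energy M T U \<le> energy M T' U"
  unfolding energy_def by (intro nn_integral_mono) (auto simp: indicator_def)

lemma (in prob_space) energy_bounded_le:
  assumes C: "\<And>s \<omega>. 0 \<le> s \<Longrightarrow> \<omega> \<in> space M \<Longrightarrow> \<bar>U s \<omega>\<bar> \<le> C" and T: "0 \<le> T"
  shows "energy M T U \<le> ennreal (C\<^sup>2 * T)"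
proof -
  have "energy M T U \<le> (\<integral>\<^sup>+\<omega>. ennreal (C\<^sup>2 * T) \<partial>M)"
    unfolding energy_def
  proof (rule nn_integral_mono)
    fix \<omega> assume \<omega>: "\<omega> \<in> space M"
    have "(U s \<omega>)\<^sup>2 \<le> C\<^sup>2" if "0 \<le> s" for s
      using power_mono[OF C[OF that \<omega>] abs_ge_zero, of 2] by simp
    then have "(\<integral>\<^sup>+s\<in>{0..T}. ennreal ((U s \<omega>)\<^sup>2) \<partial>lborel) \<le> (\<integral>\<^sup>+s\<in>{0..T}. ennreal (C\<^sup>2) \<partial>lborel)"
      by (intro nn_integral_mono) (auto simp: indicator_def ennreal_leI)
    also have "\<dots> = ennreal (C\<^sup>2 * T)"
      using T by (simp add: nn_integral_cmult_indicator ennreal_mult)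
    finally show "(\<integral>\<^sup>+s\<in>{0..T}. ennreal ((U s \<omega>)\<^sup>2) \<partial>lborel) \<le> ennreal (C\<^sup>2 * T)" .
  qed
  then show ?thesis by (simp add: emeasure_space_1)
qed

text \<open>Dominated convergence, first in time and then over the probability space. Time 0 is
excluded because elementary integrands vanish there.\<close>

lemma (in prob_space) energy_tendsto_0:
  assumes U: "\<And>m::nat. jointly_measurable M (U m)"
    and C: "\<And>m s \<omega>. 0 \<le> s \<Longrightarrow> \<omega> \<in> space M \<Longrightarrow> \<bar>U m s \<omega>\<bar> \<le> C"
    and lim: "AE \<omega> in M. \<forall>s>0. (\<lambda>m. U m s \<omega>) \<longlonglongrightarrow> 0" and T: "0 \<le> T"
  shows "(\<lambda>m. energy M T (U m)) \<longlonglongrightarrow> 0"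
proof -
  have fin: "(\<integral>\<^sup>+s\<in>{0..T}. ennreal (C\<^sup>2) \<partial>lborel) = ennreal (C\<^sup>2 * T)"
    using T by (simp add: nn_integral_cmult_indicator ennreal_mult)
  have sq: "ennreal ((U m s \<omega>)\<^sup>2) \<le> ennreal (C\<^sup>2)" if "0 \<le> s" "\<omega> \<in> space M" for m s \<omega>
    using power_mono[OF C[OF that, of m] abs_ge_zero, where n=2] by (simp add: ennreal_leI)
  have inner: "(\<lambda>m. \<integral>\<^sup>+s\<in>{0..T}. ennreal ((U m s \<omega>)\<^sup>2) \<partial>lborel) \<longlonglongrightarrow> 0"
    if \<omega>: "\<omega> \<in> space M" and lim: "\<forall>s>0. (\<lambda>m. U m s \<omega>) \<longlonglongrightarrow> 0" for \<omega>
  proof -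
    have "(\<lambda>m. \<integral>\<^sup>+s\<in>{0..T}. ennreal ((U m (max 0 s) \<omega>)\<^sup>2) \<partial>lborel) \<longlonglongrightarrow> (\<integral>\<^sup>+s. 0 \<partial>(lborel :: real measure))"
    proof (rule nn_integral_dominated_convergence)
      show "(\<lambda>s. ennreal ((U m (max 0 s) \<omega>)\<^sup>2) * indicator {0..T} s) \<in> borel_measurable lborel" for m
        by (rule jointly_measurable_inner(2)[OF U \<omega>])
      show "(\<lambda>s. ennreal (C\<^sup>2) * indicator {0..T} s) \<in> borel_measurable lborel" by simp
      show "AE s in lborel. ennreal ((U m (max 0 s) \<omega>)\<^sup>2) * indicator {0..T} s
          \<le> ennreal (C\<^sup>2) * indicator {0..T} s" for m
        using sq \<omega> by (intro AE_I2) (auto simp: indicator_def)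
      show "(\<integral>\<^sup>+s\<in>{0..T}. ennreal (C\<^sup>2) \<partial>lborel) < \<infinity>" using fin by simp
      have "AE s in lborel. s \<noteq> (0::real)" by (rule AE_lborel_singleton)
      then show "AE s in lborel. (\<lambda>m. ennreal ((U m (max 0 s) \<omega>)\<^sup>2) * indicator {0..T} s) \<longlonglongrightarrow> 0"
      proof (rule eventually_mono)
        fix s :: real assume s: "s \<noteq> 0"
        show "(\<lambda>m. ennreal ((U m (max 0 s) \<omega>)\<^sup>2) * indicator {0..T} s) \<longlonglongrightarrow> 0"
        proof (cases "s \<in> {0..T}")
          case True
          then have "(\<lambda>m. ennreal ((U m s \<omega>)\<^sup>2)) \<longlonglongrightarrow> ennreal (0\<^sup>2)"
            using s lim by (intro tendsto_ennrealI tendsto_power) auto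
          then show ?thesis using True by (simp add: max_absorb2)
        qed simp
      qed
    qed simp
    then show ?thesis by (simp add: clamp_nn_integral[where f="\<lambda>s. ennreal ((U _ s \<omega>)\<^sup>2)"])
  qed
  have "(\<lambda>m. energy M T (U m)) \<longlonglongrightarrow> (\<integral>\<^sup>+\<omega>. 0 \<partial>M)"
    unfolding energy_def
  proof (rule nn_integral_dominated_convergence)
    show "(\<lambda>\<omega>. \<integral>\<^sup>+s\<in>{0..T}. ennreal ((U m s \<omega>)\<^sup>2) \<partial>lborel) \<in> borel_measurable M" for m
      by (rule jointly_measurable_inner(1)[OF U])
    show "(\<lambda>\<omega>. ennreal (C\<^sup>2 * T)) \<in> borel_measurable M" by simp
    show "AE \<omega> in M. (\<integral>\<^sup>+s\<in>{0..T}. ennreal ((U m s \<omega>)\<^sup>2) \<partial>lborel) \<le> ennreal (C\<^sup>2 * T)" for m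
    proof (rule AE_I2)
      fix \<omega> assume "\<omega> \<in> space M"
      then show "(\<integral>\<^sup>+s\<in>{0..T}. ennreal ((U m s \<omega>)\<^sup>2) \<partial>lborel) \<le> ennreal (C\<^sup>2 * T)"
        unfolding fin[symmetric] using sq by (intro nn_integral_mono) (auto simp: indicator_def)
    qed
    show "(\<integral>\<^sup>+\<omega>. ennreal (C\<^sup>2 * T) \<partial>M) < \<infinity>" by (simp add: emeasure_space_1)
    show "AE \<omega> in M. (\<lambda>m. \<integral>\<^sup>+s\<in>{0..T}. ennreal ((U m s \<omega>)\<^sup>2) \<partial>lborel) \<longlonglongrightarrow> 0"
      using lim AE_space by eventually_elim (rule inner)
  qed simp
  then show ?thesis by simp
qed

section \<open>Existence of the Ito integral\<close>

text \<open>The elementary integrand on the grid of mesh \<open>2^-m\<close> in \<open>[0,m]\<close> that takes the values of \<open>H\<close> at the left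
endpoints.\<close>

definition dyadic_process :: "(real \<Rightarrow> 'w \<Rightarrow> real) \<Rightarrow> nat \<Rightarrow> real \<Rightarrow> 'w \<Rightarrow> real" where
  "dyadic_process H m = simple_process (m * 2^m) (\<lambda>i. real i / 2^m) (\<lambda>i. H (real i / 2^m))"

lemma dyadic_process_eq:
  "dyadic_process H m s \<omega> = (if s \<in> {0<..real m} then H (real (nat (\<lceil>s * 2^m\<rceil> - 1)) / 2^m) \<omega> else 0)"
proof -
  define c where "c = \<lceil>s * 2^m\<rceil>"
  have ind: "indicator {real j / 2^m<..real (Suc j) / 2^m} s = (if c = int j + 1 then 1 else (0::real))" for j
  proof -
    have "s \<in> {real j / 2^m<..real (Suc j) / 2^m} \<longleftrightarrow> real j < s * 2^m \<and> s * 2^m \<le> real j + 1"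
      by (simp add: divide_less_eq le_divide_eq add.commute)
    also have "\<dots> \<longleftrightarrow> c = int j + 1" unfolding c_def ceiling_eq_iff by simp
    finally show ?thesis by (simp add: indicator_def)
  qed
  have pos: "0 < s \<longleftrightarrow> 0 < c" by (simp add: c_def zero_less_mult_iff)
  have le: "s \<le> real m \<longleftrightarrow> c \<le> int (m * 2^m)"
  proof -
    have "c \<le> int (m * 2^m) \<longleftrightarrow> s * 2^m \<le> real m * 2^m" unfolding c_def ceiling_le_iff by simp
    then show ?thesis by simp
  qed
  have "dyadic_process H m s \<omega> = (\<Sum>j<m * 2^m. if c = int j + 1 then H (real j / 2^m) \<omega> else 0)"
    unfolding dyadic_process_def simple_process_def ind by (simp add: if_distrib cong: if_cong)
  also have "\<dots> = (\<Sum>j<m * 2^m. if j = nat (c - 1) \<and> 0 < c then H (real j / 2^m) \<omega> else 0)"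
    by (intro sum.cong refl) (auto simp: nat_eq_iff)
  also have "\<dots> = (if 0 < c \<and> c \<le> int (m * 2^m) then H (real (nat (c - 1)) / 2^m) \<omega> else 0)"
    by (cases "0 < c") (auto simp: sum.delta nat_less_iff)
  finally show ?thesis using pos le by (simp add: c_def)
qed

lemma dyadic_process_tendsto:
  assumes cont: "continuous_on {0..} (\<lambda>s. H s \<omega>)" and s: "0 < s"
  shows "(\<lambda>m. dyadic_process H m s \<omega>) \<longlonglongrightarrow> H s \<omega>"
proof -
  have c: "s * 2^m - 1 \<le> real (nat (\<lceil>s * 2^m\<rceil> - 1))" "real (nat (\<lceil>s * 2^m\<rceil> - 1)) \<le> s * 2^m" for m :: nat
  proof -
    have "0 < \<lceil>s * 2^m\<rceil>" using s by simp
    then have "real (nat (\<lceil>s * 2^m\<rceil> - 1)) = of_int \<lceil>s * 2^m\<rceil> - 1" by simp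
    then show "s * 2^m - 1 \<le> real (nat (\<lceil>s * 2^m\<rceil> - 1))" "real (nat (\<lceil>s * 2^m\<rceil> - 1)) \<le> s * 2^m"
      using ceiling_correct[of "s * 2^m"] by linarith+
  qed
  have "(\<lambda>m. real (nat (\<lceil>s * 2^m\<rceil> - 1)) / 2^m) \<longlonglongrightarrow> s"
  proof (rule tendsto_sandwich)
    show "\<forall>\<^sub>F m in sequentially. s - (1/2)^m \<le> real (nat (\<lceil>s * 2^m\<rceil> - 1)) / 2^m"
    proof (intro always_eventually allI)
      fix m
      have "(s * 2^m - 1) / 2^m \<le> real (nat (\<lceil>s * 2^m\<rceil> - 1)) / 2^m" using c(1) by (rule divide_right_mono) simp
      then show "s - (1/2)^m \<le> real (nat (\<lceil>s * 2^m\<rceil> - 1)) / 2^m" by (simp add: diff_divide_distrib power_one_over)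
    qed
    show "\<forall>\<^sub>F m in sequentially. real (nat (\<lceil>s * 2^m\<rceil> - 1)) / 2^m \<le> s"
      using c(2) by (intro always_eventually allI) (simp add: pos_divide_le_eq)
    have "(\<lambda>m. s - (1/2)^m) \<longlonglongrightarrow> s - 0" by (intro tendsto_intros LIMSEQ_power_zero) auto
    then show "(\<lambda>m. s - (1/2)^m) \<longlonglongrightarrow> s" by simp
  qed simp
  then have "(\<lambda>m. H (real (nat (\<lceil>s * 2^m\<rceil> - 1)) / 2^m) \<omega>) \<longlonglongrightarrow> H s \<omega>"
    using cont s by (intro continuous_on_tendsto_compose[where f="\<lambda>s. H s \<omega>" and s="{0..}"]) auto
  moreover have "\<forall>\<^sub>F m in sequentially. H (real (nat (\<lceil>s * 2^m\<rceil> - 1)) / 2^m) \<omega> = dyadic_process H m s \<omega>"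
  proof -
    obtain k :: nat where "s \<le> real k" using real_arch_simple by blast
    then show ?thesis using s by (intro eventually_sequentiallyI[of k]) (auto simp: dyadic_process_eq)
  qed
  ultimately show ?thesis by (rule Lim_transform_eventually)
qed

context adapted_brownian
begin

lemma simple_integrand_dyadic:
  assumes H: "\<And>s. 0 \<le> s \<Longrightarrow> H s \<in> borel_measurable (F s)"
    and K: "\<And>s \<omega>. 0 \<le> s \<Longrightarrow> \<omega> \<in> space M \<Longrightarrow> \<bar>H s \<omega>\<bar> \<le> K"
  shows "simple_integrand M F (m * 2^m) (\<lambda>i. real i / 2^m) (\<lambda>i. H (real i / 2^m))"
  unfolding simple_integrand_def
  using H K by (auto simp: strict_mono_on_def divide_strict_right_mono bounded_real intro!: exI[of _ K])

text \<open>The elementary integrals along a sufficiently sparse sequence of dyadic grids converge almost surely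
and locally uniformly, by the maximal inequality; the limit inherits the mean square properties by
Fatou's lemma.\<close>

theorem ito_integral_exists:
  assumes null: "\<And>t. 0 \<le> t \<Longrightarrow> null_sets M \<subseteq> sets (F t)"
    and H: "\<And>s. 0 \<le> s \<Longrightarrow> H s \<in> borel_measurable (F s)"
    and cont: "\<And>\<omega>. \<omega> \<in> space M \<Longrightarrow> continuous_on {0..} (\<lambda>s. H s \<omega>)"
    and K: "\<And>s \<omega>. 0 \<le> s \<Longrightarrow> \<omega> \<in> space M \<Longrightarrow> \<bar>H s \<omega>\<bar> \<le> K"
  shows "\<exists>Y. is_ito_integral M F W H Y \<and> L2_martingale Y"
proof -
  have jH: "jointly_measurable M H"
    using H measurable_F_M cont by (intro jointly_measurable_continuous) auto
  note S = simple_integrand_dyadic[of H, OF H K]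
  have jS: "jointly_measurable M (dyadic_process H m)" for m
    unfolding dyadic_process_def by (rule jointly_measurable_simple_process[OF S])
  have K0: "0 \<le> K" using K[of 0] not_empty by (meson abs_ge_zero ex_in_conv order_refl order_trans)
  have bS: "\<bar>dyadic_process H m s \<omega>\<bar> \<le> K" if "\<omega> \<in> space M" for m s \<omega>
    using K[OF _ that] K0 by (auto simp: dyadic_process_eq)
  have conv: "(\<lambda>m. energy M (real N) (\<lambda>s \<omega>. H s \<omega> - dyadic_process H m s \<omega>)) \<longlonglongrightarrow> 0" for N
  proof (rule energy_tendsto_0)
    show "jointly_measurable M (\<lambda>s \<omega>. H s \<omega> - dyadic_process H m s \<omega>)" for m
      by (rule jointly_measurable_diff[OF jH jS])
    show "\<bar>H s \<omega> - dyadic_process H m s \<omega>\<bar> \<le> 2 * K" if "0 \<le> s" "\<omega> \<in> space M" for m s \<omega>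
      using K[OF that] bS[OF that(2), of m s] by linarith
    have "(\<lambda>m. H s \<omega> - dyadic_process H m s \<omega>) \<longlonglongrightarrow> 0" if "0 < s" "\<omega> \<in> space M" for s \<omega>
      using tendsto_diff[OF tendsto_const dyadic_process_tendsto[where H=H and s=s and \<omega>=\<omega>, OF cont[OF that(2)] that(1)], of "H s \<omega>"] by simp
    then show "AE \<omega> in M. \<forall>s>0. (\<lambda>m. H s \<omega> - dyadic_process H m s \<omega>) \<longlonglongrightarrow> 0" by (intro AE_I2) blast
  qed simp
  \<comment> \<open>With the energy of order \<open>16^-N\<close> the maximal inequality at level \<open>2^-N\<close> leaves probabilities of
    order \<open>4^-N\<close>, which are summable.\<close>
  have "\<exists>m. energy M (real N) (\<lambda>s \<omega>. H s \<omega> - dyadic_process H m s \<omega>) < ennreal ((1/16)^N)" for N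
    using eventually_happens'[OF sequentially_bot order_tendstoD(2)[OF conv[of N], of "ennreal ((1/16)^N)"]]
    by auto
  then obtain \<mu> where \<mu>: "\<And>N. energy M (real N) (\<lambda>s \<omega>. H s \<omega> - dyadic_process H (\<mu> N) s \<omega>) < ennreal ((1/16)^N)"
    by metis
  define n where "n = (\<lambda>N. \<mu> N * 2^\<mu> N)"
  define \<tau> where "\<tau> = (\<lambda>N i. real i / 2^\<mu> N)"
  define \<xi> where "\<xi> = (\<lambda>N i. H (real i / 2^\<mu> N))"
  have SI: "simple_integrand M F (n N) (\<tau> N) (\<xi> N)" for N
    unfolding n_def \<tau>_def \<xi>_def by (rule S)
  have dy: "simple_process (n N) (\<tau> N) (\<xi> N) = dyadic_process H (\<mu> N)" for N
    unfolding n_def \<tau>_def \<xi>_def dyadic_process_def ..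
  define J where "J = (\<lambda>N. simple_ito W (n N) (\<tau> N) (\<xi> N))"
  have eH: "energy M T (\<lambda>s \<omega>. H s \<omega> - simple_process (n N) (\<tau> N) (\<xi> N) s \<omega>) \<le> ennreal ((1/16)^N)"
    if "T \<le> real N" for T N
    using order_trans[OF energy_mono_time[OF that] less_imp_le[OF \<mu>[of N]]] by (simp add: dy)
  have close: "(\<integral>\<^sup>+\<omega>. ennreal ((J k T \<omega> - J N T \<omega>)\<^sup>2) \<partial>M) \<le> ennreal (6 * (1/16)^N)"
    if T: "0 \<le> T" "T \<le> real N" and "N \<le> k" for T N k
  proof -
    let ?S = "\<lambda>k. simple_process (n k) (\<tau> k) (\<xi> k)"
    have z: "energy M T (\<lambda>s \<omega>. H s \<omega> - H s \<omega>) = 0" by (simp add: energy_def)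
    have "(\<integral>\<^sup>+\<omega>. ennreal ((J k T \<omega> - J N T \<omega>)\<^sup>2) \<partial>M) = energy M T (\<lambda>s \<omega>. ?S k s \<omega> - ?S N s \<omega>)"
      unfolding energy_def J_def by (rule simple_ito_isometry[OF SI SI T(1)])
    also have "\<dots> \<le> 3 * (energy M T (\<lambda>s \<omega>. ?S k s \<omega> - H s \<omega>) + energy M T (\<lambda>s \<omega>. H s \<omega> - H s \<omega>)
        + energy M T (\<lambda>s \<omega>. H s \<omega> - ?S N s \<omega>))"
      by (intro energy_diff_triangle3 jH jointly_measurable_simple_process SI)
    also have "\<dots> \<le> 3 * (ennreal ((1/16)^N) + 0 + ennreal ((1/16)^N))"
    proof (intro mult_left_mono add_mono)
      have "energy M T (\<lambda>s \<omega>. ?S k s \<omega> - H s \<omega>) \<le> ennreal ((1/16)^k)"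
        using eH[of T k] that by (subst energy_diff_commute) simp
      also have "\<dots> \<le> ennreal ((1/16)^N)" using that by (intro ennreal_leI power_decreasing) auto
      finally show "energy M T (\<lambda>s \<omega>. ?S k s \<omega> - H s \<omega>) \<le> ennreal ((1/16)^N)" .
    qed (use z eH T in auto)
    also have "\<dots> = ennreal 3 * ennreal (2 * (1/16)^N)"
      by (simp add: ennreal_plus[symmetric] del: ennreal_plus)
    also have "\<dots> = ennreal (3 * (2 * (1/16)^N))" by (rule ennreal_mult[symmetric]) auto
    finally show ?thesis by simp
  qed
  have mart: "L2_martingale (J N)" for N unfolding J_def by (rule L2_martingale_simple_ito[OF SI])
  obtain N0 where N0: "N0 \<in> null_sets M" and contW: "\<And>\<omega>. \<omega> \<in> space M - N0 \<Longrightarrow> continuous_on {0..} (\<lambda>t. W t \<omega>)"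
    using continuous_paths by (auto elim!: AE_E3)
  have contJ: "continuous_on {0..} (\<lambda>t. J N t \<omega>)" if "\<omega> \<in> space M - N0" for N \<omega>
    unfolding J_def simple_ito_def
  proof (intro continuous_intros)
    fix i assume "i \<in> {..<n N}"
    then have i: "0 \<le> \<tau> N i" "0 \<le> \<tau> N (Suc i)" using simple_integrandD[OF SI, of i N] by auto
    show "continuous_on {0..} (\<lambda>t. W (min t (\<tau> N (Suc i))) \<omega>)" "continuous_on {0..} (\<lambda>t. W (min t (\<tau> N i)) \<omega>)"
      using i by (auto intro!: continuous_on_compose2[OF contW[OF that]] continuous_intros)
  qed
  have "\<exists>A\<in>sets M. prob A \<le> 6 * (1/4)^N \<and>
      (\<forall>\<omega>\<in>space M - A - N0. \<forall>t\<in>{0..real N}. \<bar>J (Suc N) t \<omega> - J N t \<omega>\<bar> \<le> (1/2)^N)" for N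
  proof -
    let ?Z = "\<lambda>t \<omega>. J (Suc N) t \<omega> - J N t \<omega>"
    have Z: "L2_martingale ?Z" by (rule L2_martingale_diff[OF mart mart])
    have "\<exists>A\<in>sets M. ((1/2)^N)\<^sup>2 * prob A \<le> expectation (\<lambda>\<omega>. (?Z (real N) \<omega>)\<^sup>2) \<and>
      (\<forall>\<omega>\<in>space M - A - N0. \<forall>t\<in>{0..real N}. \<bar>?Z t \<omega>\<bar> \<le> (1/2)^N)"
      by (rule kolmogorov_maximal_inequality[OF Z])
        (auto intro!: continuous_intros continuous_on_subset[OF contJ])
    moreover have "expectation (\<lambda>\<omega>. (?Z (real N) \<omega>)\<^sup>2) \<le> 6 * (1/16)^N"
    proof -
      have "ennreal (expectation (\<lambda>\<omega>. (?Z (real N) \<omega>)\<^sup>2)) = (\<integral>\<^sup>+\<omega>. ennreal ((?Z (real N) \<omega>)\<^sup>2) \<partial>M)"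
        using L2_martingaleD(3)[OF Z] by (intro nn_integral_eq_integral[symmetric]) auto
      also have "\<dots> \<le> ennreal (6 * (1/16)^N)" by (rule close) auto
      finally show ?thesis by (simp add: ennreal_le_iff)
    qed
    moreover have "6 * (1/16::real)^N = ((1/2)^N)\<^sup>2 * (6 * (1/4)^N)"
      by (simp add: power2_eq_square power_mult_distrib[symmetric])
    ultimately show ?thesis by (smt (verit) mult_le_cancel_left_pos zero_less_power half_gt_zero_iff)
  qed
  then obtain A where A: "\<And>N. A N \<in> sets M" "\<And>N. prob (A N) \<le> 6 * (1/4)^N"
    "\<And>N \<omega> t. \<omega> \<in> space M - A N - N0 \<Longrightarrow> t \<in> {0..real N} \<Longrightarrow> \<bar>J (Suc N) t \<omega> - J N t \<omega>\<bar> \<le> (1/2)^N"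
    by metis
  have "summable (\<lambda>N. prob (A N))"
    by (rule summable_comparison_test'[where g="\<lambda>N. 6 * (1/4)^N" and N=0]) (use A(2) in auto)
  then have ev: "AE \<omega> in M. \<forall>\<^sub>F N in sequentially. \<omega> \<in> space M - A N"
    by (intro borel_cantelli_AE1 A(1)) (auto simp: emeasure_eq_measure)
  have "AE \<omega> in M. \<forall>\<^sub>F N in sequentially. \<forall>t\<in>{0..real k}. dist (J N t \<omega>) (J (Suc N) t \<omega>) \<le> (1/2)^N"
    for k :: nat
    using ev AE_not_in[OF N0]
  proof eventually_elim
    fix \<omega> assume "\<forall>\<^sub>F N in sequentially. \<omega> \<in> space M - A N" and \<omega>: "\<omega> \<notin> N0"
    then have "\<forall>\<^sub>F N in sequentially. \<omega> \<in> space M - A N \<and> k \<le> N"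
      by (simp add: eventually_conj_iff eventually_ge_at_top)
    then show "\<forall>\<^sub>F N in sequentially. \<forall>t\<in>{0..real k}. dist (J N t \<omega>) (J (Suc N) t \<omega>) \<le> (1/2)^N"
      by (rule eventually_mono)
        (use A(3) \<omega> in \<open>auto simp: dist_real_def abs_minus_commute\<close>)
  qed
  then have "\<exists>Z N. N \<in> null_sets M \<and> (\<forall>t\<ge>0. Z t \<in> borel_measurable (F t)) \<and>
    (\<forall>\<omega>. continuous_on {0..} (\<lambda>t. Z t \<omega>)) \<and>
    (\<forall>\<omega>\<in>space M - N. \<forall>t\<ge>0. (\<lambda>n. J n t \<omega>) \<longlonglongrightarrow> Z t \<omega>) \<and>
    (\<forall>\<omega>. \<omega> \<notin> space M - N \<longrightarrow> (\<forall>t. Z t \<omega> = 0))"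
    by (intro fast_convergent_processes[OF null L2_martingaleD(1)[OF mart] N0 contJ])
  then obtain Y N where N: "N \<in> null_sets M" and Y': "\<forall>t\<ge>0. Y t \<in> borel_measurable (F t)"
    "\<forall>\<omega>. continuous_on {0..} (\<lambda>t. Y t \<omega>)"
    "\<forall>\<omega>\<in>space M - N. \<forall>t\<ge>0. (\<lambda>n. J n t \<omega>) \<longlonglongrightarrow> Y t \<omega>"
    by blast
  then have Y: "\<And>t. 0 \<le> t \<Longrightarrow> Y t \<in> borel_measurable (F t)"
    "\<And>\<omega>. continuous_on {0..} (\<lambda>t. Y t \<omega>)"
    "\<And>\<omega> t. \<omega> \<in> space M - N \<Longrightarrow> 0 \<le> t \<Longrightarrow> (\<lambda>n. J n t \<omega>) \<longlonglongrightarrow> Y t \<omega>" by auto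
  have YM: "Y t \<in> borel_measurable M" if "0 \<le> t" for t using Y(1)[OF that] measurable_F_M by blast
  have JM: "J k t \<in> borel_measurable M" if "0 \<le> t" for k t using L2_martingaleD(2)[OF mart that] .
  have limY: "(\<lambda>N. \<integral>\<^sup>+\<omega>. ennreal ((Y T \<omega> - J N T \<omega>)\<^sup>2) \<partial>M) \<longlonglongrightarrow> 0" if T: "0 \<le> T" for T
  proof (rule tendsto_sandwich[where f="\<lambda>_. 0" and h="\<lambda>N. ennreal (6 * (1/16)^N)"])
    have "(\<lambda>N. ennreal (6 * (1/16)^N)) \<longlonglongrightarrow> ennreal (6 * 0)"
      by (intro tendsto_ennrealI tendsto_mult tendsto_const LIMSEQ_power_zero) auto
    then show "(\<lambda>N. ennreal (6 * (1/16)^N)) \<longlonglongrightarrow> 0" by simp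
    obtain N1 :: nat where N1: "T \<le> real N1" using real_arch_simple by blast
    show "\<forall>\<^sub>F N in sequentially. (\<integral>\<^sup>+\<omega>. ennreal ((Y T \<omega> - J N T \<omega>)\<^sup>2) \<partial>M) \<le> ennreal (6 * (1/16)^N)"
    proof (rule eventually_sequentiallyI[of N1])
      fix k assume k: "N1 \<le> k"
      show "(\<integral>\<^sup>+\<omega>. ennreal ((Y T \<omega> - J k T \<omega>)\<^sup>2) \<partial>M) \<le> ennreal (6 * (1/16)^k)"
      proof (rule fatou_bound)
        show "(\<lambda>\<omega>. ennreal ((J i T \<omega> - J k T \<omega>)\<^sup>2)) \<in> borel_measurable M" for i
          using JM[OF T, of i] JM[OF T, of k] by measurable
        show "AE \<omega> in M. (\<lambda>i. ennreal ((J i T \<omega> - J k T \<omega>)\<^sup>2)) \<longlonglongrightarrow> ennreal ((Y T \<omega> - J k T \<omega>)\<^sup>2)"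
          using AE_not_in[OF N] by (rule AE_mp) (intro AE_I2 impI tendsto_intros Y(3) T, auto)
        show "\<forall>\<^sub>F i in sequentially. (\<integral>\<^sup>+\<omega>. ennreal ((J i T \<omega> - J k T \<omega>)\<^sup>2) \<partial>M) \<le> ennreal (6 * (1/16)^k)"
          using k N1 by (intro eventually_sequentiallyI[of k] close T) auto
      qed
    qed
  qed auto
  have mY: "L2_martingale Y" by (rule L2_martingale_limit[OF mart Y(1) limY])
  have "is_ito_integral M F W H Y"
    unfolding is_ito_integral_def
  proof (intro conjI allI impI ballI)
    show "(\<lambda>(s, \<omega>). H s \<omega>) \<in> borel_measurable (restrict_space borel {0..} \<Otimes>\<^sub>M M)"
      using jH by (simp add: jointly_measurable_def)
    fix T :: real assume T: "0 \<le> T"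
    show "H T \<in> borel_measurable (F T)" by (rule H[OF T])
    show "(\<integral>\<^sup>+\<omega>. (\<integral>\<^sup>+s\<in>{0..T}. ennreal ((H s \<omega>)\<^sup>2) \<partial>lborel) \<partial>M) < \<infinity>"
      using energy_bounded_le[of H K T] K T unfolding energy_def by (simp add: le_less_trans)
    show "Y T \<in> borel_measurable M" by (rule YM[OF T])
    have e0: "(\<lambda>N. energy M T (\<lambda>s \<omega>. H s \<omega> - simple_process (n N) (\<tau> N) (\<xi> N) s \<omega>)) \<longlonglongrightarrow> 0"
    proof (rule tendsto_sandwich[where f="\<lambda>_. 0" and h="\<lambda>N. ennreal ((1/16)^N)"])
      have "(\<lambda>N. ennreal ((1/16)^N)) \<longlonglongrightarrow> ennreal 0"
        by (intro tendsto_ennrealI LIMSEQ_power_zero) auto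
      then show "(\<lambda>N. ennreal ((1/16)^N)) \<longlonglongrightarrow> 0" by simp
      obtain N1 :: nat where N1: "T \<le> real N1" using real_arch_simple by blast
      show "\<forall>\<^sub>F N in sequentially. energy M T (\<lambda>s \<omega>. H s \<omega> - simple_process (n N) (\<tau> N) (\<xi> N) s \<omega>) \<le> ennreal ((1/16)^N)"
        using N1 by (intro eventually_sequentiallyI[of N1] eH) auto
    qed auto
    show "\<exists>n \<tau> \<xi>.
        (\<forall>m::nat. simple_integrand M F (n m) (\<tau> m) (\<xi> m)) \<and>
        (\<lambda>m. \<integral>\<^sup>+\<omega>. (\<integral>\<^sup>+s\<in>{0..T}.
             ennreal ((H s \<omega> - simple_process (n m) (\<tau> m) (\<xi> m) s \<omega>)\<^sup>2) \<partial>lborel) \<partial>M)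
          \<longlonglongrightarrow> 0 \<and>
        (\<lambda>m. \<integral>\<^sup>+\<omega>. ennreal ((Y T \<omega> - simple_ito W (n m) (\<tau> m) (\<xi> m) T \<omega>)\<^sup>2) \<partial>M)
          \<longlonglongrightarrow> 0"
      using SI e0 limY[OF T] unfolding energy_def J_def
      by (intro exI[of _ n] exI[of _ \<tau>] exI[of _ \<xi>]) auto
  next
    fix \<omega> assume "\<omega> \<in> space M"
    show "continuous_on {0..} (\<lambda>t. Y t \<omega>)" by (rule Y(2))
  qed
  then show ?thesis using mY by blast
qed

end

section \<open>Matrix-valued processes\<close>

lemma matrix_measurableI:
  fixes f :: "'w \<Rightarrow> real^'n^'m"
  assumes m: "\<And>i j. (\<lambda>\<omega>. f \<omega> $ i $ j) \<in> borel_measurable N"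
  shows "f \<in> borel_measurable N"
proof (subst borel_measurable_euclidean_space, rule ballI)
  fix u :: "real^'n^'m"
  have eq: "f \<omega> \<bullet> u = (\<Sum>i\<in>UNIV. \<Sum>j\<in>UNIV. f \<omega> $ i $ j * u $ i $ j)" for \<omega>
    by (simp only: inner_vec_def inner_real_def)
  show "(\<lambda>\<omega>. f \<omega> \<bullet> u) \<in> borel_measurable N"
    unfolding eq
    by (rule borel_measurable_sum, rule borel_measurable_sum, rule borel_measurable_times,
        rule m, rule borel_measurable_const)
qed

lemma matrix_entry_measurable:
  fixes f :: "'w \<Rightarrow> real^'n^'m"
  assumes "f \<in> borel_measurable N"
  shows "(\<lambda>\<omega>. f \<omega> $ i $ j) \<in> borel_measurable N"
proof -
  have "continuous_on UNIV (\<lambda>A::real^'n^'m. A $ i $ j)" by (intro continuous_intros)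
  from measurable_compose[OF assms borel_measurable_continuous_onI[OF this]] show ?thesis .
qed

text \<open>The crude Cauchy-Schwarz bound for the double sum in an entry of a matrix stochastic integral. It
reduces all matrix estimates to estimates of scalar integrals against single entries of \<open>B\<close>.\<close>

lemma sum_sum_sq_le:
  fixes d :: "'n::finite \<Rightarrow> 'n \<Rightarrow> real"
  shows "(\<Sum>k\<in>UNIV. \<Sum>r\<in>UNIV. d k r)\<^sup>2 \<le> (real CARD('n))\<^sup>2 * (\<Sum>k\<in>UNIV. \<Sum>r\<in>UNIV. (d k r)\<^sup>2)"
proof -
  have pairs: "(\<Sum>k\<in>UNIV. \<Sum>r\<in>UNIV. h k r) = (\<Sum>p\<in>UNIV \<times> UNIV. h (fst p) (snd p))"
    for h :: "'n \<Rightarrow> 'n \<Rightarrow> real"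
    by (simp only: sum.cartesian_product case_prod_beta')
  have "card (UNIV \<times> UNIV :: ('n \<times> 'n) set) = CARD('n) * CARD('n)" by (rule card_cartesian_product)
  then have "(\<Sum>p\<in>UNIV \<times> UNIV. d (fst p) (snd p))\<^sup>2 \<le>
      (\<Sum>p\<in>UNIV \<times> UNIV. (d (fst p) (snd p))\<^sup>2) * real (CARD('n) * CARD('n))"
    using sum_squared_le_sum_of_squares[of "\<lambda>p. d (fst p) (snd p)" "UNIV \<times> UNIV"] by (simp only:)
  also have "\<dots> = (real CARD('n))\<^sup>2 * (\<Sum>p\<in>UNIV \<times> UNIV. (d (fst p) (snd p))\<^sup>2)"
    by (simp only: of_nat_mult power2_eq_square[of "real CARD('n)"] mult.commute)
  finally show ?thesis unfolding pairs .
qed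

lemma sixth_power_collect: "n * (n * (n\<^sup>2 * (n * (n * (9 * c))))) = 9 * n^6 * (c::real)"
proof -
  have "n^6 = n * (n * (n\<^sup>2 * (n * n)))" by (simp add: numeral_eq_Suc)
  then show ?thesis by simp
qed

lemma norm_matrix_le_entries:
  fixes A :: "real^'n^'n"
  assumes "\<And>i j. \<bar>A $ i $ j\<bar> \<le> e"
  shows "norm A \<le> (real CARD('n))\<^sup>2 * e"
proof -
  have "norm A = L2_set (\<lambda>i. norm (A $ i)) UNIV" by (rule norm_vec_def)
  also have "\<dots> \<le> (\<Sum>i\<in>UNIV. norm (A $ i))" by (rule L2_set_le_sum) simp
  also have "\<dots> \<le> (\<Sum>i\<in>UNIV. \<Sum>j\<in>UNIV. \<bar>A $ i $ j\<bar>)" by (intro sum_mono norm_le_l1_cart)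
  also have "\<dots> \<le> (\<Sum>i\<in>(UNIV::'n set). \<Sum>j\<in>(UNIV::'n set). e)" by (intro sum_mono assms)
  finally show ?thesis by (simp add: power2_eq_square)
qed

lemma energy_le_cmult:
  assumes U: "jointly_measurable M U" and c: "0 \<le> c"
    and le: "\<And>s \<omega>. 0 \<le> s \<Longrightarrow> \<omega> \<in> space M \<Longrightarrow> (H s \<omega>)\<^sup>2 \<le> c * (U s \<omega>)\<^sup>2"
  shows "energy M t H \<le> ennreal c * energy M t U"
proof -
  note m = jointly_measurable_inner[OF U, where T=t]
  have "energy M t H \<le> (\<integral>\<^sup>+\<omega>. ennreal c * (\<integral>\<^sup>+s\<in>{0..t}. ennreal ((U s \<omega>)\<^sup>2) \<partial>lborel) \<partial>M)"
    unfolding energy_def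
  proof (rule nn_integral_mono)
    fix \<omega> assume \<omega>: "\<omega> \<in> space M"
    have "(\<integral>\<^sup>+s\<in>{0..t}. ennreal ((H s \<omega>)\<^sup>2) \<partial>lborel) \<le>
      (\<integral>\<^sup>+s. ennreal c * (ennreal ((U (max 0 s) \<omega>)\<^sup>2) * indicator {0..t} s) \<partial>lborel)"
    proof (rule nn_integral_mono)
      fix s
      show "ennreal ((H s \<omega>)\<^sup>2) * indicator {0..t} s \<le>
          ennreal c * (ennreal ((U (max 0 s) \<omega>)\<^sup>2) * indicator {0..t} s)"
        using ennreal_leI[OF le[OF _ \<omega>, of s]] c by (auto simp: indicator_def ennreal_mult)
    qed
    also have "\<dots> = ennreal c * (\<integral>\<^sup>+s\<in>{0..t}. ennreal ((U s \<omega>)\<^sup>2) \<partial>lborel)"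
      unfolding clamp_nn_integral[where f="\<lambda>s. ennreal ((U s \<omega>)\<^sup>2)"] by (rule nn_integral_cmult[OF m(2)[OF \<omega>]])
    finally show "(\<integral>\<^sup>+s\<in>{0..t}. ennreal ((H s \<omega>)\<^sup>2) \<partial>lborel) \<le> \<dots>" .
  qed
  also have "\<dots> = ennreal c * energy M t U" unfolding energy_def by (rule nn_integral_cmult[OF m(1)])
  finally show ?thesis .
qed

text \<open>Tonelli's theorem puts the mean square distance in the form to which Gronwall's argument applies.\<close>

lemma energy_eq_time_integral:
  assumes "sigma_finite_measure M" and U: "jointly_measurable M U"
  shows "energy M t U = (\<integral>\<^sup>+s\<in>{0..t}. (\<integral>\<^sup>+\<omega>. ennreal ((U s \<omega>)\<^sup>2) \<partial>M) \<partial>lborel)"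
proof -
  interpret sigma_finite_measure M by fact
  interpret pair_sigma_finite lborel M by unfold_locales
  note [measurable] = jointly_measurable_clamped[OF U]
  have m: "(\<lambda>(s, \<omega>). ennreal ((U (max 0 s) \<omega>)\<^sup>2) * indicator {0..t} s) \<in> borel_measurable (lborel \<Otimes>\<^sub>M M)"
    by measurable
  have Us: "U (max 0 s) \<in> borel_measurable M" for s
    using measurable_compose[OF measurable_Pair1'[of s borel M] jointly_measurable_clamped[OF U]] by simp
  have "energy M t U = (\<integral>\<^sup>+\<omega>. (\<integral>\<^sup>+s. ennreal ((U (max 0 s) \<omega>)\<^sup>2) * indicator {0..t} s \<partial>lborel) \<partial>M)"
    unfolding energy_def by (subst clamp_nn_integral[where f="\<lambda>s. ennreal ((U s _)\<^sup>2)"]) (rule refl)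
  also have "\<dots> = (\<integral>\<^sup>+s. (\<integral>\<^sup>+\<omega>. ennreal ((U (max 0 s) \<omega>)\<^sup>2) * indicator {0..t} s \<partial>M) \<partial>lborel)"
    by (rule Fubini'[OF m])
  also have "\<dots> = (\<integral>\<^sup>+s\<in>{0..t}. (\<integral>\<^sup>+\<omega>. ennreal ((U s \<omega>)\<^sup>2) \<partial>M) \<partial>lborel)"
    by (intro nn_integral_cong) (auto simp: indicator_def)
  finally show ?thesis .
qed

text \<open>Jensen's inequality for the uniform distribution on \<open>[0,t]\<close>, in the form
\<open>0 \<le> \<integral>\<^sub>0\<^sup>t (t \<delta> s - a)\<^sup>2 ds = t (t q - a\<^sup>2)\<close>, where \<open>a\<close> and \<open>q\<close> are the integrals of \<open>\<delta>\<close> and \<open>\<delta>\<^sup>2\<close>.\<close>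

lemma time_integral_difference_sq_le:
  fixes \<phi> \<psi> :: "real \<Rightarrow> 'e::euclidean_space"
  assumes c: "continuous_on {0..T} \<phi>" "continuous_on {0..T} \<psi>" and t: "t \<in> {0..T}"
  shows "ennreal ((norm ((LINT s:{0..t}|lborel. \<phi> s) - (LINT s:{0..t}|lborel. \<psi> s)))\<^sup>2) \<le>
    ennreal T * (\<integral>\<^sup>+s\<in>{0..T}. ennreal ((norm (\<phi> s - \<psi> s))\<^sup>2) \<partial>lborel)"
proof -
  define \<delta> where "\<delta> = (\<lambda>s. norm (\<phi> s - \<psi> s))"
  define a where "a = (LINT s:{0..t}|lborel. \<delta> s)"
  define q where "q = (LINT s:{0..t}|lborel. (\<delta> s)\<^sup>2)"
  have ct: "continuous_on {0..t} \<phi>" "continuous_on {0..t} \<psi>"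
    using c t by (auto intro: continuous_on_subset)
  then have c\<delta>: "continuous_on {0..t} \<delta>" unfolding \<delta>_def by (intro continuous_intros)
  note int = borel_integrable_atLeastAtMost'
  have i: "set_integrable lborel {0..t} \<phi>" "set_integrable lborel {0..t} \<psi>"
    "set_integrable lborel {0..t} \<delta>" "set_integrable lborel {0..t} (\<lambda>s. (\<delta> s)\<^sup>2)"
    using ct c\<delta> by (auto intro!: int continuous_intros)
  have "(LINT s:{0..t}|lborel. \<phi> s) - (LINT s:{0..t}|lborel. \<psi> s) = (LINT s:{0..t}|lborel. \<phi> s - \<psi> s)"
    using i by (simp add: set_integral_diff(2))
  also have "norm \<dots> \<le> a"
    unfolding a_def \<delta>_def using i by (intro set_integral_norm_bound set_integral_diff(1))
  finally have na: "norm ((LINT s:{0..t}|lborel. \<phi> s) - (LINT s:{0..t}|lborel. \<psi> s)) \<le> a" .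
  then have a0: "0 \<le> a" by (rule order_trans[OF norm_ge_zero])
  have jensen: "a\<^sup>2 \<le> t * q"
  proof (cases "t = 0")
    case True
    have "a = 0"
    proof -
      have "AE s in lborel. s \<noteq> (0::real)" by (rule AE_lborel_singleton)
      then have "AE s in lborel. indicator {0..t} s *\<^sub>R \<delta> s = 0"
        by (rule eventually_mono) (auto simp: True indicator_def)
      then show ?thesis unfolding a_def set_lebesgue_integral_def by (rule integral_eq_zero_AE)
    qed
    then show ?thesis using True by simp
  next
    case False
    then have t0: "t > 0" using t by simp
    have const: "(LINT s:{0..t}|lborel. k) = t * k" "set_integrable lborel {0..t} (\<lambda>s. k)" for k :: real
      using t0 by (auto simp: set_lebesgue_integral_def intro: int)
    have "0 \<le> (LINT s:{0..t}|lborel. (t * \<delta> s - a)\<^sup>2)"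
      unfolding set_lebesgue_integral_def by (intro integral_nonneg_AE AE_I2) (simp add: indicator_def)
    also have "(LINT s:{0..t}|lborel. (t * \<delta> s - a)\<^sup>2) = (LINT s:{0..t}|lborel. (t\<^sup>2 * (\<delta> s)\<^sup>2 - (2 * t * a) * \<delta> s) + a\<^sup>2)"
      by (simp add: power2_diff power_mult_distrib algebra_simps)
    also have "\<dots> = (t\<^sup>2 * q - (2 * t * a) * a) + t * a\<^sup>2"
    proof -
      have j: "set_integrable lborel {0..t} (\<lambda>s. t\<^sup>2 * (\<delta> s)\<^sup>2)" "set_integrable lborel {0..t} (\<lambda>s. (2 * t * a) * \<delta> s)"
        using c\<delta> by (auto intro!: int continuous_intros)
      show ?thesis
        by (subst set_integral_add(2)[OF set_integral_diff(1)[OF j] const(2)], subst set_integral_diff(2)[OF j])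
          (simp add: a_def q_def const)
    qed
    also have "\<dots> = t * (t * q - a\<^sup>2)" by (simp add: power2_eq_square algebra_simps)
    finally show ?thesis using t0 by (simp add: zero_le_mult_iff)
  qed
  have q: "ennreal q = (\<integral>\<^sup>+s\<in>{0..t}. ennreal ((\<delta> s)\<^sup>2) \<partial>lborel)"
  proof -
    have "(\<integral>\<^sup>+s\<in>{0..t}. ennreal ((\<delta> s)\<^sup>2) \<partial>lborel) = (\<integral>\<^sup>+s. ennreal (indicator {0..t} s *\<^sub>R (\<delta> s)\<^sup>2) \<partial>lborel)"
      by (intro nn_integral_cong) (auto simp: indicator_def)
    also have "\<dots> = ennreal q"
      unfolding q_def set_lebesgue_integral_def
      by (rule nn_integral_eq_integral) (use i(4) in \<open>auto simp: set_integrable_def\<close>)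
    finally show ?thesis by simp
  qed
  have q0: "0 \<le> q" unfolding q_def set_lebesgue_integral_def by (intro integral_nonneg_AE AE_I2) simp
  have "ennreal ((norm ((LINT s:{0..t}|lborel. \<phi> s) - (LINT s:{0..t}|lborel. \<psi> s)))\<^sup>2) \<le> ennreal (t * q)"
    using power_mono[OF na norm_ge_zero, of 2] jensen by (intro ennreal_leI) simp
  also have "\<dots> = ennreal t * ennreal q" using t q0 by (simp add: ennreal_mult)
  also have "\<dots> \<le> ennreal T * (\<integral>\<^sup>+s\<in>{0..T}. ennreal ((\<delta> s)\<^sup>2) \<partial>lborel)"
    unfolding q using t by (intro mult_mono ennreal_leI nn_integral_mono) (auto simp: indicator_def)
  finally show ?thesis by (simp add: \<delta>_def)
qed

section \<open>Dependence of the equation on its input\<close>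

lemma lipschitz_coefficient_continuous:
  assumes "lipschitz_coefficient h" shows "continuous_on UNIV h"
proof -
  obtain L where L: "0 \<le> L" "\<And>A B. norm (h A - h B) \<le> L * norm (A - B)"
    using assms unfolding lipschitz_coefficient_def by blast
  then have "L-lipschitz_on UNIV h" by (auto intro!: lipschitz_onI simp: dist_norm)
  then show ?thesis by (rule lipschitz_on_continuous_on)
qed

text \<open>The distance of two processes, truncated at 1 so that its mean square is finite for all processes.\<close>

definition gap :: "(real \<Rightarrow> 'w \<Rightarrow> real^'n^'n) \<Rightarrow> (real \<Rightarrow> 'w \<Rightarrow> real^'n^'n) \<Rightarrow> real \<Rightarrow> 'w \<Rightarrow> real" where
  "gap X Y s \<omega> = min 1 (norm (X s \<omega> - Y s \<omega>))"

text \<open>Combines the Lipschitz bound, good for small \<open>d\<close>, with the uniform bound, good for large \<open>d\<close>.\<close>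

lemma sq_le_truncated:
  fixes a d K L :: real
  assumes a: "\<bar>a\<bar> \<le> L * d" "\<bar>a\<bar> \<le> K" and nn: "0 \<le> L" "0 \<le> K" "0 \<le> d"
  shows "a\<^sup>2 \<le> (L + K)\<^sup>2 * (min 1 d)\<^sup>2"
proof -
  have "\<bar>a\<bar> \<le> (L + K) * min 1 d"
  proof (cases "d \<le> 1")
    case True
    have "0 \<le> K * d" using nn by (intro mult_nonneg_nonneg)
    with True a(1) show ?thesis by (simp add: min_absorb2 distrib_right)
  next
    case False
    with a(2) nn show ?thesis by (simp add: min_absorb1)
  qed
  from power_mono[OF this abs_ge_zero, of 2] show ?thesis by (simp add: power_mult_distrib)
qed

text \<open>Products \<open>g x $ i $ k * f x $ r $ j\<close> are the integrands of the matrix integrals. They are again bounded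
and Lipschitz, and a single constant is made to serve for them and for the drift.\<close>

lemma coefficient_gap_bounds:
  fixes b g f :: "real^'n^'n \<Rightarrow> real^'n^'n"
  assumes b: "lipschitz_coefficient b" and g: "lipschitz_coefficient g" and f: "lipschitz_coefficient f"
  shows "\<exists>c\<ge>0. (\<forall>x y. (norm (b x - b y))\<^sup>2 \<le> c * (min 1 (norm (x - y)))\<^sup>2) \<and>
    (\<forall>x y i k r j. (g x $ i $ k * f x $ r $ j - g y $ i $ k * f y $ r $ j)\<^sup>2 \<le> c * (min 1 (norm (x - y)))\<^sup>2)"
proof -
  have ex: "\<exists>K L. 0 \<le> K \<and> 0 \<le> L \<and> (\<forall>A i j. \<bar>h A $ i $ j\<bar> \<le> K) \<and> (\<forall>A B. norm (h A - h B) \<le> L * norm (A - B))"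
    if "lipschitz_coefficient h" for h :: "real^'n^'n \<Rightarrow> real^'n^'n"
    using that unfolding lipschitz_coefficient_def by (meson abs_ge_zero order_trans)
  obtain Kb Lb where Kb: "0 \<le> Kb" "0 \<le> Lb" "\<And>A i j. \<bar>b A $ i $ j\<bar> \<le> Kb" "\<And>A B. norm (b A - b B) \<le> Lb * norm (A - B)"
    using ex[OF b] by blast
  obtain Kg Lg where Kg: "0 \<le> Kg" "0 \<le> Lg" "\<And>A i j. \<bar>g A $ i $ j\<bar> \<le> Kg" "\<And>A B. norm (g A - g B) \<le> Lg * norm (A - B)"
    using ex[OF g] by blast
  obtain Kf Lf where Kf: "0 \<le> Kf" "0 \<le> Lf" "\<And>A i j. \<bar>f A $ i $ j\<bar> \<le> Kf" "\<And>A B. norm (f A - f B) \<le> Lf * norm (A - B)"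
    using ex[OF f] by blast
  have entry: "\<bar>A $ i $ j\<bar> \<le> norm A" for A :: "real^'n^'n" and i j
    using component_le_norm_cart[of "A $ i" j] Finite_Cartesian_Product.norm_nth_le[of A i] by linarith
  let ?n = "(real CARD('n))\<^sup>2"
  define c1 where "c1 = (Lb + ?n * (2 * Kb))\<^sup>2"
  define c2 where "c2 = ((Kg * Lf + Lg * Kf) + 2 * (Kg * Kf))\<^sup>2"
  have 1: "(norm (b x - b y))\<^sup>2 \<le> c1 * (min 1 (norm (x - y)))\<^sup>2" for x y
    unfolding c1_def
  proof (rule sq_le_truncated)
    show "\<bar>norm (b x - b y)\<bar> \<le> Lb * norm (x - y)" using Kb(4) by simp
    have "\<bar>(b x - b y) $ i $ j\<bar> \<le> 2 * Kb" for i j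
      using Kb(3)[of x i j] Kb(3)[of y i j] by simp
    then show "\<bar>norm (b x - b y)\<bar> \<le> ?n * (2 * Kb)" using norm_matrix_le_entries[of "b x - b y"] by simp
  qed (use Kb in auto)
  have 2: "(g x $ i $ k * f x $ r $ j - g y $ i $ k * f y $ r $ j)\<^sup>2 \<le> c2 * (min 1 (norm (x - y)))\<^sup>2" for x y i k r j
    unfolding c2_def
  proof (rule sq_le_truncated)
    have "g x $ i $ k * f x $ r $ j - g y $ i $ k * f y $ r $ j =
        g x $ i $ k * ((f x - f y) $ r $ j) + (g x - g y) $ i $ k * f y $ r $ j"
      by (simp add: algebra_simps)
    also have "\<bar>\<dots>\<bar> \<le> \<bar>g x $ i $ k\<bar> * \<bar>(f x - f y) $ r $ j\<bar> + \<bar>(g x - g y) $ i $ k\<bar> * \<bar>f y $ r $ j\<bar>"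
      unfolding abs_mult[symmetric] by (rule abs_triangle_ineq)
    also have "\<dots> \<le> Kg * (Lf * norm (x - y)) + (Lg * norm (x - y)) * Kf"
      by (intro add_mono mult_mono Kg(3) Kf(3) order_trans[OF entry Kf(4)] order_trans[OF entry Kg(4)])
        (use Kg Kf in auto)
    finally show "\<bar>g x $ i $ k * f x $ r $ j - g y $ i $ k * f y $ r $ j\<bar> \<le> (Kg * Lf + Lg * Kf) * norm (x - y)"
      by (simp add: algebra_simps)
    have p: "\<bar>g z $ i $ k * f z $ r $ j\<bar> \<le> Kg * Kf" for z
      unfolding abs_mult by (intro mult_mono Kg(3) Kf(3)) (use Kg in auto)
    show "\<bar>g x $ i $ k * f x $ r $ j - g y $ i $ k * f y $ r $ j\<bar> \<le> 2 * (Kg * Kf)"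
      using p[of x] p[of y] by linarith
  qed (use Kg Kf in auto)
  have "c1 * (min 1 (norm (x - y)))\<^sup>2 \<le> max c1 c2 * (min 1 (norm (x - y)))\<^sup>2"
    "c2 * (min 1 (norm (x - y)))\<^sup>2 \<le> max c1 c2 * (min 1 (norm (x - y)))\<^sup>2" for x y :: "real^'n^'n"
    by (intro mult_right_mono; simp)+
  note m = this
  have "\<forall>x y. (norm (b x - b y))\<^sup>2 \<le> max c1 c2 * (min 1 (norm (x - y)))\<^sup>2"
    using order_trans[OF 1 m(1)] by blast
  moreover have "\<forall>x y i k r j. (g x $ i $ k * f x $ r $ j - g y $ i $ k * f y $ r $ j)\<^sup>2
      \<le> max c1 c2 * (min 1 (norm (x - y)))\<^sup>2"
    using order_trans[OF 2 m(2)] by blast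
  moreover have "0 \<le> max c1 c2" by (simp add: c1_def le_max_iff_disj)
  ultimately show ?thesis by blast
qed

definition coefficient_const ::
    "(real^'n^'n \<Rightarrow> real^'n^'n) \<Rightarrow> (real^'n^'n \<Rightarrow> real^'n^'n) \<Rightarrow> (real^'n^'n \<Rightarrow> real^'n^'n) \<Rightarrow> real" where
  "coefficient_const b g f = (SOME c. c \<ge> 0 \<and>
    (\<forall>x y. (norm (b x - b y))\<^sup>2 \<le> c * (min 1 (norm (x - y)))\<^sup>2) \<and>
    (\<forall>x y i k r j. (g x $ i $ k * f x $ r $ j - g y $ i $ k * f y $ r $ j)\<^sup>2 \<le> c * (min 1 (norm (x - y)))\<^sup>2))"

text \<open>The process \<open>P\<close> is the right-hand side of the equation evaluated along \<open>X\<close>. A solution is a fixed point of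
this relation; the Picard map is a choice of \<open>P\<close> for given \<open>X\<close>.\<close>

definition sde_step where
  "sde_step M F B b g f X0 X P \<longleftrightarrow> (\<exists>J K.
     is_matrix_ito_integral M F (\<lambda>s \<omega>. g (X s \<omega>)) B (\<lambda>s \<omega>. f (X s \<omega>)) J \<and>
     is_matrix_ito_integral M F (\<lambda>s \<omega>. f (X s \<omega>)) (\<lambda>s \<omega>. transpose (B s \<omega>)) (\<lambda>s \<omega>. g (X s \<omega>)) K \<and>
     (AE \<omega> in M. \<forall>t\<ge>0. set_integrable lborel {0..t} (\<lambda>s. b (X s \<omega>)) \<and>
        P t \<omega> = X0 + (LINT s:{0..t}|lborel. b (X s \<omega>)) + J t \<omega> + K t \<omega>))"

lemma is_matrix_ito_integralE:
  assumes "is_matrix_ito_integral M F A W C J"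
  obtains Y where
    "\<forall>i j k r. is_ito_integral M F (\<lambda>s \<omega>. W s \<omega> $ k $ r) (\<lambda>s \<omega>. A s \<omega> $ i $ k * C s \<omega> $ r $ j) (Y i j k r)"
    "\<forall>t\<ge>0. \<forall>\<omega>\<in>space M. \<forall>i j. J t \<omega> $ i $ j = (\<Sum>k\<in>UNIV. \<Sum>r\<in>UNIV. Y i j k r t \<omega>)"
  using assms unfolding is_matrix_ito_integral_def by (elim exE conjE) (rule that)

lemma is_ito_integral_measurable: "is_ito_integral M F W H Y \<Longrightarrow> 0 \<le> t \<Longrightarrow> Y t \<in> borel_measurable M"
  by (simp add: is_ito_integral_def)

lemma matrix_ito_integral_measurable:
  fixes J :: "real \<Rightarrow> 'w \<Rightarrow> real^'n^'n"
  assumes J: "is_matrix_ito_integral M F A W C J" and t: "0 \<le> t"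
  shows "J t \<in> borel_measurable M"
proof (rule matrix_measurableI)
  fix i j
  obtain Y where "\<forall>i j k r. is_ito_integral M F (\<lambda>s \<omega>. W s \<omega> $ k $ r) (\<lambda>s \<omega>. A s \<omega> $ i $ k * C s \<omega> $ r $ j) (Y i j k r)"
    and "\<forall>t\<ge>0. \<forall>\<omega>\<in>space M. \<forall>i j. J t \<omega> $ i $ j = (\<Sum>k\<in>UNIV. \<Sum>r\<in>UNIV. Y i j k r t \<omega>)"
    by (rule is_matrix_ito_integralE[OF J])
  note Y = this(1)[rule_format] and eq = this(2)[rule_format]
  have "Y i j k r t \<in> borel_measurable M" for k r
    by (rule is_ito_integral_measurable[OF Y t])
  then have "(\<lambda>\<omega>. \<Sum>k\<in>UNIV. \<Sum>r\<in>UNIV. Y i j k r t \<omega>) \<in> borel_measurable M"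
    by (intro borel_measurable_sum)
  moreover have "(\<lambda>\<omega>. J t \<omega> $ i $ j) \<in> borel_measurable M \<longleftrightarrow>
      (\<lambda>\<omega>. \<Sum>k\<in>UNIV. \<Sum>r\<in>UNIV. Y i j k r t \<omega>) \<in> borel_measurable M"
    by (rule measurable_cong) (rule eq[OF t])
  ultimately show "(\<lambda>\<omega>. J t \<omega> $ i $ j) \<in> borel_measurable M" by blast
qed

context filtered_prob_space
begin

text \<open>There are \<open>n\<^sup>2\<close> entries, each a sum of \<open>n\<^sup>2\<close> scalar integrals; squaring that sum costs another factor
\<open>n\<^sup>2\<close>, and the factor 9 is the one of the scalar estimate.\<close>

lemma matrix_ito_difference:
  fixes J J' W :: "real \<Rightarrow> 'w \<Rightarrow> real^'n^'n"
  assumes W: "\<And>k r. adapted_brownian M F (\<lambda>s \<omega>. W s \<omega> $ k $ r)"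
    and J: "is_matrix_ito_integral M F A W C J" and J': "is_matrix_ito_integral M F A' W C' J'"
    and U: "jointly_measurable M U" and c: "0 \<le> c"
    and le: "\<And>s \<omega> i j k r. 0 \<le> s \<Longrightarrow> \<omega> \<in> space M \<Longrightarrow>
      (A s \<omega> $ i $ k * C s \<omega> $ r $ j - A' s \<omega> $ i $ k * C' s \<omega> $ r $ j)\<^sup>2 \<le> c * (U s \<omega>)\<^sup>2"
    and t: "0 \<le> t"
  shows "(\<integral>\<^sup>+\<omega>. ennreal ((norm (J t \<omega> - J' t \<omega>))\<^sup>2) \<partial>M) \<le> ennreal (9 * real CARD('n)^6 * c) * energy M t U"
proof -
  obtain Y where "\<forall>i j k r. is_ito_integral M F (\<lambda>s \<omega>. W s \<omega> $ k $ r) (\<lambda>s \<omega>. A s \<omega> $ i $ k * C s \<omega> $ r $ j) (Y i j k r)"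
    and "\<forall>t\<ge>0. \<forall>\<omega>\<in>space M. \<forall>i j. J t \<omega> $ i $ j = (\<Sum>k\<in>UNIV. \<Sum>r\<in>UNIV. Y i j k r t \<omega>)"
    by (rule is_matrix_ito_integralE[OF J])
  note Y = this(1)[rule_format] and eqJ = this(2)[rule_format]
  obtain Y' where "\<forall>i j k r. is_ito_integral M F (\<lambda>s \<omega>. W s \<omega> $ k $ r) (\<lambda>s \<omega>. A' s \<omega> $ i $ k * C' s \<omega> $ r $ j) (Y' i j k r)"
    and "\<forall>t\<ge>0. \<forall>\<omega>\<in>space M. \<forall>i j. J' t \<omega> $ i $ j = (\<Sum>k\<in>UNIV. \<Sum>r\<in>UNIV. Y' i j k r t \<omega>)"
    by (rule is_matrix_ito_integralE[OF J'])
  note Y' = this(1)[rule_format] and eqJ' = this(2)[rule_format]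
  have [measurable]: "Y i j k r t \<in> borel_measurable M" "Y' i j k r t \<in> borel_measurable M" for i j k r
    by (rule is_ito_integral_measurable[OF Y t], rule is_ito_integral_measurable[OF Y' t])
  let ?d = "\<lambda>i j k r \<omega>. Y i j k r t \<omega> - Y' i j k r t \<omega>"
  have entry: "(\<integral>\<^sup>+\<omega>. ennreal ((?d i j k r \<omega>)\<^sup>2) \<partial>M) \<le> 9 * (ennreal c * energy M t U)" for i j k r
  proof -
    have "(\<integral>\<^sup>+\<omega>. ennreal ((?d i j k r \<omega>)\<^sup>2) \<partial>M) \<le>
      9 * energy M t (\<lambda>s \<omega>. A s \<omega> $ i $ k * C s \<omega> $ r $ j - A' s \<omega> $ i $ k * C' s \<omega> $ r $ j)"
      by (rule adapted_brownian.ito_integral_difference_estimate[OF W Y Y' t])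
    also have "\<dots> \<le> 9 * (ennreal c * energy M t U)"
      by (intro mult_left_mono energy_le_cmult U c le) auto
    finally show ?thesis .
  qed
  have "(\<integral>\<^sup>+\<omega>. ennreal ((norm (J t \<omega> - J' t \<omega>))\<^sup>2) \<partial>M) \<le>
    (\<integral>\<^sup>+\<omega>. (\<Sum>i\<in>(UNIV::'n set). \<Sum>j\<in>(UNIV::'n set). ennreal ((real CARD('n))\<^sup>2) *
      (\<Sum>k\<in>UNIV. \<Sum>r\<in>UNIV. ennreal ((?d i j k r \<omega>)\<^sup>2))) \<partial>M)"
  proof (rule nn_integral_mono)
    fix \<omega> assume \<omega>: "\<omega> \<in> space M"
    have "(norm (J t \<omega> - J' t \<omega>))\<^sup>2 \<le> (\<Sum>i\<in>UNIV. \<Sum>j\<in>UNIV. (real CARD('n))\<^sup>2 * (\<Sum>k\<in>UNIV. \<Sum>r\<in>UNIV. (?d i j k r \<omega>)\<^sup>2))"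
      unfolding norm_matrix_sq
    proof (intro sum_mono)
      fix i j :: 'n
      have "(J t \<omega> - J' t \<omega>) $ i $ j = (\<Sum>k\<in>UNIV. \<Sum>r\<in>UNIV. ?d i j k r \<omega>)"
        by (simp only: vector_minus_component eqJ[OF t \<omega>] eqJ'[OF t \<omega>] sum_subtractf)
      then show "((J t \<omega> - J' t \<omega>) $ i $ j)\<^sup>2 \<le> (real CARD('n))\<^sup>2 * (\<Sum>k\<in>UNIV. \<Sum>r\<in>UNIV. (?d i j k r \<omega>)\<^sup>2)"
        by (simp only: sum_sum_sq_le)
    qed
    from ennreal_leI[OF this] show "ennreal ((norm (J t \<omega> - J' t \<omega>))\<^sup>2) \<le>
      (\<Sum>i\<in>(UNIV::'n set). \<Sum>j\<in>(UNIV::'n set). ennreal ((real CARD('n))\<^sup>2) *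
      (\<Sum>k\<in>UNIV. \<Sum>r\<in>UNIV. ennreal ((?d i j k r \<omega>)\<^sup>2)))"
      by (simp add: ennreal_mult[symmetric] sum_nonneg)
  qed
  also have "\<dots> = (\<Sum>i\<in>(UNIV::'n set). \<Sum>j\<in>(UNIV::'n set). ennreal ((real CARD('n))\<^sup>2) *
      (\<Sum>k\<in>UNIV. \<Sum>r\<in>UNIV. (\<integral>\<^sup>+\<omega>. ennreal ((?d i j k r \<omega>)\<^sup>2) \<partial>M)))"
    by (simp add: nn_integral_sum nn_integral_cmult del: sum_ennreal)
  also have "\<dots> \<le> (\<Sum>i\<in>(UNIV::'n set). \<Sum>j\<in>(UNIV::'n set). ennreal ((real CARD('n))\<^sup>2) *
      (\<Sum>k\<in>(UNIV::'n set). \<Sum>r\<in>(UNIV::'n set). 9 * (ennreal c * energy M t U)))"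
    by (intro sum_mono mult_left_mono entry) auto
  also have "\<dots> = (of_nat CARD('n) * (of_nat CARD('n) * (ennreal ((real CARD('n))\<^sup>2) *
      (of_nat CARD('n) * (of_nat CARD('n) * (9 * ennreal c)))))) * energy M t U"
    by (simp only: sum_constant mult.assoc)
  also have "of_nat CARD('n) * (of_nat CARD('n) * (ennreal ((real CARD('n))\<^sup>2) *
      (of_nat CARD('n) * (of_nat CARD('n) * (9 * ennreal c))))) =
      ennreal (real CARD('n) * (real CARD('n) * ((real CARD('n))\<^sup>2 * (real CARD('n) * (real CARD('n) * (9 * c))))))"
    using c by (simp add: ennreal_mult ennreal_of_nat_eq_real_of_nat[symmetric])
  also have "real CARD('n) * (real CARD('n) * ((real CARD('n))\<^sup>2 * (real CARD('n) * (real CARD('n) * (9 * c))))) =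
      9 * real CARD('n)^6 * c"
    by (rule sixth_power_collect)
  finally show ?thesis .
qed

end

text \<open>The equation in the form in which it is solved: coefficients defined on all matrices, and a
filtration that contains the null sets.\<close>

locale matrix_sde = filtered_prob_space M F
  for M :: "'w measure" and F :: "real \<Rightarrow> 'w measure" +
  fixes B :: "real \<Rightarrow> 'w \<Rightarrow> real^'n^'n"
    and b g f :: "real^'n^'n \<Rightarrow> real^'n^'n" and X0 :: "real^'n^'n"
  assumes null: "\<And>t. 0 \<le> t \<Longrightarrow> null_sets M \<subseteq> sets (F t)"
    and entries: "\<And>k r. adapted_brownian M F (\<lambda>t \<omega>. B t \<omega> $ k $ r)"
    and coeff: "lipschitz_coefficient b" "lipschitz_coefficient g" "lipschitz_coefficient f"
    and initial: "X0 \<in> sym_mats"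
begin

text \<open>The space on which the Picard map acts.\<close>

definition admissible :: "(real \<Rightarrow> 'w \<Rightarrow> real^'n^'n) \<Rightarrow> bool" where
  "admissible X \<longleftrightarrow> (\<forall>t\<ge>0. X t \<in> borel_measurable (F t)) \<and>
     (\<forall>\<omega>\<in>space M. continuous_on {0..} (\<lambda>t. X t \<omega>))"

abbreviation C0 :: real where "C0 \<equiv> coefficient_const b g f"

lemma C0: "0 \<le> C0" "(norm (b x - b y))\<^sup>2 \<le> C0 * (min 1 (norm (x - y)))\<^sup>2"
  "(g x $ i $ k * f x $ r $ j - g y $ i $ k * f y $ r $ j)\<^sup>2 \<le> C0 * (min 1 (norm (x - y)))\<^sup>2"
  using someI_ex[OF coefficient_gap_bounds[OF coeff]] unfolding coefficient_const_def[symmetric] by auto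

lemma admissible_measurable:
  assumes "admissible X" "0 \<le> t"
  shows "X t \<in> borel_measurable (F t)" "X t \<in> borel_measurable M"
  using assms measurable_F_M unfolding admissible_def by blast+

lemma admissible_continuous:
  "admissible X \<Longrightarrow> \<omega> \<in> space M \<Longrightarrow> continuous_on {0..} (\<lambda>t. X t \<omega>)"
  unfolding admissible_def by blast

lemma jointly_measurable_gap:
  assumes X: "admissible X" and Y: "admissible Y"
  shows "jointly_measurable M (gap X Y)"
proof (rule jointly_measurable_continuous)
  show "gap X Y s \<in> borel_measurable M" if "0 \<le> s" for s
    using admissible_measurable(2)[OF X that] admissible_measurable(2)[OF Y that]
    unfolding gap_def[abs_def] by measurable
  show "continuous_on {0..} (\<lambda>s. gap X Y s \<omega>)" if "\<omega> \<in> space M" for \<omega>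
    using admissible_continuous[OF X that] admissible_continuous[OF Y that]
    unfolding gap_def by (intro continuous_intros)
qed

lemma transpose_entries: "adapted_brownian M F (\<lambda>t \<omega>. transpose (B t \<omega>) $ k $ r)"
  using entries[of r k] by (simp add: transpose_def)

lemma drift_difference:
  assumes X: "admissible X" and Y: "admissible Y" and \<omega>: "\<omega> \<in> space M" and t: "t \<in> {0..T}"
  shows "ennreal ((norm ((LINT s:{0..t}|lborel. b (X s \<omega>)) - (LINT s:{0..t}|lborel. b (Y s \<omega>))))\<^sup>2)
    \<le> ennreal (T * C0) * (\<integral>\<^sup>+s\<in>{0..T}. ennreal ((gap X Y s \<omega>)\<^sup>2) \<partial>lborel)"
proof -
  have c: "continuous_on {0..T} (\<lambda>s. b (Z s \<omega>))" if "admissible Z" for Z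
    by (rule continuous_on_compose2[OF lipschitz_coefficient_continuous[OF coeff(1)]])
      (auto intro: continuous_on_subset[OF admissible_continuous[OF that \<omega>]])
  have T: "0 \<le> T" using t by simp
  have "ennreal ((norm ((LINT s:{0..t}|lborel. b (X s \<omega>)) - (LINT s:{0..t}|lborel. b (Y s \<omega>))))\<^sup>2)
    \<le> ennreal T * (\<integral>\<^sup>+s\<in>{0..T}. ennreal ((norm (b (X s \<omega>) - b (Y s \<omega>)))\<^sup>2) \<partial>lborel)"
    by (rule time_integral_difference_sq_le[OF c[OF X] c[OF Y] t])
  also have "(\<integral>\<^sup>+s\<in>{0..T}. ennreal ((norm (b (X s \<omega>) - b (Y s \<omega>)))\<^sup>2) \<partial>lborel) \<le>
      (\<integral>\<^sup>+s. ennreal C0 * (ennreal ((gap X Y (max 0 s) \<omega>)\<^sup>2) * indicator {0..T} s) \<partial>lborel)"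
  proof (rule nn_integral_mono)
    fix s
    show "ennreal ((norm (b (X s \<omega>) - b (Y s \<omega>)))\<^sup>2) * indicator {0..T} s \<le>
        ennreal C0 * (ennreal ((gap X Y (max 0 s) \<omega>)\<^sup>2) * indicator {0..T} s)"
      using ennreal_leI[OF C0(2)[of "X s \<omega>" "Y s \<omega>"]] C0(1)
      by (auto simp: indicator_def ennreal_mult gap_def)
  qed
  also have "\<dots> = ennreal C0 * (\<integral>\<^sup>+s\<in>{0..T}. ennreal ((gap X Y s \<omega>)\<^sup>2) \<partial>lborel)"
    unfolding clamp_nn_integral[where f="\<lambda>s. ennreal ((gap X Y s \<omega>)\<^sup>2)"]
    by (rule nn_integral_cmult[OF jointly_measurable_inner(2)[OF jointly_measurable_gap[OF X Y] \<omega>]])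
  finally show ?thesis using T C0(1) by (simp add: ennreal_mult mult.assoc mult_left_mono)
qed

text \<open>Three terms, hence the factor 3: the drift contributes \<open>T * C0\<close>, and each of the two matrix integrals
contributes \<open>9 * n^6 * C0\<close>.\<close>

definition gronwall_const :: "real \<Rightarrow> real" where
  "gronwall_const T = 3 * (T * C0 + 18 * real CARD('n)^6 * C0)"

lemma gronwall_const_nonneg: "0 \<le> T \<Longrightarrow> 0 \<le> gronwall_const T"
  using C0(1) by (simp add: gronwall_const_def)

text \<open>The central estimate, used for uniqueness, for the rate of the Picard iteration and for identifying
its limit.\<close>

theorem sde_step_difference:
  assumes X: "admissible X" and X': "admissible X'"
    and P: "sde_step M F B b g f X0 X P" and P': "sde_step M F B b g f X0 X' P'" and t: "0 \<le> t"
  shows "(\<integral>\<^sup>+\<omega>. ennreal ((norm (P t \<omega> - P' t \<omega>))\<^sup>2) \<partial>M) \<le> ennreal (gronwall_const t) * energy M t (gap X X')"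
proof -
  obtain J K where J: "is_matrix_ito_integral M F (\<lambda>s \<omega>. g (X s \<omega>)) B (\<lambda>s \<omega>. f (X s \<omega>)) J"
    and K: "is_matrix_ito_integral M F (\<lambda>s \<omega>. f (X s \<omega>)) (\<lambda>s \<omega>. transpose (B s \<omega>)) (\<lambda>s \<omega>. g (X s \<omega>)) K"
    and eq: "AE \<omega> in M. \<forall>t\<ge>0. set_integrable lborel {0..t} (\<lambda>s. b (X s \<omega>)) \<and>
        P t \<omega> = X0 + (LINT s:{0..t}|lborel. b (X s \<omega>)) + J t \<omega> + K t \<omega>"
    using P unfolding sde_step_def by blast
  obtain J' K' where J': "is_matrix_ito_integral M F (\<lambda>s \<omega>. g (X' s \<omega>)) B (\<lambda>s \<omega>. f (X' s \<omega>)) J'"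
    and K': "is_matrix_ito_integral M F (\<lambda>s \<omega>. f (X' s \<omega>)) (\<lambda>s \<omega>. transpose (B s \<omega>)) (\<lambda>s \<omega>. g (X' s \<omega>)) K'"
    and eq': "AE \<omega> in M. \<forall>t\<ge>0. set_integrable lborel {0..t} (\<lambda>s. b (X' s \<omega>)) \<and>
        P' t \<omega> = X0 + (LINT s:{0..t}|lborel. b (X' s \<omega>)) + J' t \<omega> + K' t \<omega>"
    using P' unfolding sde_step_def by blast
  note U = jointly_measurable_gap[OF X X']
  note [measurable] = matrix_ito_integral_measurable[OF J t] matrix_ito_integral_measurable[OF K t]
    matrix_ito_integral_measurable[OF J' t] matrix_ito_integral_measurable[OF K' t]
    jointly_measurable_inner(1)[OF U, of t]
  let ?E = "energy M t (gap X X')" and ?\<kappa> = "9 * real CARD('n)^6 * C0"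
  let ?in = "\<lambda>\<omega>. \<integral>\<^sup>+s\<in>{0..t}. ennreal ((gap X X' s \<omega>)\<^sup>2) \<partial>lborel"
  have J_le: "(\<integral>\<^sup>+\<omega>. ennreal ((norm (J t \<omega> - J' t \<omega>))\<^sup>2) \<partial>M) \<le> ennreal ?\<kappa> * ?E"
    by (rule matrix_ito_difference[OF entries J J' U C0(1) _ t]) (use C0(3) in \<open>simp add: gap_def\<close>)
  have K_le: "(\<integral>\<^sup>+\<omega>. ennreal ((norm (K t \<omega> - K' t \<omega>))\<^sup>2) \<partial>M) \<le> ennreal ?\<kappa> * ?E"
  proof (rule matrix_ito_difference[OF transpose_entries K K' U C0(1) _ t])
    fix s :: real and \<omega> :: 'w and i j k r
    show "(f (X s \<omega>) $ i $ k * g (X s \<omega>) $ r $ j - f (X' s \<omega>) $ i $ k * g (X' s \<omega>) $ r $ j)\<^sup>2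
        \<le> C0 * (gap X X' s \<omega>)\<^sup>2"
      using C0(3)[of "X s \<omega>" r j i k "X' s \<omega>"] by (simp add: gap_def mult.commute)
  qed
  have "(\<integral>\<^sup>+\<omega>. ennreal ((norm (P t \<omega> - P' t \<omega>))\<^sup>2) \<partial>M) \<le>
    (\<integral>\<^sup>+\<omega>. 3 * (ennreal (t * C0) * ?in \<omega> + ennreal ((norm (J t \<omega> - J' t \<omega>))\<^sup>2) + ennreal ((norm (K t \<omega> - K' t \<omega>))\<^sup>2)) \<partial>M)"
  proof (rule nn_integral_mono_AE)
    show "AE \<omega> in M. ennreal ((norm (P t \<omega> - P' t \<omega>))\<^sup>2) \<le> 3 * (ennreal (t * C0) * ?in \<omega>
        + ennreal ((norm (J t \<omega> - J' t \<omega>))\<^sup>2) + ennreal ((norm (K t \<omega> - K' t \<omega>))\<^sup>2))"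
      using eq eq' AE_space
    proof eventually_elim
      fix \<omega> :: 'w
      let ?b = "\<lambda>X. LINT s:{0..t}|lborel. b (X s \<omega>)"
      assume P: "\<forall>t\<ge>0. set_integrable lborel {0..t} (\<lambda>s. b (X s \<omega>)) \<and>
        P t \<omega> = X0 + (LINT s:{0..t}|lborel. b (X s \<omega>)) + J t \<omega> + K t \<omega>"
        and P': "\<forall>t\<ge>0. set_integrable lborel {0..t} (\<lambda>s. b (X' s \<omega>)) \<and>
        P' t \<omega> = X0 + (LINT s:{0..t}|lborel. b (X' s \<omega>)) + J' t \<omega> + K' t \<omega>"
        and \<omega>: "\<omega> \<in> space M"
      have "P t \<omega> - P' t \<omega> = (?b X - ?b X') + (J t \<omega> - J' t \<omega>) + (K t \<omega> - K' t \<omega>)"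
        using P P' t by simp
      then have "norm (P t \<omega> - P' t \<omega>) \<le> norm (?b X - ?b X') + norm (J t \<omega> - J' t \<omega>) + norm (K t \<omega> - K' t \<omega>)"
        by (metis norm_triangle_le add_right_mono norm_triangle_ineq order_refl)
      then have "(norm (P t \<omega> - P' t \<omega>))\<^sup>2 \<le> (norm (?b X - ?b X') + norm (J t \<omega> - J' t \<omega>) + norm (K t \<omega> - K' t \<omega>))\<^sup>2"
        by (intro power_mono) auto
      also have "\<dots> \<le> 3 * ((norm (?b X - ?b X'))\<^sup>2 + (norm (J t \<omega> - J' t \<omega>))\<^sup>2 + (norm (K t \<omega> - K' t \<omega>))\<^sup>2)"
        by (rule sq_sum3_le)
      finally have "ennreal ((norm (P t \<omega> - P' t \<omega>))\<^sup>2) \<le> ennreal (3 * ((norm (?b X - ?b X'))\<^sup>2 + (norm (J t \<omega> - J' t \<omega>))\<^sup>2 + (norm (K t \<omega> - K' t \<omega>))\<^sup>2))"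
        by (rule ennreal_leI)
      also have "\<dots> = 3 * (ennreal ((norm (?b X - ?b X'))\<^sup>2) + ennreal ((norm (J t \<omega> - J' t \<omega>))\<^sup>2) + ennreal ((norm (K t \<omega> - K' t \<omega>))\<^sup>2))"
        by (simp add: ennreal_mult ennreal_plus)
      also have "\<dots> \<le> 3 * (ennreal (t * C0) * ?in \<omega>
        + ennreal ((norm (J t \<omega> - J' t \<omega>))\<^sup>2) + ennreal ((norm (K t \<omega> - K' t \<omega>))\<^sup>2))"
        using t by (intro mult_left_mono add_right_mono drift_difference[OF X X' \<omega>]) auto
      finally show "ennreal ((norm (P t \<omega> - P' t \<omega>))\<^sup>2) \<le> 3 * (ennreal (t * C0) * ?in \<omega>
        + ennreal ((norm (J t \<omega> - J' t \<omega>))\<^sup>2) + ennreal ((norm (K t \<omega> - K' t \<omega>))\<^sup>2))" .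
    qed
  qed
  also have "\<dots> = 3 * (ennreal (t * C0) * ?E + (\<integral>\<^sup>+\<omega>. ennreal ((norm (J t \<omega> - J' t \<omega>))\<^sup>2) \<partial>M)
      + (\<integral>\<^sup>+\<omega>. ennreal ((norm (K t \<omega> - K' t \<omega>))\<^sup>2) \<partial>M))"
    by (simp add: nn_integral_cmult nn_integral_add energy_def)
  also have "\<dots> \<le> 3 * (ennreal (t * C0) * ?E + ennreal ?\<kappa> * ?E + ennreal ?\<kappa> * ?E)"
    by (intro mult_left_mono add_mono J_le K_le) auto
  also have "\<dots> = ennreal (gronwall_const t) * ?E"
  proof -
    have \<kappa>: "0 \<le> ?\<kappa>" "0 \<le> t * C0" using C0(1) t by simp_all
    have "ennreal (t * C0) + ennreal ?\<kappa> + ennreal ?\<kappa> = ennreal (t * C0 + ?\<kappa> + ?\<kappa>)"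
      using \<kappa> by (simp only: ennreal_plus add_nonneg_nonneg)
    moreover have "gronwall_const t = 3 * (t * C0 + ?\<kappa> + ?\<kappa>)" by (simp add: gronwall_const_def)
    moreover have "ennreal (3 * (t * C0 + ?\<kappa> + ?\<kappa>)) = ennreal 3 * ennreal (t * C0 + ?\<kappa> + ?\<kappa>)"
      using \<kappa> by (intro ennreal_mult) auto
    ultimately have "ennreal (gronwall_const t) = 3 * (ennreal (t * C0) + ennreal ?\<kappa> + ennreal ?\<kappa>)"
      by (simp only: ennreal_numeral)
    then show ?thesis by (simp only: distrib_right mult.assoc)
  qed
  finally show ?thesis .
qed

end

section \<open>Uniqueness\<close>

text \<open>Equality at the countably many dyadic times holds outside a single null set, and dyadic times are
dense.\<close>

lemma indistinguishable_of_continuous: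
  fixes X Y :: "real \<Rightarrow> 'w \<Rightarrow> 'e::t2_space"
  assumes X: "\<And>\<omega>. \<omega> \<in> space M \<Longrightarrow> continuous_on {0..} (\<lambda>t. X t \<omega>)"
    and Y: "\<And>\<omega>. \<omega> \<in> space M \<Longrightarrow> continuous_on {0..} (\<lambda>t. Y t \<omega>)"
    and eq: "\<And>t. 0 \<le> t \<Longrightarrow> AE \<omega> in M. X t \<omega> = Y t \<omega>"
  shows "AE \<omega> in M. \<forall>t\<ge>0. X t \<omega> = Y t \<omega>"
proof -
  have "AE \<omega> in M. \<forall>m i. X (real i / 2^m) \<omega> = Y (real i / 2^m) \<omega>"
    unfolding AE_all_countable by (intro allI eq) simp
  then show ?thesis using AE_space
  proof eventually_elim
    fix \<omega> assume d: "\<forall>m i. X (real i / 2^m) \<omega> = Y (real i / 2^m) \<omega>" and \<omega>: "\<omega> \<in> space M"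
    show "\<forall>t\<ge>0. X t \<omega> = Y t \<omega>"
    proof (intro allI impI)
      fix t :: real assume t: "0 \<le> t"
      have lim: "(\<lambda>m. z (real (nat \<lfloor>t * 2^m\<rfloor>) / 2^m)) \<longlonglongrightarrow> z t"
        if "continuous_on {0..} z" for z :: "real \<Rightarrow> 'e"
        using t by (intro continuous_on_tendsto_compose[OF that dyadic_floor_tendsto]) auto
      show "X t \<omega> = Y t \<omega>"
        using lim[OF X[OF \<omega>]] lim[OF Y[OF \<omega>]] d by (simp add: LIMSEQ_unique)
    qed
  qed
qed

text \<open>Gronwall's argument for a sequence of functions. A constant sequence gives uniqueness, the increments
of the iteration give existence.\<close>

lemma gronwall_iteration:
  fixes v :: "nat \<Rightarrow> real \<Rightarrow> ennreal"
  assumes C: "0 \<le> C" and v0: "\<And>s. s \<in> {0..T} \<Longrightarrow> v 0 s \<le> 1"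
    and step: "\<And>n s. s \<in> {0..T} \<Longrightarrow> v (Suc n) s \<le> ennreal C * (\<integral>\<^sup>+r\<in>{0..s}. v n r \<partial>lborel)"
    and s: "s \<in> {0..T}"
  shows "v n s \<le> ennreal ((C * s)^n / fact n)"
  using s
proof (induction n arbitrary: s)
  case 0
  then show ?case using v0 by simp
next
  case (Suc n)
  define G where "G = (\<lambda>r::real. C^n / fact (Suc n) * r^Suc n)"
  have k: "C^n / fact (Suc n) * real (Suc n) = C^n / fact n"
    by (simp only: fact_Suc) (simp del: of_nat_Suc)
  have s: "0 \<le> s" using Suc.prems by simp
  have "(\<integral>\<^sup>+r\<in>{0..s}. v n r \<partial>lborel) \<le> (\<integral>\<^sup>+r. ennreal ((C * r)^n / fact n) * indicator {0..s} r \<partial>lborel)"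
    using Suc.IH Suc.prems by (intro nn_integral_mono) (auto simp: indicator_def)
  also have "\<dots> = ennreal (G s - G 0)"
  proof (rule nn_integral_FTC_Icc)
    fix r assume r: "r \<in> {0..s}"
    have "(G has_real_derivative C^n / fact (Suc n) * (real (Suc n) * r^n)) (at r)"
      unfolding G_def by (intro DERIV_cmult) (use DERIV_pow[of "Suc n" r] in simp)
    also have "C^n / fact (Suc n) * (real (Suc n) * r^n) = (C * r)^n / fact n"
      using arg_cong[OF k, of "\<lambda>x. x * r^n"] by (simp add: power_mult_distrib mult_ac)
    finally show "(G has_real_derivative (C * r)^n / fact n) (at r)" .
    show "0 \<le> (C * r)^n / fact n" using r C by auto
  qed (use s in auto)
  finally have "ennreal C * (\<integral>\<^sup>+r\<in>{0..s}. v n r \<partial>lborel) \<le> ennreal C * ennreal (G s)"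
    by (intro mult_left_mono) (auto simp: G_def)
  also have "\<dots> = ennreal (C * G s)" using C s by (intro ennreal_mult[symmetric]) (auto simp: G_def)
  also have "C * G s = (C * s)^Suc n / fact (Suc n)" by (simp add: G_def power_mult_distrib)
  finally show ?case using step[OF Suc.prems, of n] by (rule order_trans[rotated])
qed

lemma power_div_fact_tendsto_0: "(\<lambda>n. (x::real)^n / fact n) \<longlonglongrightarrow> 0"
  using summable_LIMSEQ_zero[OF summable_exp[of x]] by (simp add: divide_inverse mult.commute)

context matrix_sde
begin

definition mean_sq_gap :: "(real \<Rightarrow> 'w \<Rightarrow> real^'n^'n) \<Rightarrow> (real \<Rightarrow> 'w \<Rightarrow> real^'n^'n) \<Rightarrow> real \<Rightarrow> ennreal" where
  "mean_sq_gap X Y s = (\<integral>\<^sup>+\<omega>. ennreal ((gap X Y s \<omega>)\<^sup>2) \<partial>M)"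

lemma mean_sq_gap_le_1: "mean_sq_gap X Y s \<le> 1"
proof -
  have "(gap X Y s \<omega>)\<^sup>2 \<le> 1" for \<omega>
    using power_mono[of "gap X Y s \<omega>" 1 2] by (simp add: gap_def)
  then have "mean_sq_gap X Y s \<le> (\<integral>\<^sup>+\<omega>. 1 \<partial>M)"
    unfolding mean_sq_gap_def by (intro nn_integral_mono) (simp add: ennreal_le_1)
  then show ?thesis by (simp add: emeasure_space_1)
qed

lemma energy_gap_eq:
  assumes "admissible X" "admissible Y"
  shows "energy M t (gap X Y) = (\<integral>\<^sup>+s\<in>{0..t}. mean_sq_gap X Y s \<partial>lborel)"
  unfolding mean_sq_gap_def
  by (rule energy_eq_time_integral[OF _ jointly_measurable_gap[OF assms]]) unfold_locales

lemma gronwall_const_mono: "s \<le> t \<Longrightarrow> gronwall_const s \<le> gronwall_const t"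
  using C0(1) by (simp add: gronwall_const_def mult_right_mono)

lemma mean_sq_gap_step:
  assumes X: "admissible X" and X': "admissible X'"
    and P: "sde_step M F B b g f X0 X P" and P': "sde_step M F B b g f X0 X' P'" and t: "t \<in> {0..T}"
  shows "mean_sq_gap P P' t \<le> ennreal (gronwall_const T) * (\<integral>\<^sup>+s\<in>{0..t}. mean_sq_gap X X' s \<partial>lborel)"
proof -
  have "(gap P P' t \<omega>)\<^sup>2 \<le> (norm (P t \<omega> - P' t \<omega>))\<^sup>2" for \<omega>
    by (intro power_mono) (auto simp: gap_def)
  then have "mean_sq_gap P P' t \<le> (\<integral>\<^sup>+\<omega>. ennreal ((norm (P t \<omega> - P' t \<omega>))\<^sup>2) \<partial>M)"
    unfolding mean_sq_gap_def by (intro nn_integral_mono ennreal_leI)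
  also have "\<dots> \<le> ennreal (gronwall_const t) * energy M t (gap X X')"
    using t by (intro sde_step_difference[OF X X' P P']) auto
  also have "\<dots> \<le> ennreal (gronwall_const T) * energy M t (gap X X')"
    using t by (intro mult_right_mono ennreal_leI gronwall_const_mono) auto
  finally show ?thesis unfolding energy_gap_eq[OF X X'] .
qed

theorem sde_unique:
  assumes X: "admissible X" and X': "admissible X'"
    and sX: "sde_step M F B b g f X0 X X" and sX': "sde_step M F B b g f X0 X' X'"
  shows "AE \<omega> in M. \<forall>t\<ge>0. X t \<omega> = X' t \<omega>"
proof (rule indistinguishable_of_continuous)
  fix t :: real assume t: "0 \<le> t"
  let ?C = "gronwall_const t"
  have C: "0 \<le> ?C" using t by (rule gronwall_const_nonneg)
  have "mean_sq_gap X X' t \<le> ennreal ((?C * t)^n / fact n)" for n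
    by (rule gronwall_iteration[of ?C t "\<lambda>_. mean_sq_gap X X'", OF C mean_sq_gap_le_1 mean_sq_gap_step[OF X X' sX sX']])
      (use t in auto)
  moreover have "(\<lambda>n. ennreal ((?C * t)^n / fact n)) \<longlonglongrightarrow> ennreal 0"
    by (intro tendsto_ennrealI power_div_fact_tendsto_0)
  ultimately have "mean_sq_gap X X' t \<le> ennreal 0" by (intro LIMSEQ_le_const) auto
  then have z: "(\<integral>\<^sup>+\<omega>. ennreal ((gap X X' t \<omega>)\<^sup>2) \<partial>M) = 0" by (simp add: mean_sq_gap_def)
  have [measurable]: "X t \<in> borel_measurable M" "X' t \<in> borel_measurable M"
    using admissible_measurable(2)[OF X t] admissible_measurable(2)[OF X' t] by auto
  have "(\<lambda>\<omega>. ennreal ((gap X X' t \<omega>)\<^sup>2)) \<in> borel_measurable M" unfolding gap_def by measurable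
  from nn_integral_0_iff_AE[OF this] z have "AE \<omega> in M. ennreal ((gap X X' t \<omega>)\<^sup>2) = 0" by simp
  then show "AE \<omega> in M. X t \<omega> = X' t \<omega>"
    by (rule eventually_mono) (auto simp: gap_def min_def split: if_splits)
qed (use admissible_continuous X X' in auto)

section \<open>Picard iteration\<close>

definition noise_integrand :: "(real \<Rightarrow> 'w \<Rightarrow> real^'n^'n) \<Rightarrow> 'n \<Rightarrow> 'n \<Rightarrow> 'n \<Rightarrow> 'n \<Rightarrow> real \<Rightarrow> 'w \<Rightarrow> real" where
  "noise_integrand X i j k r s \<omega> = g (X s \<omega>) $ i $ k * f (X s \<omega>) $ r $ j"

text \<open>The scalar integral is fixed by choice, together with its martingale property, which is needed for
maximal inequalities.\<close>

definition noise_entry :: "(real \<Rightarrow> 'w \<Rightarrow> real^'n^'n) \<Rightarrow> 'n \<Rightarrow> 'n \<Rightarrow> 'n \<Rightarrow> 'n \<Rightarrow> real \<Rightarrow> 'w \<Rightarrow> real" where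
  "noise_entry X i j k r = (SOME Y.
     is_ito_integral M F (\<lambda>t \<omega>. B t \<omega> $ k $ r) (noise_integrand X i j k r) Y \<and> L2_martingale Y)"

definition noise :: "(real \<Rightarrow> 'w \<Rightarrow> real^'n^'n) \<Rightarrow> real \<Rightarrow> 'w \<Rightarrow> real^'n^'n" where
  "noise X t \<omega> = (\<chi> i j. \<Sum>k\<in>UNIV. \<Sum>r\<in>UNIV. noise_entry X i j k r t \<omega>)"

definition drift :: "(real \<Rightarrow> 'w \<Rightarrow> real^'n^'n) \<Rightarrow> real \<Rightarrow> 'w \<Rightarrow> real^'n^'n" where
  "drift X t \<omega> = (LINT s:{0..t}|lborel. b (X s \<omega>))"

text \<open>The second stochastic integral of the equation is represented by the transpose of the first one, so
that the values are symmetric for every outcome and not only almost surely.\<close>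

definition picard :: "(real \<Rightarrow> 'w \<Rightarrow> real^'n^'n) \<Rightarrow> real \<Rightarrow> 'w \<Rightarrow> real^'n^'n" where
  "picard X t \<omega> = X0 + drift X t \<omega> + noise X t \<omega> + transpose (noise X t \<omega>)"

lemma coeff_entry_continuous:
  assumes "lipschitz_coefficient h" shows "continuous_on UNIV (\<lambda>A. h A $ i $ j)"
  by (intro continuous_intros lipschitz_coefficient_continuous assms)

lemma noise_integrand_adapted:
  assumes X: "admissible X" and s: "0 \<le> s"
  shows "noise_integrand X i j k r s \<in> borel_measurable (F s)"
  unfolding noise_integrand_def[abs_def]
  by (intro borel_measurable_times
      measurable_compose[OF admissible_measurable(1)[OF X s] borel_measurable_continuous_onI]
      coeff_entry_continuous coeff)

lemma noise_integrand_continuous: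
  assumes X: "admissible X" and \<omega>: "\<omega> \<in> space M"
  shows "continuous_on {0..} (\<lambda>s. noise_integrand X i j k r s \<omega>)"
  unfolding noise_integrand_def
  by (intro continuous_on_mult continuous_on_compose2[OF coeff_entry_continuous[OF coeff(2)] admissible_continuous[OF X \<omega>]]
     continuous_on_compose2[OF coeff_entry_continuous[OF coeff(3)] admissible_continuous[OF X \<omega>]]) auto

lemma noise_integrand_bounded: "\<exists>K. \<forall>X i j k r s \<omega>. \<bar>noise_integrand X i j k r s \<omega>\<bar> \<le> K"
proof -
  obtain K1 K2 where K: "\<And>A i j. \<bar>g A $ i $ j\<bar> \<le> K1" "\<And>A i j. \<bar>f A $ i $ j\<bar> \<le> K2"
    using coeff unfolding lipschitz_coefficient_def by blast
  have "\<bar>noise_integrand X i j k r s \<omega>\<bar> \<le> K1 * K2" for X i j k r s \<omega>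
    unfolding noise_integrand_def abs_mult
    by (intro mult_mono K) (auto intro: order_trans[OF abs_ge_zero K(1)])
  then show ?thesis by blast
qed

lemma noise_entry:
  assumes X: "admissible X"
  shows "is_ito_integral M F (\<lambda>t \<omega>. B t \<omega> $ k $ r) (noise_integrand X i j k r) (noise_entry X i j k r)"
    and "L2_martingale (noise_entry X i j k r)"
proof -
  obtain K where K: "\<forall>X i j k r s \<omega>. \<bar>noise_integrand X i j k r s \<omega>\<bar> \<le> K"
    using noise_integrand_bounded by blast
  have "\<exists>Y. is_ito_integral M F (\<lambda>t \<omega>. B t \<omega> $ k $ r) (noise_integrand X i j k r) Y \<and> L2_martingale Y"
    by (rule adapted_brownian.ito_integral_exists[OF entries null noise_integrand_adapted[OF X]
          noise_integrand_continuous[OF X], where K=K]) (use K in auto)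
  from someI_ex[OF this] show
    "is_ito_integral M F (\<lambda>t \<omega>. B t \<omega> $ k $ r) (noise_integrand X i j k r) (noise_entry X i j k r)"
    "L2_martingale (noise_entry X i j k r)"
    unfolding noise_entry_def[symmetric] by auto
qed

lemma noise_entry_continuous:
  "admissible X \<Longrightarrow> \<omega> \<in> space M \<Longrightarrow> continuous_on {0..} (\<lambda>t. noise_entry X i j k r t \<omega>)"
  using noise_entry(1) by (simp add: is_ito_integral_def)

lemma continuous_drift_integrand:
  assumes X: "admissible X" and \<omega>: "\<omega> \<in> space M"
  shows "continuous_on {0..} (\<lambda>s. b (X s \<omega>))"
  by (rule continuous_on_compose2[OF lipschitz_coefficient_continuous[OF coeff(1)] admissible_continuous[OF X \<omega>]]) auto

lemma drift_integrable:
  assumes X: "admissible X" and \<omega>: "\<omega> \<in> space M"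
  shows "set_integrable lborel {0..t} (\<lambda>s. b (X s \<omega>))"
  by (intro borel_integrable_atLeastAtMost' continuous_on_subset[OF continuous_drift_integrand[OF assms]]) auto

lemma drift_continuous:
  assumes X: "admissible X" and \<omega>: "\<omega> \<in> space M"
  shows "continuous_on {0..} (\<lambda>t. drift X t \<omega>)"
proof (rule continuous_on_halfline)
  fix k :: nat
  have "continuous_on {0..real k} (\<lambda>t. integral {0..t} (\<lambda>s. b (X s \<omega>)))"
    by (intro indefinite_integral_continuous_1 integrable_continuous_interval
        continuous_on_subset[OF continuous_drift_integrand[OF assms]]) auto
  moreover have "drift X t \<omega> = integral {0..t} (\<lambda>s. b (X s \<omega>))" for t
    unfolding drift_def by (rule set_borel_integral_eq_integral(2)[OF drift_integrable[OF assms]])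
  ultimately show "continuous_on {0..real k} (\<lambda>t. drift X t \<omega>)" by simp
qed

text \<open>Up to time \<open>t\<close> the integrand agrees with the one of the process stopped at \<open>t\<close>, which is jointly
measurable with respect to the past of \<open>t\<close>.\<close>

lemma drift_adapted:
  assumes X: "admissible X" and t: "0 \<le> t"
  shows "drift X t \<in> borel_measurable (F t)"
proof -
  have "jointly_measurable (F t) (\<lambda>s \<omega>. X (min s t) \<omega>)"
  proof (rule jointly_measurable_continuous)
    show "X (min s t) \<in> borel_measurable (F t)" if "0 \<le> s" for s
      by (rule measurable_F_mono[OF _ admissible_measurable(1)[OF X]]) (use that t in auto)
    show "continuous_on {0..} (\<lambda>s. X (min s t) \<omega>)" if "\<omega> \<in> space (F t)" for \<omega>
      by (rule continuous_on_compose2[OF admissible_continuous[OF X]])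
        (use that t in \<open>auto intro!: continuous_intros\<close>)
  qed
  from measurable_compose[OF jointly_measurable_clamped[OF this]
      borel_measurable_continuous_onI[OF lipschitz_coefficient_continuous[OF coeff(1)]]]
  have 1: "(\<lambda>p. b (X (min (max 0 (fst p)) t) (snd p))) \<in> borel_measurable (borel \<Otimes>\<^sub>M F t)"
    by (simp add: case_prod_beta')
  have "(\<lambda>q. (snd q, fst q)) \<in> F t \<Otimes>\<^sub>M lborel \<rightarrow>\<^sub>M borel \<Otimes>\<^sub>M F t" by measurable
  from measurable_compose[OF this 1]
  have [measurable]: "(\<lambda>q. b (X (min (max 0 (snd q)) t) (fst q))) \<in> borel_measurable (F t \<Otimes>\<^sub>M lborel)" by simp
  have "(\<lambda>(\<omega>, s). indicator {0..t} s *\<^sub>R b (X (min (max 0 s) t) \<omega>)) \<in> borel_measurable (F t \<Otimes>\<^sub>M lborel)"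
    unfolding case_prod_beta' by measurable
  then have "(\<lambda>\<omega>. LINT s|lborel. indicator {0..t} s *\<^sub>R b (X (min (max 0 s) t) \<omega>)) \<in> borel_measurable (F t)"
    by (rule sigma_finite_measure.borel_measurable_lebesgue_integral[OF sigma_finite_lborel])
  moreover have "drift X t = (\<lambda>\<omega>. LINT s|lborel. indicator {0..t} s *\<^sub>R b (X (min (max 0 s) t) \<omega>))"
    unfolding drift_def set_lebesgue_integral_def
    by (intro ext Bochner_Integration.integral_cong refl) (auto simp: indicator_def)
  ultimately show ?thesis by simp
qed

lemma transpose_continuous: "continuous_on UNIV (transpose :: real^'n^'n \<Rightarrow> real^'n^'n)"
  unfolding transpose_def by (intro continuous_intros)

lemma admissible_picard:
  assumes X: "admissible X" shows "admissible (picard X)"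
  unfolding admissible_def
proof (intro conjI allI impI ballI)
  fix t :: real assume t: "0 \<le> t"
  have n: "noise X t \<in> borel_measurable (F t)"
    by (intro matrix_measurableI)
      (simp add: noise_def borel_measurable_sum L2_martingaleD(1)[OF noise_entry(2)[OF X] t])
  from measurable_compose[OF n borel_measurable_continuous_onI[OF transpose_continuous]] n drift_adapted[OF X t]
  show "picard X t \<in> borel_measurable (F t)"
    unfolding picard_def[abs_def] by (intro borel_measurable_add borel_measurable_const)
next
  fix \<omega> assume \<omega>: "\<omega> \<in> space M"
  have n: "continuous_on {0..} (\<lambda>t. noise X t \<omega>)"
    unfolding noise_def by (intro continuous_intros noise_entry_continuous[OF X \<omega>])
  have "continuous_on {0..} (\<lambda>t. transpose (noise X t \<omega>))"
    by (rule continuous_on_compose2[OF transpose_continuous n]) auto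
  then show "continuous_on {0..} (\<lambda>t. picard X t \<omega>)"
    unfolding picard_def by (intro continuous_intros n drift_continuous[OF X \<omega>])
qed

lemma coeff_symmetric: "transpose (h A) = h A" "h A $ i $ j = h A $ j $ i"
  if "lipschitz_coefficient h" for h :: "real^'n^'n \<Rightarrow> real^'n^'n"
proof -
  show *: "transpose (h A) = h A" using that unfolding lipschitz_coefficient_def by blast
  show "h A $ i $ j = h A $ j $ i" using arg_cong[OF *, of "\<lambda>A. A $ i $ j"] by (simp add: transpose_def)
qed

text \<open>By the symmetry of the coefficients the integrands of \<open>\<integral> f dB\<^sup>T g\<close> are those of \<open>\<integral> g dB f\<close> with the
indices \<open>i, j\<close> and \<open>k, r\<close> exchanged.\<close>

lemma sde_step_picard:
  assumes X: "admissible X" shows "sde_step M F B b g f X0 X (picard X)"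
  unfolding sde_step_def
proof (intro exI conjI)
  show "is_matrix_ito_integral M F (\<lambda>s \<omega>. g (X s \<omega>)) B (\<lambda>s \<omega>. f (X s \<omega>)) (noise X)"
    unfolding is_matrix_ito_integral_def
    by (rule exI[of _ "noise_entry X"])
      (use noise_entry(1)[OF X, unfolded noise_integrand_def[abs_def]] in \<open>simp add: noise_def\<close>)
  show "is_matrix_ito_integral M F (\<lambda>s \<omega>. f (X s \<omega>)) (\<lambda>s \<omega>. transpose (B s \<omega>)) (\<lambda>s \<omega>. g (X s \<omega>))
      (\<lambda>t \<omega>. transpose (noise X t \<omega>))"
    unfolding is_matrix_ito_integral_def
  proof (rule exI[of _ "\<lambda>i j k r. noise_entry X j i r k"], intro conjI allI impI ballI)
    fix i j k r
    have "noise_integrand X j i r k = (\<lambda>s \<omega>. f (X s \<omega>) $ i $ k * g (X s \<omega>) $ r $ j)"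
      unfolding noise_integrand_def[abs_def]
      using coeff_symmetric(2)[OF coeff(2), of _ j r] coeff_symmetric(2)[OF coeff(3), of _ k i]
      by (simp only: mult.commute)
    then show "is_ito_integral M F (\<lambda>s \<omega>. transpose (B s \<omega>) $ k $ r)
       (\<lambda>s \<omega>. f (X s \<omega>) $ i $ k * g (X s \<omega>) $ r $ j) (noise_entry X j i r k)"
      using noise_entry(1)[OF X, of r k j i] by (simp add: transpose_def)
    fix t \<omega>
    show "transpose (noise X t \<omega>) $ i $ j = (\<Sum>k\<in>UNIV. \<Sum>r\<in>UNIV. noise_entry X j i r k t \<omega>)"
      unfolding transpose_def noise_def vec_lambda_beta by (rule sum.swap)
  qed
  show "AE \<omega> in M. \<forall>t\<ge>0. set_integrable lborel {0..t} (\<lambda>s. b (X s \<omega>)) \<and>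
      picard X t \<omega> = X0 + (LINT s:{0..t}|lborel. b (X s \<omega>)) + noise X t \<omega> + transpose (noise X t \<omega>)"
    by (intro AE_I2 allI impI conjI drift_integrable[OF X]) (simp_all add: picard_def drift_def)
qed

lemma bounded_linear_transpose: "bounded_linear (transpose :: real^'n^'n \<Rightarrow> real^'n^'n)"
proof (rule bounded_linear_intro[where K=1])
  show "transpose (A + A') = transpose A + transpose A'" for A A' :: "real^'n^'n"
    by (simp add: transpose_def vec_eq_iff)
  show "transpose (c *\<^sub>R A) = c *\<^sub>R transpose A" for c and A :: "real^'n^'n"
    by (simp add: transpose_def vec_eq_iff)
  show "norm (transpose A) \<le> norm A * 1" for A :: "real^'n^'n" by (simp add: norm_transpose)
qed

lemma picard_symmetric:
  assumes X: "admissible X" and \<omega>: "\<omega> \<in> space M"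
  shows "picard X t \<omega> \<in> sym_mats"
proof -
  have "transpose (drift X t \<omega>) = drift X t \<omega>"
  proof -
    have "transpose (LINT s|lborel. indicator {0..t} s *\<^sub>R b (X s \<omega>)) =
        (LINT s|lborel. transpose (indicator {0..t} s *\<^sub>R b (X s \<omega>)))"
      by (rule integral_bounded_linear[OF bounded_linear_transpose, symmetric])
        (use drift_integrable[OF X \<omega>] in \<open>simp add: set_integrable_def\<close>)
    also have "\<dots> = (LINT s|lborel. indicator {0..t} s *\<^sub>R b (X s \<omega>))"
      by (simp only: linear_cmul[OF bounded_linear.linear[OF bounded_linear_transpose]] coeff_symmetric(1)[OF coeff(1)])
    finally show ?thesis unfolding drift_def set_lebesgue_integral_def .
  qed
  moreover have "transpose X0 = X0" using initial by (simp add: sym_mats_def)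
  moreover have "transpose (A + A') = transpose A + transpose A'" for A A' :: "real^'n^'n"
    by (rule linear_add[OF bounded_linear.linear[OF bounded_linear_transpose]])
  ultimately show ?thesis by (simp add: sym_mats_def picard_def add_ac)
qed

text \<open>The locally uniform version of \<open>sde_step_difference\<close>: Kolmogorov's inequality for each scalar integral,
and Markov's inequality for the drift, whose supremum over time is controlled by a single integral.\<close>

lemma picard_increment_sup:
  assumes X: "admissible X" and X': "admissible X'" and e: "e > 0" and T: "0 \<le> T"
  shows "\<exists>A\<in>sets M. ennreal (e\<^sup>2) * emeasure M A \<le>
      ennreal (T * C0 + real CARD('n)^4 * (9 * C0)) * energy M T (gap X X') \<and>
    (\<forall>\<omega>\<in>space M - A. \<forall>t\<in>{0..T}. norm (picard X t \<omega> - picard X' t \<omega>) \<le> (1 + 2 * real CARD('n)^4) * e)"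
proof -
  let ?E = "energy M T (gap X X')"
  note U = jointly_measurable_gap[OF X X']
  define d where "d = (\<lambda>(i, j, k, r) t \<omega>. noise_entry X i j k r t \<omega> - noise_entry X' i j k r t \<omega>)"
  have "\<exists>A. A \<in> sets M \<and> ennreal (e\<^sup>2) * emeasure M A \<le> ennreal (9 * C0) * ?E \<and>
    (\<forall>\<omega>\<in>space M - A. \<forall>t\<in>{0..T}. \<bar>d p t \<omega>\<bar> \<le> e)" for p
  proof -
    obtain i j k r where p: "p = (i, j, k, r)" by (cases p) auto
    have Z: "L2_martingale (d p)"
      unfolding d_def p prod.case by (rule L2_martingale_diff[OF noise_entry(2)[OF X] noise_entry(2)[OF X']])
    have c: "continuous_on {0..T} (\<lambda>t. d p t \<omega>)" if "\<omega> \<in> space M - {}" for \<omega>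
      unfolding d_def p prod.case using that
      by (intro continuous_on_diff continuous_on_subset[OF noise_entry_continuous[OF X]]
         continuous_on_subset[OF noise_entry_continuous[OF X']]) auto
    obtain A where A: "A \<in> sets M" "e\<^sup>2 * prob A \<le> expectation (\<lambda>\<omega>. (d p T \<omega>)\<^sup>2)"
      "\<forall>\<omega>\<in>space M - A - {}. \<forall>t\<in>{0..T}. \<bar>d p t \<omega>\<bar> \<le> e"
      using kolmogorov_maximal_inequality[OF Z e T c] by blast
    have "ennreal (e\<^sup>2) * emeasure M A = ennreal (e\<^sup>2 * prob A)"
      by (simp add: emeasure_eq_measure ennreal_mult)
    also have "\<dots> \<le> ennreal (expectation (\<lambda>\<omega>. (d p T \<omega>)\<^sup>2))" by (intro ennreal_leI A(2))
    also have "\<dots> = (\<integral>\<^sup>+\<omega>. ennreal ((d p T \<omega>)\<^sup>2) \<partial>M)"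
      by (rule nn_integral_eq_integral[symmetric]) (use L2_martingaleD(3)[OF Z T] in auto)
    also have "\<dots> \<le> 9 * energy M T (\<lambda>s \<omega>. noise_integrand X i j k r s \<omega> - noise_integrand X' i j k r s \<omega>)"
      unfolding d_def p prod.case
      by (rule adapted_brownian.ito_integral_difference_estimate[OF entries noise_entry(1)[OF X] noise_entry(1)[OF X'] T])
    also have "\<dots> \<le> 9 * (ennreal C0 * ?E)"
      by (intro mult_left_mono energy_le_cmult[OF U C0(1)]) (use C0(3) in \<open>auto simp: gap_def noise_integrand_def\<close>)
    also have "\<dots> = ennreal (9 * C0) * ?E" using C0(1) by (simp add: ennreal_mult mult.assoc)
    finally show ?thesis using A(1,3) by blast
  qed
  then have "\<forall>p. \<exists>A. A \<in> sets M \<and> ennreal (e\<^sup>2) * emeasure M A \<le> ennreal (9 * C0) * ?E \<and>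
    (\<forall>\<omega>\<in>space M - A. \<forall>t\<in>{0..T}. \<bar>d p t \<omega>\<bar> \<le> e)" by (rule allI)
  from choice[OF this] obtain A where "\<forall>p. A p \<in> sets M \<and> ennreal (e\<^sup>2) * emeasure M (A p) \<le> ennreal (9 * C0) * ?E \<and>
    (\<forall>\<omega>\<in>space M - A p. \<forall>t\<in>{0..T}. \<bar>d p t \<omega>\<bar> \<le> e)" by (rule exE)
  then have A: "\<And>p. A p \<in> sets M" "\<And>p. ennreal (e\<^sup>2) * emeasure M (A p) \<le> ennreal (9 * C0) * ?E"
    "\<And>p \<omega> t. \<omega> \<in> space M - A p \<Longrightarrow> t \<in> {0..T} \<Longrightarrow> \<bar>d p t \<omega>\<bar> \<le> e"
    by blast+
  define Q where "Q = (\<lambda>\<omega>. ennreal (T * C0) * (\<integral>\<^sup>+s\<in>{0..T}. ennreal ((gap X X' s \<omega>)\<^sup>2) \<partial>lborel))"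
  have [measurable]: "Q \<in> borel_measurable M"
    unfolding Q_def using jointly_measurable_inner(1)[OF U, of T] by measurable
  define D where "D = {\<omega> \<in> space M. ennreal (e\<^sup>2) < Q \<omega>}"
  have D: "D \<in> sets M" unfolding D_def by measurable
  have "ennreal (e\<^sup>2) * emeasure M D = (\<integral>\<^sup>+\<omega>. ennreal (e\<^sup>2) * indicator D \<omega> \<partial>M)"
    using D by (simp add: nn_integral_cmult_indicator)
  also have "\<dots> \<le> (\<integral>\<^sup>+\<omega>. Q \<omega> \<partial>M)"
    by (intro nn_integral_mono) (auto simp: D_def indicator_def less_imp_le)
  also have "\<dots> = ennreal (T * C0) * ?E"
    unfolding Q_def energy_def by (rule nn_integral_cmult[OF jointly_measurable_inner(1)[OF U]])
  finally have eD: "ennreal (e\<^sup>2) * emeasure M D \<le> ennreal (T * C0) * ?E" .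
  define A' where "A' = D \<union> (\<Union>p\<in>UNIV. A p)"
  have A': "A' \<in> sets M" unfolding A'_def using D A(1) by auto
  have "ennreal (e\<^sup>2) * emeasure M A' \<le> ennreal (e\<^sup>2) * (emeasure M D + (\<Sum>p\<in>UNIV. emeasure M (A p)))"
    unfolding A'_def using D A(1)
    by (intro mult_left_mono order_trans[OF emeasure_subadditive] add_left_mono emeasure_subadditive_finite) auto
  also have "\<dots> = ennreal (e\<^sup>2) * emeasure M D + (\<Sum>p\<in>UNIV. ennreal (e\<^sup>2) * emeasure M (A p))"
    by (simp add: distrib_left sum_distrib_left)
  also have "\<dots> \<le> ennreal (T * C0) * ?E + (\<Sum>p\<in>(UNIV::('n \<times> 'n \<times> 'n \<times> 'n) set). ennreal (9 * C0) * ?E)"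
    by (intro add_mono eD sum_mono A(2))
  also have "\<dots> = (ennreal (T * C0) + of_nat (CARD('n \<times> 'n \<times> 'n \<times> 'n)) * ennreal (9 * C0)) * ?E"
    by (simp only: sum_constant distrib_right mult.assoc)
  also have "ennreal (T * C0) + of_nat (CARD('n \<times> 'n \<times> 'n \<times> 'n)) * ennreal (9 * C0)
      = ennreal (T * C0 + real CARD('n)^4 * (9 * C0))"
  proof -
    have "real CARD('n \<times> 'n \<times> 'n \<times> 'n) = real CARD('n)^4"
      by (simp only: card_prod of_nat_mult power4_eq_xxxx mult.assoc)
    then have "of_nat (CARD('n \<times> 'n \<times> 'n \<times> 'n)) = ennreal (real CARD('n)^4)"
      by (simp only: ennreal_of_nat_eq_real_of_nat)
    moreover have "ennreal (real CARD('n)^4) * ennreal (9 * C0) = ennreal (real CARD('n)^4 * (9 * C0))"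
      using C0(1) by (intro ennreal_mult[symmetric]) auto
    moreover have "ennreal (T * C0) + ennreal (real CARD('n)^4 * (9 * C0)) = ennreal (T * C0 + real CARD('n)^4 * (9 * C0))"
      using C0(1) T by (intro ennreal_plus[symmetric]) auto
    ultimately show ?thesis by (simp only:)
  qed
  finally have bound: "ennreal (e\<^sup>2) * emeasure M A' \<le> ennreal (T * C0 + real CARD('n)^4 * (9 * C0)) * ?E" .
  have "norm (picard X t \<omega> - picard X' t \<omega>) \<le> (1 + 2 * real CARD('n)^4) * e"
    if \<omega>: "\<omega> \<in> space M - A'" and t: "t \<in> {0..T}" for \<omega> t
  proof -
    have \<omega>M: "\<omega> \<in> space M" using \<omega> by simp
    have "ennreal ((norm (drift X t \<omega> - drift X' t \<omega>))\<^sup>2) \<le> Q \<omega>"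
      unfolding drift_def Q_def by (rule drift_difference[OF X X' \<omega>M t])
    also have "\<dots> \<le> ennreal (e\<^sup>2)" using \<omega> by (auto simp: A'_def D_def)
    finally have "(norm (drift X t \<omega> - drift X' t \<omega>))\<^sup>2 \<le> e\<^sup>2" by (simp add: ennreal_le_iff)
    then have dr: "norm (drift X t \<omega> - drift X' t \<omega>) \<le> e" by (rule power2_le_imp_le) (use e in simp)
    let ?N = "noise X t \<omega> - noise X' t \<omega>"
    have "norm ?N \<le> (real CARD('n))\<^sup>2 * ((real CARD('n))\<^sup>2 * e)"
    proof (rule norm_matrix_le_entries)
      fix i j
      have "?N $ i $ j = (\<Sum>k\<in>UNIV. \<Sum>r\<in>UNIV. d (i, j, k, r) t \<omega>)"
        by (simp add: d_def noise_def sum_subtractf)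
      also have "\<bar>\<dots>\<bar> \<le> (\<Sum>k\<in>UNIV. \<Sum>r\<in>UNIV. \<bar>d (i, j, k, r) t \<omega>\<bar>)"
        by (intro order_trans[OF sum_abs] sum_mono sum_abs)
      also have "\<dots> \<le> (\<Sum>k\<in>(UNIV::'n set). \<Sum>r\<in>(UNIV::'n set). e)"
        by (intro sum_mono A(3) t) (use \<omega> in \<open>auto simp: A'_def\<close>)
      also have "\<dots> = (real CARD('n))\<^sup>2 * e" by (simp add: power2_eq_square)
      finally show "\<bar>?N $ i $ j\<bar> \<le> (real CARD('n))\<^sup>2 * e" .
    qed
    also have "\<dots> = real CARD('n)^4 * e"
      by (simp only: power4_eq_xxxx power2_eq_square mult.assoc)
    finally have no: "norm ?N \<le> real CARD('n)^4 * e" .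
    have "transpose (noise X t \<omega>) - transpose (noise X' t \<omega>) = transpose ?N"
      by (simp add: transpose_def vec_eq_iff)
    then have "picard X t \<omega> - picard X' t \<omega> = (drift X t \<omega> - drift X' t \<omega>) + (?N + transpose ?N)"
      by (simp add: picard_def)
    then have "norm (picard X t \<omega> - picard X' t \<omega>) \<le>
        norm (drift X t \<omega> - drift X' t \<omega>) + (norm ?N + norm (transpose ?N))"
      by (simp only:) (rule order_trans[OF norm_triangle_ineq add_left_mono[OF norm_triangle_ineq]])
    also have "\<dots> \<le> e + (real CARD('n)^4 * e + real CARD('n)^4 * e)"
      using dr no by (intro add_mono) (auto simp: norm_transpose)
    finally show ?thesis by (simp add: algebra_simps)
  qed
  then show ?thesis using A' bound by blast
qed

definition picard_iterate :: "nat \<Rightarrow> real \<Rightarrow> 'w \<Rightarrow> real^'n^'n" where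
  "picard_iterate n = (picard ^^ n) (\<lambda>t \<omega>. X0)"

lemma picard_iterate_Suc: "picard_iterate (Suc n) = picard (picard_iterate n)"
  by (simp add: picard_iterate_def)

lemma admissible_picard_iterate: "admissible (picard_iterate n)"
proof (induction n)
  case 0
  show ?case by (simp add: picard_iterate_def admissible_def)
next
  case (Suc n)
  then show ?case by (simp add: picard_iterate_Suc admissible_picard)
qed

lemma picard_iterate_symmetric: "\<omega> \<in> space M \<Longrightarrow> picard_iterate n t \<omega> \<in> sym_mats"
  by (cases n) (simp_all add: picard_iterate_Suc picard_symmetric admissible_picard_iterate,
      simp add: picard_iterate_def initial)

lemma energy_picard_increment_le:
  assumes T: "0 \<le> T"
  shows "energy M T (gap (picard_iterate (Suc n)) (picard_iterate n)) \<le>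
    ennreal (T * ((gronwall_const T * T)^n / fact n))"
proof -
  let ?C = "gronwall_const T" and ?v = "\<lambda>n. mean_sq_gap (picard_iterate (Suc n)) (picard_iterate n)"
  have C: "0 \<le> ?C" using T by (rule gronwall_const_nonneg)
  have v: "?v n s \<le> ennreal ((?C * s)^n / fact n)" if "s \<in> {0..T}" for s
  proof (rule gronwall_iteration[OF C mean_sq_gap_le_1 _ that])
    fix n s assume s: "s \<in> {0..T}"
    show "?v (Suc n) s \<le> ennreal ?C * (\<integral>\<^sup>+r\<in>{0..s}. ?v n r \<partial>lborel)"
      using mean_sq_gap_step[OF admissible_picard_iterate[of "Suc n"] admissible_picard_iterate[of n]
          sde_step_picard[OF admissible_picard_iterate] sde_step_picard[OF admissible_picard_iterate] s]
      by (simp only: picard_iterate_Suc)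
  qed
  have "(\<integral>\<^sup>+s\<in>{0..T}. ?v n s \<partial>lborel) \<le> (\<integral>\<^sup>+s\<in>{0..T}. ennreal ((?C * T)^n / fact n) \<partial>lborel)"
  proof (rule nn_integral_mono)
    fix s
    show "?v n s * indicator {0..T} s \<le> ennreal ((?C * T)^n / fact n) * indicator {0..T} s"
    proof (cases "s \<in> {0..T}")
      case True
      have "(?C * s)^n / fact n \<le> (?C * T)^n / fact n"
        using True C by (intro divide_right_mono power_mono mult_left_mono) auto
      with v[OF True] show ?thesis using True by (simp add: order_trans[OF _ ennreal_leI])
    qed simp
  qed
  also have "\<dots> = ennreal ((?C * T)^n / fact n) * ennreal T"
    using T by (simp add: nn_integral_cmult_indicator)
  also have "\<dots> = ennreal (T * ((?C * T)^n / fact n))"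
    using T C by (subst ennreal_mult[symmetric]) (auto simp: mult.commute)
  finally show ?thesis by (simp only: energy_gap_eq[OF admissible_picard_iterate admissible_picard_iterate])
qed

text \<open>On a fixed interval the threshold \<open>(1/2)^n\<close> costs a factor \<open>4^n\<close> in the probability bound, which the
factorial absorbs.\<close>

lemma picard_iterates_converge_fast:
  fixes k :: nat
  shows "AE \<omega> in M. \<forall>\<^sub>F n in sequentially. \<forall>t\<in>{0..real k}.
    dist (picard_iterate n t \<omega>) (picard_iterate (Suc n) t \<omega>) \<le> (1/2)^n"
proof -
  define T where "T = real k"
  have T: "0 \<le> T" by (simp add: T_def)
  define a where "a = 1 + 2 * real CARD('n)^4"
  have a: "a > 0" unfolding a_def by (intro add_pos_nonneg) auto
  \<comment> \<open>The level at which the scalar terms must be controlled so that the matrix increment, which is at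
    most \<open>a\<close> times larger, stays below \<open>(1/2)^Suc n\<close>.\<close>
  define e where "e = (\<lambda>n::nat. (1/2)^Suc n / a)"
  have e: "e n > 0" for n using a by (simp add: e_def)
  define K where "K = T * C0 + real CARD('n)^4 * (9 * C0)"
  have K: "0 \<le> K" using T C0(1) by (simp add: K_def)
  let ?C = "gronwall_const T"
  have C: "0 \<le> ?C" using T by (rule gronwall_const_nonneg)
  have "\<exists>A. A \<in> sets M \<and> prob A \<le> 4 * a\<^sup>2 * K * T * ((4 * (?C * T))^n / fact n) \<and>
    (\<forall>\<omega>\<in>space M - A. \<forall>t\<in>{0..T}. dist (picard_iterate (Suc n) t \<omega>) (picard_iterate (Suc (Suc n)) t \<omega>) \<le> (1/2)^Suc n)" for n
  proof -
    let ?q = "T * ((?C * T)^n / fact n)"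
    have q: "0 \<le> ?q" using T C by auto
    obtain A where A: "A \<in> sets M"
      "ennreal ((e n)\<^sup>2) * emeasure M A \<le> ennreal K * energy M T (gap (picard_iterate (Suc n)) (picard_iterate n))"
      "\<forall>\<omega>\<in>space M - A. \<forall>t\<in>{0..T}. norm (picard (picard_iterate (Suc n)) t \<omega> - picard (picard_iterate n) t \<omega>) \<le> a * e n"
      using picard_increment_sup[OF admissible_picard_iterate admissible_picard_iterate e T] unfolding K_def a_def by blast
    have "ennreal ((e n)\<^sup>2 * prob A) = ennreal ((e n)\<^sup>2) * emeasure M A"
      by (simp add: emeasure_eq_measure ennreal_mult)
    also have "\<dots> \<le> ennreal K * ennreal ?q"
      by (rule order_trans[OF A(2)]) (intro mult_left_mono energy_picard_increment_le T, simp)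
    also have "\<dots> = ennreal (K * ?q)" using K q by (rule ennreal_mult[symmetric])
    finally have "ennreal ((e n)\<^sup>2 * prob A) \<le> ennreal (K * ?q)" .
    then have 1: "(e n)\<^sup>2 * prob A \<le> K * ?q"
      by (rule ennreal_le_iff[OF mult_nonneg_nonneg[OF K q], THEN iffD1])
    have "prob A = (4 * a\<^sup>2 * 4^n) * ((e n)\<^sup>2 * prob A)"
    proof -
      have "(4 * a\<^sup>2 * 4^n) * (e n)\<^sup>2 = 1"
      proof -
        have "(e n)\<^sup>2 = (1/4)^Suc n / a\<^sup>2"
          by (simp only: e_def power_divide power2_eq_square power_mult_distrib[symmetric] times_divide_times_eq) simp
        then show ?thesis using a by (simp add: power_one_over)
      qed
      then show ?thesis by (simp only: mult.assoc[symmetric] mult_1_left)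
    qed
    also have "\<dots> \<le> (4 * a\<^sup>2 * 4^n) * (K * ?q)" using 1 by (intro mult_left_mono) auto
    also have "\<dots> = 4 * a\<^sup>2 * K * T * ((4 * (?C * T))^n / fact n)"
      by (simp add: power_mult_distrib mult_ac)
    finally have 2: "prob A \<le> 4 * a\<^sup>2 * K * T * ((4 * (?C * T))^n / fact n)" .
    have "a * e n = (1/2)^Suc n" using a by (simp add: e_def)
    with A(3) have "\<forall>\<omega>\<in>space M - A. \<forall>t\<in>{0..T}.
        dist (picard_iterate (Suc n) t \<omega>) (picard_iterate (Suc (Suc n)) t \<omega>) \<le> (1/2)^Suc n"
      by (simp only: picard_iterate_Suc dist_norm norm_minus_commute)
    with A(1) 2 show ?thesis by blast
  qed
  then have "\<forall>n. \<exists>A. A \<in> sets M \<and> prob A \<le> 4 * a\<^sup>2 * K * T * ((4 * (?C * T))^n / fact n) \<and>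
    (\<forall>\<omega>\<in>space M - A. \<forall>t\<in>{0..T}. dist (picard_iterate (Suc n) t \<omega>) (picard_iterate (Suc (Suc n)) t \<omega>) \<le> (1/2)^Suc n)"
    by (rule allI)
  from choice[OF this] obtain A where "\<forall>n. A n \<in> sets M \<and> prob (A n) \<le> 4 * a\<^sup>2 * K * T * ((4 * (?C * T))^n / fact n) \<and>
    (\<forall>\<omega>\<in>space M - A n. \<forall>t\<in>{0..T}. dist (picard_iterate (Suc n) t \<omega>) (picard_iterate (Suc (Suc n)) t \<omega>) \<le> (1/2)^Suc n)"
    by (rule exE)
  then have A: "\<And>n. A n \<in> sets M" "\<And>n. prob (A n) \<le> 4 * a\<^sup>2 * K * T * ((4 * (?C * T))^n / fact n)"
    "\<And>n \<omega> t. \<omega> \<in> space M - A n \<Longrightarrow> t \<in> {0..T} \<Longrightarrow>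
      dist (picard_iterate (Suc n) t \<omega>) (picard_iterate (Suc (Suc n)) t \<omega>) \<le> (1/2)^Suc n"
    by blast+
  have "summable (\<lambda>n. 4 * a\<^sup>2 * K * T * ((4 * (?C * T))^n / fact n))"
    using summable_exp[of "4 * (?C * T)"] by (intro summable_mult) (simp add: divide_inverse mult.commute)
  then have "summable (\<lambda>n. prob (A n))"
    by (rule summable_comparison_test'[where N=0]) (use A(2) in simp)
  then have "AE \<omega> in M. \<forall>\<^sub>F n in sequentially. \<omega> \<in> space M - A n"
    by (intro borel_cantelli_AE1 A(1)) (auto simp: emeasure_eq_measure)
  then show ?thesis
  proof (rule eventually_mono)
    fix \<omega> assume "\<forall>\<^sub>F n in sequentially. \<omega> \<in> space M - A n"
    then have "\<forall>\<^sub>F n in sequentially. \<forall>t\<in>{0..real k}.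
        dist (picard_iterate (Suc n) t \<omega>) (picard_iterate (Suc (Suc n)) t \<omega>) \<le> (1/2)^Suc n"
      by (rule eventually_mono) (use A(3) in \<open>auto simp: T_def\<close>)
    then show "\<forall>\<^sub>F n in sequentially. \<forall>t\<in>{0..real k}.
        dist (picard_iterate n t \<omega>) (picard_iterate (Suc n) t \<omega>) \<le> (1/2)^n"
      by (subst (asm) eventually_sequentially_Suc)
  qed
qed

lemma closed_sym_mats: "closed (sym_mats :: (real^'n^'n) set)"
  unfolding sym_mats_def by (intro closed_Collect_eq transpose_continuous continuous_on_id)

text \<open>The limit \<open>X\<close> of the iterates is a fixed point of the Picard map, since \<open>picard X\<close> is the mean square limit
of the same iterates. Closedness of the set of symmetric matrices transfers symmetry to the limit.\<close>

theorem sde_exists: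
  "\<exists>X. admissible X \<and> (\<forall>t\<ge>0. \<forall>\<omega>\<in>space M. X t \<omega> \<in> sym_mats) \<and> sde_step M F B b g f X0 X X"
proof -
  have adm: "admissible (picard_iterate n)" for n by (rule admissible_picard_iterate)
  have "\<exists>Z N. N \<in> null_sets M \<and> (\<forall>t\<ge>0. Z t \<in> borel_measurable (F t)) \<and>
    (\<forall>\<omega>. continuous_on {0..} (\<lambda>t. Z t \<omega>)) \<and>
    (\<forall>\<omega>\<in>space M - N. \<forall>t\<ge>0. (\<lambda>n. picard_iterate n t \<omega>) \<longlonglongrightarrow> Z t \<omega>) \<and>
    (\<forall>\<omega>. \<omega> \<notin> space M - N \<longrightarrow> (\<forall>t. Z t \<omega> = X0))"
    by (rule fast_convergent_processes[of picard_iterate "{}" X0, OF null admissible_measurable(1)[OF adm] _ _ picard_iterates_converge_fast])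
      (use admissible_continuous[OF adm] in auto)
  then obtain X N where N: "N \<in> null_sets M" and X1: "\<forall>t\<ge>0. X t \<in> borel_measurable (F t)"
    "\<forall>\<omega>. continuous_on {0..} (\<lambda>t. X t \<omega>)"
    and lim: "\<forall>\<omega>\<in>space M - N. \<forall>t\<ge>0. (\<lambda>n. picard_iterate n t \<omega>) \<longlonglongrightarrow> X t \<omega>"
    and default: "\<forall>\<omega>. \<omega> \<notin> space M - N \<longrightarrow> (\<forall>t. X t \<omega> = X0)"
    by (elim exE conjE)
  have X: "admissible X" using X1 by (simp add: admissible_def)
  have sym: "X t \<omega> \<in> sym_mats" if t: "0 \<le> t" and \<omega>: "\<omega> \<in> space M" for t \<omega>
  proof (cases "\<omega> \<in> N")
    case True
    then show ?thesis using default initial by simp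
  next
    case False
    then have "(\<lambda>n. picard_iterate n t \<omega>) \<longlonglongrightarrow> X t \<omega>" using lim \<omega> t by blast
    then show ?thesis
      by (rule closed_sequentially[OF closed_sym_mats picard_iterate_symmetric[OF \<omega>]])
  qed
  have limAE: "AE \<omega> in M. \<forall>t\<ge>0. (\<lambda>n. picard_iterate n t \<omega>) \<longlonglongrightarrow> X t \<omega>"
    using AE_not_in[OF N] AE_space by eventually_elim (use lim in blast)
  have fixpoint: "AE \<omega> in M. X t \<omega> = picard X t \<omega>" if t: "0 \<le> t" for t
  proof -
    let ?g = "\<lambda>n \<omega>. ennreal ((norm (picard X t \<omega> - picard_iterate (Suc n) t \<omega>))\<^sup>2)"
    let ?h = "\<lambda>\<omega>. ennreal ((norm (picard X t \<omega> - X t \<omega>))\<^sup>2)"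
    note [measurable] = admissible_measurable(2)[OF X t] admissible_measurable(2)[OF adm t]
      admissible_measurable(2)[OF admissible_picard[OF X] t]
    have "(\<lambda>n. energy M t (gap X (picard_iterate n))) \<longlonglongrightarrow> 0"
    proof (rule energy_tendsto_0[OF jointly_measurable_gap[OF X adm] _ _ t])
      show "\<bar>gap X (picard_iterate m) s \<omega>\<bar> \<le> 1" for m s \<omega> by (simp add: gap_def)
      show "AE \<omega> in M. \<forall>s>0. (\<lambda>m. gap X (picard_iterate m) s \<omega>) \<longlonglongrightarrow> 0"
        using limAE
      proof eventually_elim
        fix \<omega> assume l: "\<forall>t\<ge>0. (\<lambda>n. picard_iterate n t \<omega>) \<longlonglongrightarrow> X t \<omega>"
        show "\<forall>s>0. (\<lambda>m. gap X (picard_iterate m) s \<omega>) \<longlonglongrightarrow> 0"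
        proof (intro allI impI)
          fix s :: real assume "s > 0"
          with l have "(\<lambda>n. picard_iterate n s \<omega>) \<longlonglongrightarrow> X s \<omega>" by simp
          then have "(\<lambda>m. min 1 (norm (X s \<omega> - picard_iterate m s \<omega>))) \<longlonglongrightarrow> min 1 (norm (X s \<omega> - X s \<omega>))"
            by (intro tendsto_min tendsto_norm tendsto_diff tendsto_const)
          then show "(\<lambda>m. gap X (picard_iterate m) s \<omega>) \<longlonglongrightarrow> 0" by (simp add: gap_def)
        qed
      qed
    qed
    then have "(\<lambda>n. ennreal (gronwall_const t) * energy M t (gap X (picard_iterate n))) \<longlonglongrightarrow> ennreal (gronwall_const t) * 0"
      by (intro ennreal_tendsto_cmult) auto
    then have l: "(\<lambda>n. ennreal (gronwall_const t) * energy M t (gap X (picard_iterate n))) \<longlonglongrightarrow> 0" by simp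
    have le: "(\<integral>\<^sup>+\<omega>. ?g n \<omega> \<partial>M) \<le> ennreal (gronwall_const t) * energy M t (gap X (picard_iterate n))" for n
      unfolding picard_iterate_Suc
      by (rule sde_step_difference[OF X adm sde_step_picard[OF X] sde_step_picard[OF adm] t])
    have "(\<integral>\<^sup>+\<omega>. ?h \<omega> \<partial>M) \<le> c" if c: "0 < c" for c
    proof (rule fatou_bound)
      show "?g k \<in> borel_measurable M" for k by measurable
      show "AE \<omega> in M. (\<lambda>k. ?g k \<omega>) \<longlonglongrightarrow> ?h \<omega>"
        using limAE
      proof eventually_elim
        fix \<omega> assume "\<forall>t\<ge>0. (\<lambda>n. picard_iterate n t \<omega>) \<longlonglongrightarrow> X t \<omega>"
        then have "(\<lambda>n. picard_iterate (Suc n) t \<omega>) \<longlonglongrightarrow> X t \<omega>" using t by (intro LIMSEQ_Suc) blast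
        then show "(\<lambda>k. ?g k \<omega>) \<longlonglongrightarrow> ?h \<omega>"
          by (intro tendsto_ennrealI tendsto_power tendsto_norm tendsto_diff tendsto_const)
      qed
      show "\<forall>\<^sub>F k in sequentially. (\<integral>\<^sup>+\<omega>. ?g k \<omega> \<partial>M) \<le> c"
        using order_tendstoD(2)[OF l c] by (rule eventually_mono) (rule order_trans[OF le less_imp_le])
    qed
    then have "(\<integral>\<^sup>+\<omega>. ?h \<omega> \<partial>M) \<le> 0" by (rule dense_ge)
    then have z: "(\<integral>\<^sup>+\<omega>. ?h \<omega> \<partial>M) = 0" by simp
    have "?h \<in> borel_measurable M" by measurable
    from nn_integral_0_iff_AE[OF this] z have "AE \<omega> in M. ?h \<omega> = 0" by simp
    then show ?thesis by (rule eventually_mono) simp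
  qed
  have eq: "AE \<omega> in M. \<forall>t\<ge>0. X t \<omega> = picard X t \<omega>"
    by (rule indistinguishable_of_continuous)
      (use admissible_continuous[OF X] admissible_continuous[OF admissible_picard[OF X]] fixpoint in auto)
  have "sde_step M F B b g f X0 X X"
  proof -
    obtain J K where J: "is_matrix_ito_integral M F (\<lambda>s \<omega>. g (X s \<omega>)) B (\<lambda>s \<omega>. f (X s \<omega>)) J"
      and K: "is_matrix_ito_integral M F (\<lambda>s \<omega>. f (X s \<omega>)) (\<lambda>s \<omega>. transpose (B s \<omega>)) (\<lambda>s \<omega>. g (X s \<omega>)) K"
      and e: "AE \<omega> in M. \<forall>t\<ge>0. set_integrable lborel {0..t} (\<lambda>s. b (X s \<omega>)) \<and>
        picard X t \<omega> = X0 + (LINT s:{0..t}|lborel. b (X s \<omega>)) + J t \<omega> + K t \<omega>"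
      using sde_step_picard[OF X] unfolding sde_step_def by (elim exE conjE)
    have "AE \<omega> in M. \<forall>t\<ge>0. set_integrable lborel {0..t} (\<lambda>s. b (X s \<omega>)) \<and>
        X t \<omega> = X0 + (LINT s:{0..t}|lborel. b (X s \<omega>)) + J t \<omega> + K t \<omega>"
      using e eq by eventually_elim simp
    with J K show ?thesis unfolding sde_step_def by blast
  qed
  with X sym show ?thesis by blast
qed

end

section \<open>Adjoining null sets\<close>

definition null_augmentation :: "'w measure \<Rightarrow> (real \<Rightarrow> 'w measure) \<Rightarrow> real \<Rightarrow> 'w measure" where
  "null_augmentation M F t = sigma (space M) (sets (F t) \<union> null_sets M)"

text \<open>The sets that differ from a member of \<open>N\<close> by a null set form a \<open>\<sigma>\<close>-algebra.\<close>

lemma null_augmentation_set_AE_eq: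
  assumes N: "subalgebra M N" and A: "A \<in> sigma_sets (space M) (sets N \<union> null_sets M)"
  shows "A \<in> sets M \<and> (\<exists>A'\<in>sets N. AE \<omega> in M. \<omega> \<in> A \<longleftrightarrow> \<omega> \<in> A')"
  using A
proof induction
  case (Basic A)
  then show ?case
  proof
    assume "A \<in> sets N"
    then show ?thesis using N by (auto simp: subalgebra_def)
  next
    assume A: "A \<in> null_sets M"
    have "AE \<omega> in M. \<omega> \<in> A \<longleftrightarrow> \<omega> \<in> {}" using AE_not_in[OF A] by simp
    then show ?thesis using A by (auto simp: null_sets_def)
  qed
next
  case Empty
  have "AE \<omega> in M. \<omega> \<in> {} \<longleftrightarrow> \<omega> \<in> {}" by simp
  then show ?case by blast
next
  case (Compl A)
  then obtain A' where A': "A' \<in> sets N" "AE \<omega> in M. \<omega> \<in> A \<longleftrightarrow> \<omega> \<in> A'" and AM: "A \<in> sets M" by blast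
  have "AE \<omega> in M. \<omega> \<in> space M - A \<longleftrightarrow> \<omega> \<in> space N - A'"
    using A'(2) N by (auto simp: subalgebra_def elim: eventually_mono)
  then show ?case using A'(1) AM by blast
next
  case (Union A)
  then have AM: "\<And>i. A i \<in> sets M" and "\<forall>i::nat. \<exists>A'. A' \<in> sets N \<and> (AE \<omega> in M. \<omega> \<in> A i \<longleftrightarrow> \<omega> \<in> A')" by blast+
  from choice[OF this(2)] obtain A' where A': "\<And>i. A' i \<in> sets N" "\<And>i. AE \<omega> in M. \<omega> \<in> A i \<longleftrightarrow> \<omega> \<in> A' i" by blast
  have "AE \<omega> in M. \<forall>i. \<omega> \<in> A i \<longleftrightarrow> \<omega> \<in> A' i" unfolding AE_all_countable using A'(2) by blast
  then have "AE \<omega> in M. \<omega> \<in> (\<Union>i. A i) \<longleftrightarrow> \<omega> \<in> (\<Union>i. A' i)" by (rule eventually_mono) blast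
  moreover have "(\<Union>i. A' i) \<in> sets N" "(\<Union>i. A i) \<in> sets M" using A'(1) AM by auto
  ultimately show ?case by blast
qed

lemma (in prob_space) indep_set_adjoin_null_sets:
  assumes N: "subalgebra M N" and ind: "indep_set (sets N) \<C>"
  shows "indep_set (sigma_sets (space M) (sets N \<union> null_sets M)) \<C>"
proof (rule indep_setI)
  show "sigma_sets (space M) (sets N \<union> null_sets M) \<subseteq> events"
    using null_augmentation_set_AE_eq[OF N] by blast
  show \<C>: "\<C> \<subseteq> events" using indep_setD_ev2[OF ind] .
  fix a c assume a: "a \<in> sigma_sets (space M) (sets N \<union> null_sets M)" and c: "c \<in> \<C>"
  obtain a' where a': "a' \<in> sets N" "AE \<omega> in M. \<omega> \<in> a \<longleftrightarrow> \<omega> \<in> a'" and aM: "a \<in> sets M"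
    using null_augmentation_set_AE_eq[OF N a] by blast
  have a'M: "a' \<in> sets M" using a'(1) N by (auto simp: subalgebra_def)
  have cM: "c \<in> sets M" using \<C> c by blast
  have "prob (a \<inter> c) = prob (a' \<inter> c)"
    using a'(2) aM a'M cM by (intro finite_measure_eq_AE) (auto elim: eventually_mono)
  also have "\<dots> = prob a' * prob c" by (rule indep_setD[OF ind a'(1) c])
  also have "prob a' = prob a"
    using a'(2) aM a'M by (intro finite_measure_eq_AE) (auto elim: eventually_mono)
  finally show "prob (a \<inter> c) = prob a * prob c" .
qed

lemma sets_null_augmentation:
  assumes "subalgebra M (F t)"
  shows "sets (null_augmentation M F t) = sigma_sets (space M) (sets (F t) \<union> null_sets M)"
proof -
  have "sets (F t) \<union> null_sets M \<subseteq> Pow (space M)"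
    using assms sets.sets_into_space unfolding subalgebra_def by (auto simp: null_sets_def)
  then show ?thesis unfolding null_augmentation_def by (rule sets_measure_of)
qed

lemma space_null_augmentation [simp]: "space (null_augmentation M F t) = space M"
  by (simp add: null_augmentation_def space_measure_of_conv)

lemma (in prob_space) filtered_null_augmentation:
  assumes F: "filtration (space M) F" and sub: "\<And>t. subalgebra M (F t)"
  shows "filtered_prob_space M (null_augmentation M F)"
proof (intro filtered_prob_space.intro filtered_prob_space_axioms.intro)
  show "prob_space M" by (rule prob_space_axioms)
  show "filtration (space M) (null_augmentation M F)"
  proof
    show "sets (null_augmentation M F s) \<subseteq> sets (null_augmentation M F t)" if "s \<le> t" for s t
      unfolding sets_null_augmentation[where F=F, OF sub]
      using filtration.sets_F_mono[OF F that] by (intro sigma_sets_mono') blast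
  qed simp
  show "subalgebra M (null_augmentation M F t)" for t
    unfolding subalgebra_def sets_null_augmentation[where F=F, OF sub]
    using null_augmentation_set_AE_eq[OF sub] by auto
qed

lemma subset_null_augmentation:
  assumes "subalgebra M (F t)"
  shows "sets (F t) \<subseteq> sets (null_augmentation M F t)" "null_sets M \<subseteq> sets (null_augmentation M F t)"
  unfolding sets_null_augmentation[where F=F and t=t, OF assms] by auto

section \<open>Brownian increments and the past\<close>

text \<open>The finitely many times and \<open>s\<close> are arranged into a grid starting at 0; up to a null set the values at
these times are sums of increments over the grid, and these are independent of the increment after \<open>s\<close>.\<close>

lemma (in prob_space) brownian_past_independent_of_increment:
  fixes U :: "real set"
  assumes W: "standard_brownian M W" and st: "0 \<le> s" "s < t"
    and U: "finite U" "U \<subseteq> {0..s}" and S: "\<And>u. S u \<in> sets borel" and T: "T \<in> sets borel"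
  shows "prob ({\<omega> \<in> space M. \<forall>u\<in>U. W u \<omega> \<in> S u} \<inter> {\<omega> \<in> space M. W t \<omega> - W s \<omega> \<in> T}) =
    prob {\<omega> \<in> space M. \<forall>u\<in>U. W u \<omega> \<in> S u} * prob {\<omega> \<in> space M. W t \<omega> - W s \<omega> \<in> T}"
proof -
  have Wm: "W u \<in> borel_measurable M" if "0 \<le> u" for u using W that by (simp add: standard_brownian_def)
  have W0: "AE \<omega> in M. W 0 \<omega> = 0" using W by (simp add: standard_brownian_def)
  define V where "V = insert 0 (insert s U)"
  have V: "finite V" "V \<subseteq> {0..s}" "0 \<in> V" "s \<in> V" using U st by (auto simp: V_def)
  define xs where "xs = sorted_list_of_set V"
  have xs: "set xs = V" "sorted_wrt (<) xs" "xs \<noteq> []"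
    using V by (auto simp: xs_def strict_sorted_list_of_set)
  define m where "m = length xs - 1"
  have len: "length xs = Suc m" using xs(3) by (simp add: m_def)
  have lt: "xs ! i < xs ! j" if "i < j" "j \<le> m" for i j
    using sorted_wrt_nth_less[OF xs(2)] that len by simp
  have inV: "xs ! i \<in> V" if "i \<le> m" for i using nth_mem[of i xs] that len xs(1) by simp
  have first: "xs ! 0 = 0"
  proof -
    obtain i where i: "i \<le> m" "xs ! i = 0" using V(3) xs(1) len by (metis in_set_conv_nth less_Suc_eq_le)
    show ?thesis using lt[of 0 i] i inV[of 0] V(2) by (cases "i = 0") auto
  qed
  have last: "xs ! m = s"
  proof -
    obtain i where i: "i \<le> m" "xs ! i = s" using V(4) xs(1) len by (metis in_set_conv_nth less_Suc_eq_le)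
    have "xs ! m \<le> s" using inV[of m] V(2) by auto
    then show ?thesis using lt[of i m] i by (cases "i = m") auto
  qed
  \<comment> \<open>The grid runs through \<open>V\<close> from 0 to \<open>s\<close> and ends with \<open>t\<close>, so the increment with index \<open>m\<close> is the
    one from \<open>s\<close> to \<open>t\<close>.\<close>
  define \<tau> where "\<tau> = (\<lambda>i. if i \<le> m then xs ! i else t)"
  have "strict_mono_on {..Suc m} \<tau>"
  proof (rule strict_mono_onI)
    fix i j assume ij: "i \<in> {..Suc m}" "j \<in> {..Suc m}" "i < j"
    show "\<tau> i < \<tau> j"
    proof (cases "j \<le> m")
      case True
      then show ?thesis using lt[of i j] ij by (simp add: \<tau>_def)
    next
      case False
      have "xs ! i \<le> s" using inV[of i] ij False V(2) by auto
      then show ?thesis using False ij st by (simp add: \<tau>_def)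
    qed
  qed
  moreover have "0 \<le> \<tau> 0" by (simp add: \<tau>_def first)
  ultimately have ind: "indep_vars (\<lambda>_. borel) (\<lambda>i \<omega>. W (\<tau> (Suc i)) \<omega> - W (\<tau> i) \<omega>) {..<Suc m}"
    using W unfolding standard_brownian_def by blast
  define \<Delta> where "\<Delta> = (\<lambda>i \<omega>. W (\<tau> (Suc i)) \<omega> - W (\<tau> i) \<omega>)"
  have ind2: "indep_var (PiM {..<m} (\<lambda>_. borel)) (\<lambda>\<omega>. restrict (\<lambda>i. \<Delta> i \<omega>) {..<m})
      (PiM {m} (\<lambda>_. borel)) (\<lambda>\<omega>. restrict (\<lambda>i. \<Delta> i \<omega>) {m})"
    unfolding \<Delta>_def by (rule indep_var_restrict[OF ind]) auto
  have "\<forall>u\<in>U. \<exists>i. i \<le> m \<and> xs ! i = u"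
    using xs(1) len unfolding V_def by (metis in_set_conv_nth insertCI less_Suc_eq_le)
  then obtain k where k: "\<And>u. u \<in> U \<Longrightarrow> k u \<le> m" "\<And>u. u \<in> U \<Longrightarrow> xs ! k u = u" by metis
  have tele: "W u \<omega> = (\<Sum>i<k u. \<Delta> i \<omega>)" if u: "u \<in> U" and "W 0 \<omega> = 0" for u \<omega>
  proof -
    have "(\<Sum>i<k u. \<Delta> i \<omega>) = W (\<tau> (k u)) \<omega> - W (\<tau> 0) \<omega>"
      unfolding \<Delta>_def by (rule sum_lessThan_telescope)
    then show ?thesis using k[OF u] that(2) by (simp add: \<tau>_def first)
  qed
  define E where "E = {x \<in> space (PiM {..<m} (\<lambda>_. borel)). \<forall>u\<in>U. (\<Sum>i<k u. x i :: real) \<in> S u}"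
  have E: "E \<in> sets (PiM {..<m} (\<lambda>_. borel))"
    unfolding E_def
  proof (rule sets.sets_Collect_finite_All[OF _ U(1)])
    fix u assume u: "u \<in> U"
    have "(\<lambda>x. \<Sum>i<k u. x i :: real) \<in> borel_measurable (PiM {..<m} (\<lambda>_. borel))"
      using k(1)[OF u] by (intro borel_measurable_sum measurable_component_singleton) auto
    from measurable_sets[OF this S[of u]]
    show "{x \<in> space (PiM {..<m} (\<lambda>_. borel)). (\<Sum>i<k u. x i :: real) \<in> S u} \<in> sets (PiM {..<m} (\<lambda>_. borel))"
      by (simp add: vimage_def Int_def conj_commute)
  qed
  define C where "C = {x \<in> space (PiM {m} (\<lambda>_. borel)). (x m :: real) \<in> T}"
  have C: "C \<in> sets (PiM {m} (\<lambda>_. borel))"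
  proof -
    have "(\<lambda>x. x m :: real) \<in> borel_measurable (PiM {m} (\<lambda>_. borel))"
      by (rule measurable_component_singleton) simp
    from measurable_sets[OF this T] show ?thesis
      by (simp add: C_def vimage_def Int_def conj_commute)
  qed
  let ?past = "\<lambda>\<omega>. restrict (\<lambda>i. \<Delta> i \<omega>) {..<m}" and ?next = "\<lambda>\<omega>. restrict (\<lambda>i. \<Delta> i \<omega>) {m}"
  let ?a = "{\<omega> \<in> space M. \<forall>u\<in>U. W u \<omega> \<in> S u}" and ?c = "{\<omega> \<in> space M. W t \<omega> - W s \<omega> \<in> T}"
  have "prob ((\<lambda>\<omega>. (?past \<omega>, ?next \<omega>)) -` (E \<times> C) \<inter> space M) = prob (?past -` E \<inter> space M) * prob (?next -` C \<inter> space M)"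
    by (rule indep_varD[OF ind2 E C])
  moreover have "(\<lambda>\<omega>. (?past \<omega>, ?next \<omega>)) -` (E \<times> C) \<inter> space M = (?past -` E \<inter> space M) \<inter> (?next -` C \<inter> space M)"
    by auto
  moreover have c: "?next -` C \<inter> space M = ?c"
    by (auto simp: C_def space_PiM PiE_def \<Delta>_def \<tau>_def last)
  moreover have a: "AE \<omega> in M. \<omega> \<in> ?past -` E \<inter> space M \<longleftrightarrow> \<omega> \<in> ?a"
    using W0 AE_space
  proof eventually_elim
    fix \<omega> assume "W 0 \<omega> = 0" and \<omega>: "\<omega> \<in> space M"
    then have "(\<Sum>i<k u. restrict (\<lambda>i. \<Delta> i \<omega>) {..<m} i) = W u \<omega>" if "u \<in> U" for u
      using k(1)[OF that] tele[OF that] by (auto intro!: sum.cong)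
    moreover have "?past \<omega> \<in> space (PiM {..<m} (\<lambda>_. borel))" by (simp add: space_PiM)
    ultimately show "\<omega> \<in> ?past -` E \<inter> space M \<longleftrightarrow> \<omega> \<in> ?a" using \<omega> by (simp add: E_def)
  qed
  moreover have aM: "?a \<in> sets M"
  proof (rule sets.sets_Collect_finite_All[OF _ U(1)])
    fix u assume "u \<in> U"
    then have "W u \<in> borel_measurable M" using U(2) by (intro Wm) auto
    from measurable_sets[OF this S[of u]] show "{\<omega> \<in> space M. W u \<omega> \<in> S u} \<in> sets M"
      by (simp add: vimage_def Int_def conj_commute)
  qed
  moreover have cM: "?c \<in> sets M" and pM: "?past -` E \<inter> space M \<in> sets M"
    using measurable_sets[OF indep_var_rv2[OF ind2] C] measurable_sets[OF indep_var_rv1[OF ind2] E] c by auto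
  moreover have "prob (?past -` E \<inter> space M) = prob ?a"
    using a pM aM by (rule finite_measure_eq_AE)
  moreover have "prob ((?past -` E \<inter> space M) \<inter> ?c) = prob (?a \<inter> ?c)"
    using a pM aM cM by (intro finite_measure_eq_AE) (auto elim: eventually_mono)
  ultimately show ?thesis by simp
qed

lemma sets_PiM_cylinder:
  assumes "finite U" "U \<subseteq> I" "\<And>u. S u \<in> sets borel"
  shows "{x \<in> space (PiM I (\<lambda>_. borel :: real measure)). \<forall>u\<in>U. x u \<in> S u} \<in> sets (PiM I (\<lambda>_. borel))"
proof (rule sets.sets_Collect_finite_All[OF _ assms(1)])
  fix u assume "u \<in> U"
  then have "(\<lambda>x. x u :: real) \<in> borel_measurable (PiM I (\<lambda>_. borel))"
    using assms(2) by (intro measurable_component_singleton) auto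
  from measurable_sets[OF this assms(3)[of u]]
  show "{x \<in> space (PiM I (\<lambda>_. borel :: real measure)). x u \<in> S u} \<in> sets (PiM I (\<lambda>_. borel))"
    by (simp add: vimage_def Int_def conj_commute)
qed

text \<open>Events depending on the entries of \<open>B\<close> at finitely many times up to \<open>s\<close>. They are closed under
intersection, unlike the preimages that generate the natural filtration.\<close>

definition cylinder_sets :: "'w measure \<Rightarrow> (real \<Rightarrow> 'w \<Rightarrow> real^'n^'n) \<Rightarrow> real \<Rightarrow> 'w set set" where
  "cylinder_sets M B s = {{\<omega> \<in> space M. \<forall>i j. \<forall>u\<in>U. B u \<omega> $ i $ j \<in> S i j u} | U S.
     finite U \<and> U \<subseteq> {0..s} \<and> (\<forall>i j u. S i j u \<in> sets (borel :: real measure))}"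

lemma cylinder_setsI:
  assumes "finite U" "U \<subseteq> {0..s}" "\<forall>i j u. S i j u \<in> sets (borel :: real measure)"
  shows "{\<omega> \<in> space M. \<forall>i j. \<forall>u\<in>U. B u \<omega> $ i $ j \<in> S i j u} \<in> cylinder_sets M B s"
  unfolding cylinder_sets_def
  by (rule CollectI, rule exI[of _ U], rule exI[of _ S]) (simp add: assms)

lemma Int_stable_cylinder_sets: "Int_stable (cylinder_sets M B s)"
proof (rule Int_stableI)
  fix a a' assume "a \<in> cylinder_sets M B s" "a' \<in> cylinder_sets M B s"
  then obtain U S U' S' where a: "a = {\<omega> \<in> space M. \<forall>i j. \<forall>u\<in>U. B u \<omega> $ i $ j \<in> S i j u}"
      "finite U" "U \<subseteq> {0..s}" "\<forall>i j u. S i j u \<in> sets (borel :: real measure)"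
    and a': "a' = {\<omega> \<in> space M. \<forall>i j. \<forall>u\<in>U'. B u \<omega> $ i $ j \<in> S' i j u}"
      "finite U'" "U' \<subseteq> {0..s}" "\<forall>i j u. S' i j u \<in> sets (borel :: real measure)"
    unfolding cylinder_sets_def by blast
  let ?S = "\<lambda>i j u. (if u \<in> U then S i j u else UNIV) \<inter> (if u \<in> U' then S' i j u else UNIV)"
  have "a \<inter> a' = {\<omega> \<in> space M. \<forall>i j. \<forall>u\<in>U \<union> U'. B u \<omega> $ i $ j \<in> ?S i j u}"
    unfolding a(1) a'(1) by auto
  also have "\<dots> \<in> cylinder_sets M B s"
  proof (rule cylinder_setsI)
    show "finite (U \<union> U')" using a(2) a'(2) by (rule finite_UnI)
    show "U \<union> U' \<subseteq> {0..s}" using a(3) a'(3) by (rule Un_least)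
    show "\<forall>i j u. ?S i j u \<in> sets (borel :: real measure)"
      by (intro allI sets.Int) (simp_all add: a(4) a'(4))
  qed
  finally show "a \<inter> a' \<in> cylinder_sets M B s" .
qed

text \<open>A cylinder event is an intersection of events for the single entries, which are independent. Within
the entry \<open>(k, r)\<close> the increment splits off, and the other entries are not affected by it.\<close>

lemma (in prob_space) cylinder_independent_of_increment:
  fixes B :: "real \<Rightarrow> 'a \<Rightarrow> real^'n^'n"
  assumes B: "matrix_brownian M B" and st: "0 \<le> s" "s < t"
  shows "indep_set (cylinder_sets M B s) {(\<lambda>\<omega>. B t \<omega> $ k $ r - B s \<omega> $ k $ r) -` T \<inter> space M | T. T \<in> sets borel}"
proof -
  let ?path = "\<lambda>p \<omega>. restrict (\<lambda>t. B t \<omega> $ fst p $ snd p) {0..}"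
  let ?P = "PiM {0::real..} (\<lambda>_. borel :: real measure)"
  have std: "standard_brownian M (\<lambda>t \<omega>. B t \<omega> $ i $ j)" for i j using B by (simp add: matrix_brownian_def)
  have m: "(\<lambda>\<omega>. B u \<omega> $ i $ j) \<in> borel_measurable M" if "0 \<le> u" for u i j
    using std[of i j] that by (simp add: standard_brownian_def)
  have ind: "indep_vars (\<lambda>_. ?P) ?path UNIV"
    using B unfolding matrix_brownian_def case_prod_beta' by blast
  let ?D = "\<lambda>\<omega>. B t \<omega> $ k $ r - B s \<omega> $ k $ r"
  have Dm: "?D \<in> borel_measurable M" using m[of t k r] m[of s k r] st by simp
  have cyl: "{\<omega> \<in> space M. \<forall>i j. \<forall>u\<in>U. B u \<omega> $ i $ j \<in> S i j u} \<in> events"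
    if "finite U" "U \<subseteq> {0..s}" "\<forall>i j u. S i j u \<in> sets (borel :: real measure)" for U S
  proof -
    have "{\<omega> \<in> space M. \<forall>u\<in>U. B u \<omega> $ i $ j \<in> S i j u} \<in> events" for i j
    proof (rule sets.sets_Collect_finite_All[OF _ that(1)])
      fix u assume "u \<in> U"
      then have "(\<lambda>\<omega>. B u \<omega> $ i $ j) \<in> borel_measurable M" using that(2) by (intro m) auto
      from measurable_sets[OF this that(3)[rule_format, of i j u]]
      show "{\<omega> \<in> space M. B u \<omega> $ i $ j \<in> S i j u} \<in> events" by (simp add: vimage_def Int_def conj_commute)
    qed
    then show ?thesis by (intro sets.sets_Collect_countable_All) auto
  qed
  show ?thesis
  proof (rule indep_setI)
    show "cylinder_sets M B s \<subseteq> events" unfolding cylinder_sets_def using cyl by blast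
    show "{?D -` T \<inter> space M | T. T \<in> sets borel} \<subseteq> events" using measurable_sets[OF Dm] by blast
    fix a c assume "a \<in> cylinder_sets M B s" and "c \<in> {?D -` T \<inter> space M | T. T \<in> sets borel}"
    then obtain U S T where a: "a = {\<omega> \<in> space M. \<forall>i j. \<forall>u\<in>U. B u \<omega> $ i $ j \<in> S i j u}"
      and U: "finite U" "U \<subseteq> {0..s}" and S: "\<And>i j u. S i j u \<in> sets (borel :: real measure)"
      and c: "c = ?D -` T \<inter> space M" and T: "T \<in> sets borel"
      unfolding cylinder_sets_def by blast
    have U0: "U \<subseteq> {0..}" using U(2) by auto
    define E where "E = (\<lambda>p. {x \<in> space ?P. \<forall>u\<in>U. x u \<in> S (fst p) (snd p) u})"
    define C where "C = {x \<in> space ?P. x t - x s \<in> T}"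
    have E: "E p \<in> sets ?P" for p unfolding E_def by (rule sets_PiM_cylinder[OF U(1) U0 S])
    have C: "C \<in> sets ?P"
    proof -
      have "(\<lambda>x. x t - x s :: real) \<in> borel_measurable ?P"
        using st by (intro borel_measurable_diff measurable_component_singleton) auto
      from measurable_sets[OF this T] show ?thesis by (simp add: C_def vimage_def Int_def conj_commute)
    qed
    \<comment> \<open>The event on the increment is charged to the path of its own entry.\<close>
    define E' where "E' = E((k, r) := E (k, r) \<inter> C)"
    have E': "E' p \<in> sets ?P" for p using E C by (simp add: E'_def)
    have pE: "?path p -` E p \<inter> space M = {\<omega> \<in> space M. \<forall>u\<in>U. B u \<omega> $ fst p $ snd p \<in> S (fst p) (snd p) u}" for p
      using U0 by (auto simp: E_def space_PiM)
    have pC: "?path (k, r) -` C \<inter> space M = c" using st by (auto simp: C_def c space_PiM)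
    have prod: "prob (\<Inter>p\<in>UNIV. ?path p -` X p \<inter> space M) = (\<Prod>p\<in>UNIV. prob (?path p -` X p \<inter> space M))"
      if "\<And>p. X p \<in> sets ?P" for X
      by (rule indep_varsD_finite[OF ind]) (use that in auto)
    have a_eq: "a = (\<Inter>p\<in>UNIV. ?path p -` E p \<inter> space M)" unfolding pE a by auto
    have ac_eq: "a \<inter> c = (\<Inter>p\<in>UNIV. ?path p -` E' p \<inter> space M)"
      unfolding a_eq pC[symmetric] E'_def by (auto split: if_splits)
    let ?rest = "\<Prod>p\<in>UNIV - {(k, r)}. prob (?path p -` E p \<inter> space M)"
    have "prob (a \<inter> c) = prob (?path (k, r) -` E' (k, r) \<inter> space M) * (\<Prod>p\<in>UNIV - {(k, r)}. prob (?path p -` E' p \<inter> space M))"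
      unfolding ac_eq prod[OF E'] by (rule prod.remove) auto
    also have "(\<Prod>p\<in>UNIV - {(k, r)}. prob (?path p -` E' p \<inter> space M)) = ?rest"
      by (rule prod.cong) (auto simp: E'_def)
    also have "?path (k, r) -` E' (k, r) \<inter> space M = (?path (k, r) -` E (k, r) \<inter> space M) \<inter> c"
      unfolding pC[symmetric] by (auto simp: E'_def)
    also have "prob ((?path (k, r) -` E (k, r) \<inter> space M) \<inter> c) = prob (?path (k, r) -` E (k, r) \<inter> space M) * prob c"
      using brownian_past_independent_of_increment[OF std[of k r] st U S[of k r] T] unfolding pE c
      by (simp add: vimage_def Int_def conj_commute)
    finally have "prob (a \<inter> c) = (prob (?path (k, r) -` E (k, r) \<inter> space M) * ?rest) * prob c"
      by (simp only: mult_ac)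
    also have "prob (?path (k, r) -` E (k, r) \<inter> space M) * ?rest = prob a"
      unfolding a_eq prod[OF E] by (rule prod.remove[symmetric]) auto
    finally show "prob (a \<inter> c) = prob a * prob c" .
  qed
qed

lemma (in prob_space) adapted_brownian_null_augmentation:
  assumes F: "filtration (space M) F" and sub: "\<And>t. subalgebra M (F t)"
    and W: "standard_brownian M W" and adapted: "\<And>t. 0 \<le> t \<Longrightarrow> W t \<in> borel_measurable (F t)"
    and ind: "\<And>s t. 0 \<le> s \<Longrightarrow> s < t \<Longrightarrow>
      indep_set (sets (F s)) (sets (vimage_algebra (space M) (\<lambda>\<omega>. W t \<omega> - W s \<omega>) borel))"
  shows "adapted_brownian M (null_augmentation M F) W"
proof (intro adapted_brownian.intro filtered_null_augmentation[OF F sub] adapted_brownian_axioms.intro)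
  fix t :: real assume t: "0 \<le> t"
  show "W t \<in> borel_measurable (null_augmentation M F t)"
    using adapted[OF t] subset_null_augmentation(1)[where F=F and t=t, OF sub] sub[of t]
    by (auto simp: measurable_def subalgebra_def)
next
  fix s t :: real assume st: "0 \<le> s" "s < t"
  show "distributed M lborel (\<lambda>\<omega>. W t \<omega> - W s \<omega>) (normal_density 0 (sqrt (t - s)))"
    using W st by (simp add: standard_brownian_def)
  show "indep_set (sets (null_augmentation M F s)) (sets (vimage_algebra (space M) (\<lambda>\<omega>. W t \<omega> - W s \<omega>) borel))"
    unfolding sets_null_augmentation[where F=F and t=s, OF sub]
    by (rule indep_set_adjoin_null_sets[OF sub ind[OF st]])
next
  show "AE \<omega> in M. continuous_on {0..} (\<lambda>t. W t \<omega>)" using W by (simp add: standard_brownian_def)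
qed

text \<open>The part of the generator of \<open>brownian_augmentation\<close> that stems from \<open>B\<close>.\<close>

definition natural_generator :: "'w measure \<Rightarrow> (real \<Rightarrow> 'w \<Rightarrow> real^'n^'n) \<Rightarrow> real \<Rightarrow> 'w set set" where
  "natural_generator M B t = {B s -` S \<inter> space M | s S. s \<in> {0..t} \<and> S \<in> sets borel}"

definition natural_filtration :: "'w measure \<Rightarrow> (real \<Rightarrow> 'w \<Rightarrow> real^'n^'n) \<Rightarrow> real \<Rightarrow> 'w measure" where
  "natural_filtration M B t = sigma (space M) (natural_generator M B t)"

lemma sets_natural_filtration: "sets (natural_filtration M B t) = sigma_sets (space M) (natural_generator M B t)"
  unfolding natural_filtration_def by (rule sets_measure_of) (auto simp: natural_generator_def)

lemma space_natural_filtration [simp]: "space (natural_filtration M B t) = space M"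
  by (simp add: natural_filtration_def space_measure_of_conv)

lemma brownian_augmentation_eq: "brownian_augmentation M B = null_augmentation M (natural_filtration M B)"
proof
  fix t
  have null: "null_sets M \<subseteq> Pow (space M)" using sets.sets_into_space by (auto simp: null_sets_def)
  have gen: "natural_generator M B t \<subseteq> Pow (space M)" by (auto simp: natural_generator_def)
  let ?S = "sigma_sets (space M)"
  have "?S (natural_generator M B t \<union> null_sets M) = ?S (?S (natural_generator M B t) \<union> null_sets M)"
  proof (rule antisym)
    show "?S (natural_generator M B t \<union> null_sets M) \<subseteq> ?S (?S (natural_generator M B t) \<union> null_sets M)"
      by (intro sigma_sets_mono') (auto intro: sigma_sets.Basic)
    have "?S (natural_generator M B t) \<subseteq> ?S (natural_generator M B t \<union> null_sets M)"
      by (rule sigma_sets_mono') auto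
    then show "?S (?S (natural_generator M B t) \<union> null_sets M) \<subseteq> ?S (natural_generator M B t \<union> null_sets M)"
      by (intro sigma_sets_mono) (auto intro: sigma_sets.Basic)
  qed
  then have "sigma (space M) (natural_generator M B t \<union> null_sets M) =
      sigma (space M) (?S (natural_generator M B t) \<union> null_sets M)"
    using null gen sigma_sets_into_sp[OF gen] by (intro sigma_eqI Un_least subsetI PowI) blast+
  then show "brownian_augmentation M B t = null_augmentation M (natural_filtration M B) t"
    unfolding brownian_augmentation_def null_augmentation_def sets_natural_filtration natural_generator_def .
qed

lemma matrix_brownian_measurable:
  assumes "matrix_brownian M B" "0 \<le> t" shows "B t \<in> borel_measurable M"
  using assms by (intro matrix_measurableI) (simp add: matrix_brownian_def standard_brownian_def)

lemma subalgebra_natural_filtration: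
  assumes "matrix_brownian M B" shows "subalgebra M (natural_filtration M B t)"
proof -
  have "natural_generator M B t \<subseteq> sets M"
    using measurable_sets[OF matrix_brownian_measurable[OF assms]] by (auto simp: natural_generator_def)
  then show ?thesis
    unfolding subalgebra_def sets_natural_filtration by (auto dest: sets.sigma_sets_subset)
qed

lemma filtration_natural_filtration: "filtration (space M) (natural_filtration M B)"
proof
  show "sets (natural_filtration M B s) \<subseteq> sets (natural_filtration M B t)" if "s \<le> t" for s t
    unfolding sets_natural_filtration using that
    by (intro sigma_sets_mono') (auto simp: natural_generator_def intro: order_trans)
qed simp

lemma natural_filtration_measurable:
  assumes "0 \<le> s" "s \<le> t" shows "B s \<in> borel_measurable (natural_filtration M B t)"
  by (rule measurableI) (use assms in \<open>auto simp: sets_natural_filtration natural_generator_def intro!: sigma_sets.Basic\<close>)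

lemma natural_generator_subset_cylinders:
  fixes B :: "real \<Rightarrow> 'w \<Rightarrow> real^'n^'n"
  shows "natural_generator M B s \<subseteq> sigma_sets (space M) (cylinder_sets M B s)"
proof
  fix a assume "a \<in> natural_generator M B s"
  then obtain u S where a: "a = B u -` S \<inter> space M" and u: "u \<in> {0..s}" and S: "S \<in> sets borel"
    unfolding natural_generator_def by blast
  let ?N = "sigma (space M) (cylinder_sets M B s)"
  have sets: "sets ?N = sigma_sets (space M) (cylinder_sets M B s)"
    by (rule sets_measure_of) (auto simp: cylinder_sets_def)
  have space: "space ?N = space M" by (simp add: space_measure_of_conv)
  have "B u \<in> borel_measurable ?N"
  proof (rule matrix_measurableI, rule measurableI)
    fix i j :: 'n and T :: "real set" assume T: "T \<in> sets borel"
    let ?S = "\<lambda>i' j' (u'::real). if i' = i \<and> j' = j then T else UNIV"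
    have "(\<lambda>\<omega>. B u \<omega> $ i $ j) -` T \<inter> space ?N = {\<omega> \<in> space M. \<forall>i j. \<forall>u\<in>{u}. B u \<omega> $ i $ j \<in> ?S i j u}"
      unfolding space by auto
    also have "\<dots> \<in> cylinder_sets M B s"
      by (rule cylinder_setsI) (use u T in auto)
    finally show "(\<lambda>\<omega>. B u \<omega> $ i $ j) -` T \<inter> space ?N \<in> sets ?N"
      unfolding sets by (rule sigma_sets.Basic)
  qed simp
  from measurable_sets[OF this S] show "a \<in> sigma_sets (space M) (cylinder_sets M B s)"
    unfolding a sets space .
qed

lemma (in prob_space) indep_set_mono:
  assumes "indep_set A C" "A' \<subseteq> A" "C' \<subseteq> C" shows "indep_set A' C'"
  using assms unfolding indep_sets2_eq by blast

lemma (in prob_space) adapted_brownian_augmentation: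
  assumes B: "matrix_brownian M B"
  shows "adapted_brownian M (brownian_augmentation M B) (\<lambda>t \<omega>. B t \<omega> $ k $ r)"
  unfolding brownian_augmentation_eq
proof (rule adapted_brownian_null_augmentation[OF filtration_natural_filtration subalgebra_natural_filtration[OF B]])
  show "standard_brownian M (\<lambda>t \<omega>. B t \<omega> $ k $ r)" using B by (simp add: matrix_brownian_def)
  show "(\<lambda>\<omega>. B t \<omega> $ k $ r) \<in> borel_measurable (natural_filtration M B t)" if "0 \<le> t" for t
    by (rule matrix_entry_measurable[OF natural_filtration_measurable]) (use that in auto)
  fix s t :: real assume st: "0 \<le> s" "s < t"
  let ?D = "\<lambda>\<omega>. B t \<omega> $ k $ r - B s \<omega> $ k $ r"
  have "indep_set (sigma_sets (space M) (cylinder_sets M B s)) (sigma_sets (space M) {?D -` T \<inter> space M | T. T \<in> sets borel})"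
  proof (rule indep_set_sigma_sets[OF cylinder_independent_of_increment[OF B st] Int_stable_cylinder_sets])
    show "Int_stable {?D -` T \<inter> space M | T. T \<in> sets borel}"
    proof (rule Int_stableI)
      fix a a' assume "a \<in> {?D -` T \<inter> space M | T. T \<in> sets borel}" "a' \<in> {?D -` T \<inter> space M | T. T \<in> sets borel}"
      then obtain T T' where T: "a = ?D -` T \<inter> space M" "a' = ?D -` T' \<inter> space M" "T \<in> sets borel" "T' \<in> sets borel"
        by blast
      then have "a \<inter> a' = ?D -` (T \<inter> T') \<inter> space M" "T \<inter> T' \<in> sets borel" by auto
      then show "a \<inter> a' \<in> {?D -` T \<inter> space M | T. T \<in> sets borel}" by blast
    qed
  qed
  then show "indep_set (sets (natural_filtration M B s)) (sets (vimage_algebra (space M) ?D borel))"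
    by (rule indep_set_mono)
      (simp_all add: sets_natural_filtration sets_vimage_algebra sigma_sets_mono natural_generator_subset_cylinders)
qed

lemma (in prob_space) adapted_brownian_of_brownian_filtration:
  fixes B :: "real \<Rightarrow> 'a \<Rightarrow> real^'n^'n"
  assumes B: "matrix_brownian M B" and F: "brownian_filtration M F B"
  shows "adapted_brownian M (null_augmentation M F) (\<lambda>t \<omega>. B t \<omega> $ k $ r)"
proof (rule adapted_brownian_null_augmentation)
  show "filtration (space M) F" "subalgebra M (F t)" for t using F by (auto simp: brownian_filtration_def)
  show "standard_brownian M (\<lambda>t \<omega>. B t \<omega> $ k $ r)" using B by (simp add: matrix_brownian_def)
  show "(\<lambda>\<omega>. B t \<omega> $ k $ r) \<in> borel_measurable (F t)" if "0 \<le> t" for t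
    by (rule matrix_entry_measurable) (use F that in \<open>simp add: brownian_filtration_def\<close>)
  fix s t :: real assume st: "0 \<le> s" "s < t"
  have "indep_set (sets (F s)) (sets (vimage_algebra (space M) (\<lambda>\<omega>. B t \<omega> - B s \<omega>) borel))"
    using F st by (simp add: brownian_filtration_def)
  then show "indep_set (sets (F s)) (sets (vimage_algebra (space M) (\<lambda>\<omega>. B t \<omega> $ k $ r - B s \<omega> $ k $ r) borel))"
  proof (rule indep_set_mono[OF _ subset_refl])
    have entry: "(\<lambda>A::real^'n^'n. A $ k $ r) \<in> borel_measurable borel"
      by (rule matrix_entry_measurable) simp
    have "{(\<lambda>\<omega>. B t \<omega> $ k $ r - B s \<omega> $ k $ r) -` T \<inter> space M |T. T \<in> sets borel} \<subseteq>
        {(\<lambda>\<omega>. B t \<omega> - B s \<omega>) -` T \<inter> space M |T. T \<in> sets borel}"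
    proof
      fix a assume "a \<in> {(\<lambda>\<omega>. B t \<omega> $ k $ r - B s \<omega> $ k $ r) -` T \<inter> space M |T. T \<in> sets borel}"
      then obtain T where a: "a = (\<lambda>\<omega>. B t \<omega> $ k $ r - B s \<omega> $ k $ r) -` T \<inter> space M" and T: "T \<in> sets borel" by blast
      have "a = (\<lambda>\<omega>. B t \<omega> - B s \<omega>) -` ((\<lambda>A. A $ k $ r) -` T) \<inter> space M" unfolding a by auto
      moreover have "(\<lambda>A::real^'n^'n. A $ k $ r) -` T \<in> sets borel" using measurable_sets[OF entry T] by simp
      ultimately show "a \<in> {(\<lambda>\<omega>. B t \<omega> - B s \<omega>) -` T \<inter> space M |T. T \<in> sets borel}" by blast
    qed
    then show "sets (vimage_algebra (space M) (\<lambda>\<omega>. B t \<omega> $ k $ r - B s \<omega> $ k $ r) borel) \<subseteq>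
        sets (vimage_algebra (space M) (\<lambda>\<omega>. B t \<omega> - B s \<omega>) borel)"
      unfolding sets_vimage_algebra by (rule sigma_sets_mono')
  qed
qed

section \<open>Change of filtration and of coefficients\<close>

text \<open>Elementary integrands for a filtration are elementary integrands for every larger one, and the values
of the integrand matter only at nonnegative times on the underlying space.\<close>

lemma is_ito_integral_transfer:
  assumes Y: "is_ito_integral M F W H Y"
    and sub: "\<And>t. 0 \<le> t \<Longrightarrow> sets (F t) \<subseteq> sets (F' t)" and space: "\<And>t. space (F t) = space M" "\<And>t. space (F' t) = space M"
    and eq: "\<And>s \<omega>. 0 \<le> s \<Longrightarrow> \<omega> \<in> space M \<Longrightarrow> H s \<omega> = H' s \<omega>"
  shows "is_ito_integral M F' W H' Y"
proof -
  have F': "h \<in> borel_measurable (F' t)" if "h \<in> borel_measurable (F t)" "0 \<le> t" for h :: "'a \<Rightarrow> real" and t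
    using that sub[OF that(2)] space by (auto simp: measurable_def)
  have S: "simple_integrand M F' n \<tau> \<xi>" if "simple_integrand M F n \<tau> \<xi>" for n \<tau> \<xi>
    using that F'[OF simple_integrandD(3)[OF that] simple_integrandD(1)[OF that]]
    by (auto simp: simple_integrand_def)
  have nn: "(\<integral>\<^sup>+\<omega>. (\<integral>\<^sup>+s\<in>{0..T}. ennreal ((H s \<omega> - Z s \<omega>)\<^sup>2) \<partial>lborel) \<partial>M) =
      (\<integral>\<^sup>+\<omega>. (\<integral>\<^sup>+s\<in>{0..T}. ennreal ((H' s \<omega> - Z s \<omega>)\<^sup>2) \<partial>lborel) \<partial>M)" for Z T
    by (intro nn_integral_cong) (auto simp: indicator_def eq)
  have 1: "(\<lambda>(s, \<omega>). H' s \<omega>) \<in> borel_measurable (restrict_space borel {0..} \<Otimes>\<^sub>M M)"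
  proof -
    have "(\<lambda>(s, \<omega>). H s \<omega>) \<in> borel_measurable (restrict_space borel {0..} \<Otimes>\<^sub>M M) \<longleftrightarrow>
        (\<lambda>(s, \<omega>). H' s \<omega>) \<in> borel_measurable (restrict_space borel {0..} \<Otimes>\<^sub>M M)"
      by (rule measurable_cong) (auto simp: space_pair_measure space_restrict_space eq)
    then show ?thesis using Y by (simp add: is_ito_integral_def)
  qed
  have 2: "H' s \<in> borel_measurable (F' s)" if s: "0 \<le> s" for s
  proof -
    have "H s \<in> borel_measurable (F' s)" using Y s by (intro F') (auto simp: is_ito_integral_def)
    moreover have "H s \<in> borel_measurable (F' s) \<longleftrightarrow> H' s \<in> borel_measurable (F' s)"
      by (rule measurable_cong) (use s eq space in auto)
    ultimately show ?thesis by blast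
  qed
  have 3: "(\<integral>\<^sup>+\<omega>. (\<integral>\<^sup>+s\<in>{0..T}. ennreal ((H' s \<omega>)\<^sup>2) \<partial>lborel) \<partial>M) < \<infinity>" if "0 \<le> T" for T
  proof -
    have "(\<integral>\<^sup>+\<omega>. (\<integral>\<^sup>+s\<in>{0..T}. ennreal ((H s \<omega>)\<^sup>2) \<partial>lborel) \<partial>M) < \<infinity>"
      using Y that by (simp add: is_ito_integral_def)
    then show ?thesis using nn[where T=T and Z="\<lambda>_ _. 0"] by simp
  qed
  show ?thesis
    unfolding is_ito_integral_def
  proof (intro conjI allI impI 1 2 3)
    show "Y t \<in> borel_measurable M" if "0 \<le> t" for t using Y that by (rule is_ito_integral_measurable)
    show "\<forall>\<omega>\<in>space M. continuous_on {0..} (\<lambda>t. Y t \<omega>)" using Y by (simp add: is_ito_integral_def)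
    fix T :: real assume "0 \<le> T"
    then obtain n \<tau> \<xi> where "\<forall>m::nat. simple_integrand M F (n m) (\<tau> m) (\<xi> m)"
      "(\<lambda>m. \<integral>\<^sup>+\<omega>. (\<integral>\<^sup>+s\<in>{0..T}. ennreal ((H s \<omega> - simple_process (n m) (\<tau> m) (\<xi> m) s \<omega>)\<^sup>2) \<partial>lborel) \<partial>M) \<longlonglongrightarrow> 0"
      "(\<lambda>m. \<integral>\<^sup>+\<omega>. ennreal ((Y T \<omega> - simple_ito W (n m) (\<tau> m) (\<xi> m) T \<omega>)\<^sup>2) \<partial>M) \<longlonglongrightarrow> 0"
      using Y unfolding is_ito_integral_def by blast
    then show "\<exists>n \<tau> \<xi>. (\<forall>m::nat. simple_integrand M F' (n m) (\<tau> m) (\<xi> m)) \<and>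
      (\<lambda>m. \<integral>\<^sup>+\<omega>. (\<integral>\<^sup>+s\<in>{0..T}. ennreal ((H' s \<omega> - simple_process (n m) (\<tau> m) (\<xi> m) s \<omega>)\<^sup>2) \<partial>lborel) \<partial>M) \<longlonglongrightarrow> 0 \<and>
      (\<lambda>m. \<integral>\<^sup>+\<omega>. ennreal ((Y T \<omega> - simple_ito W (n m) (\<tau> m) (\<xi> m) T \<omega>)\<^sup>2) \<partial>M) \<longlonglongrightarrow> 0"
      unfolding nn using S by (intro exI[of _ n] exI[of _ \<tau>] exI[of _ \<xi>]) auto
  qed
qed

lemma is_matrix_ito_integral_transfer:
  assumes J: "is_matrix_ito_integral M F A W C J"
    and sub: "\<And>t. 0 \<le> t \<Longrightarrow> sets (F t) \<subseteq> sets (F' t)" and space: "\<And>t. space (F t) = space M" "\<And>t. space (F' t) = space M"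
    and eq: "\<And>s \<omega>. 0 \<le> s \<Longrightarrow> \<omega> \<in> space M \<Longrightarrow> A s \<omega> = A' s \<omega>" "\<And>s \<omega>. 0 \<le> s \<Longrightarrow> \<omega> \<in> space M \<Longrightarrow> C s \<omega> = C' s \<omega>"
  shows "is_matrix_ito_integral M F' A' W C' J"
proof -
  obtain Y where Y: "\<forall>i j k r. is_ito_integral M F (\<lambda>s \<omega>. W s \<omega> $ k $ r) (\<lambda>s \<omega>. A s \<omega> $ i $ k * C s \<omega> $ r $ j) (Y i j k r)"
    and J: "\<forall>t\<ge>0. \<forall>\<omega>\<in>space M. \<forall>i j. J t \<omega> $ i $ j = (\<Sum>k\<in>UNIV. \<Sum>r\<in>UNIV. Y i j k r t \<omega>)"
    by (rule is_matrix_ito_integralE[OF J])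
  have "is_ito_integral M F' (\<lambda>s \<omega>. W s \<omega> $ k $ r) (\<lambda>s \<omega>. A' s \<omega> $ i $ k * C' s \<omega> $ r $ j) (Y i j k r)" for i j k r
    by (rule is_ito_integral_transfer[OF Y[rule_format, of k r i j] sub space]) (simp_all add: eq)
  then show ?thesis unfolding is_matrix_ito_integral_def using J by (intro exI[of _ Y] conjI allI) auto
qed

lemma sde_step_transfer:
  assumes P: "sde_step M F B b g f X0 X P"
    and sub: "\<And>t. 0 \<le> t \<Longrightarrow> sets (F t) \<subseteq> sets (F' t)" and space: "\<And>t. space (F t) = space M" "\<And>t. space (F' t) = space M"
    and eq: "\<And>s \<omega>. 0 \<le> s \<Longrightarrow> \<omega> \<in> space M \<Longrightarrow> b (X s \<omega>) = b' (X s \<omega>)"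
      "\<And>s \<omega>. 0 \<le> s \<Longrightarrow> \<omega> \<in> space M \<Longrightarrow> g (X s \<omega>) = g' (X s \<omega>)"
      "\<And>s \<omega>. 0 \<le> s \<Longrightarrow> \<omega> \<in> space M \<Longrightarrow> f (X s \<omega>) = f' (X s \<omega>)"
  shows "sde_step M F' B b' g' f' X0 X P"
proof -
  obtain J K where J: "is_matrix_ito_integral M F (\<lambda>s \<omega>. g (X s \<omega>)) B (\<lambda>s \<omega>. f (X s \<omega>)) J"
    and K: "is_matrix_ito_integral M F (\<lambda>s \<omega>. f (X s \<omega>)) (\<lambda>s \<omega>. transpose (B s \<omega>)) (\<lambda>s \<omega>. g (X s \<omega>)) K"
    and e: "AE \<omega> in M. \<forall>t\<ge>0. set_integrable lborel {0..t} (\<lambda>s. b (X s \<omega>)) \<and>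
        P t \<omega> = X0 + (LINT s:{0..t}|lborel. b (X s \<omega>)) + J t \<omega> + K t \<omega>"
    using P unfolding sde_step_def by (elim exE conjE)
  have J': "is_matrix_ito_integral M F' (\<lambda>s \<omega>. g' (X s \<omega>)) B (\<lambda>s \<omega>. f' (X s \<omega>)) J"
    by (rule is_matrix_ito_integral_transfer[OF J sub space]) (simp_all add: eq)
  have K': "is_matrix_ito_integral M F' (\<lambda>s \<omega>. f' (X s \<omega>)) (\<lambda>s \<omega>. transpose (B s \<omega>)) (\<lambda>s \<omega>. g' (X s \<omega>)) K"
    by (rule is_matrix_ito_integral_transfer[OF K sub space]) (simp_all add: eq)
  have "AE \<omega> in M. \<forall>t\<ge>0. set_integrable lborel {0..t} (\<lambda>s. b' (X s \<omega>)) \<and>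
        P t \<omega> = X0 + (LINT s:{0..t}|lborel. b' (X s \<omega>)) + J t \<omega> + K t \<omega>"
    using e AE_space
  proof eventually_elim
    fix \<omega> assume e: "\<forall>t\<ge>0. set_integrable lborel {0..t} (\<lambda>s. b (X s \<omega>)) \<and>
        P t \<omega> = X0 + (LINT s:{0..t}|lborel. b (X s \<omega>)) + J t \<omega> + K t \<omega>" and \<omega>: "\<omega> \<in> space M"
    have "indicator {0..t} s *\<^sub>R b (X s \<omega>) = indicator {0..t} s *\<^sub>R b' (X s \<omega>)" for s t :: real
      by (cases "s \<in> {0..t}") (simp_all add: eq(1)[OF _ \<omega>])
    then show "\<forall>t\<ge>0. set_integrable lborel {0..t} (\<lambda>s. b' (X s \<omega>)) \<and>
        P t \<omega> = X0 + (LINT s:{0..t}|lborel. b' (X s \<omega>)) + J t \<omega> + K t \<omega>"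
      using e unfolding set_integrable_def set_lebesgue_integral_def by (simp only:)
  qed
  with J' K' show ?thesis unfolding sde_step_def by blast
qed

lemma sde_solution_iff_sde_step:
  "sde_solution M F B b g f X0 X \<longleftrightarrow> (\<forall>t\<ge>0. X t \<in> borel_measurable (F t)) \<and>
     (\<forall>\<omega>\<in>space M. continuous_on {0..} (\<lambda>t. X t \<omega>)) \<and>
     (\<forall>t\<ge>0. \<forall>\<omega>\<in>space M. X t \<omega> \<in> sym_mats) \<and> sde_step M F B b g f X0 X X"
  unfolding sde_solution_def sde_step_def ..

text \<open>Solutions for two filtrations are compared in a common larger one. They take symmetric values, on
which the extended coefficients agree with the given ones.\<close>

lemma sde_solutions_indistinguishable:
  fixes B :: "real \<Rightarrow> 'w \<Rightarrow> real^'n^'n"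
  assumes sde: "matrix_sde M H B (\<lambda>A. b (sym_part A)) (\<lambda>A. g (sym_part A)) (\<lambda>A. f (sym_part A)) X0"
    and X: "sde_solution M G B b g f X0 X" and Y: "sde_solution M F B b g f X0 Y"
    and G: "\<And>t. 0 \<le> t \<Longrightarrow> sets (G t) \<subseteq> sets (H t)" "\<And>t. space (G t) = space M"
    and F: "\<And>t. 0 \<le> t \<Longrightarrow> sets (F t) \<subseteq> sets (H t)" "\<And>t. space (F t) = space M"
  shows "indistinguishable M X Y"
proof -
  interpret matrix_sde M H B "\<lambda>A. b (sym_part A)" "\<lambda>A. g (sym_part A)" "\<lambda>A. f (sym_part A)" X0 by fact
  have main: "admissible Z \<and> sde_step M H B (\<lambda>A. b (sym_part A)) (\<lambda>A. g (sym_part A)) (\<lambda>A. f (sym_part A)) X0 Z Z"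
    if Z: "sde_solution M G' B b g f X0 Z" and G': "\<And>t. 0 \<le> t \<Longrightarrow> sets (G' t) \<subseteq> sets (H t)" "\<And>t. space (G' t) = space M"
    for G' Z
  proof
    have "Z t \<in> borel_measurable (H t)" if t: "0 \<le> t" for t
    proof -
      have "Z t \<in> borel_measurable (G' t)" using Z t by (simp add: sde_solution_def)
      then show ?thesis using G'(1)[OF t] G'(2) by (auto simp: measurable_def)
    qed
    then show "admissible Z" using Z by (simp add: admissible_def sde_solution_def)
    have sym: "sym_part (Z s \<omega>) = Z s \<omega>" if "0 \<le> s" "\<omega> \<in> space M" for s \<omega>
      using Z that by (simp add: sde_solution_def)
    show "sde_step M H B (\<lambda>A. b (sym_part A)) (\<lambda>A. g (sym_part A)) (\<lambda>A. f (sym_part A)) X0 Z Z"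
      by (rule sde_step_transfer[OF _ G' space_F]) (use Z sym in \<open>simp_all add: sde_solution_iff_sde_step\<close>)
  qed
  show ?thesis
    unfolding indistinguishable_def using sde_unique main[OF X G] main[OF Y F] by blast
qed

theorem theorem7:
  fixes M :: "'w measure"
    and B :: "real \<Rightarrow> 'w \<Rightarrow> real^'n^'n"
    and X0 :: "real^'n^'n"
    and b g f :: "real \<Rightarrow> real"
  assumes "prob_space M"
    and "matrix_brownian M B"
    and "X0 \<in> psd_mats"
    and "bounded (range g)" and "bounded (range f)" and "bounded (range b)"
    and "matrix_lipschitz (mat_fun g :: real^'n^'n \<Rightarrow> real^'n^'n)"
    and "matrix_lipschitz (mat_fun f :: real^'n^'n \<Rightarrow> real^'n^'n)"
    and "matrix_lipschitz (mat_fun b :: real^'n^'n \<Rightarrow> real^'n^'n)"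
  shows "\<exists>X. strong_solution M B (mat_fun b) (mat_fun g) (mat_fun f) X0 X \<and>
           (\<forall>Y. strong_solution M B (mat_fun b) (mat_fun g) (mat_fun f) X0 Y
              \<longrightarrow> indistinguishable M X Y) \<and>
           (\<forall>F Y. brownian_filtration M F B
              \<longrightarrow> sde_solution M F B (mat_fun b) (mat_fun g) (mat_fun f) X0 Y
              \<longrightarrow> indistinguishable M X Y)"
proof -
  interpret prob_space M by fact
  note B = assms(2)
  let ?c = "\<lambda>(h :: real \<Rightarrow> real) (A :: real^'n^'n). mat_fun h (sym_part A)"
  have coeff: "lipschitz_coefficient (?c b)" "lipschitz_coefficient (?c g)" "lipschitz_coefficient (?c f)"
    using assms by (auto intro: lipschitz_coefficient_mat_fun)
  have X0: "X0 \<in> sym_mats" using assms(3) by (simp add: psd_mats_def)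
  let ?N = "natural_filtration M B" and ?G = "brownian_augmentation M B"
  have G_sub: "subalgebra M (?N t)" for t by (rule subalgebra_natural_filtration[OF B])
  have sde_G: "matrix_sde M ?G B (?c b) (?c g) (?c f) X0"
    by (intro matrix_sde.intro matrix_sde_axioms.intro coeff X0 adapted_brownian_augmentation[OF B]
        adapted_brownian.axioms(1)[OF adapted_brownian_augmentation[OF B]])
      (unfold brownian_augmentation_eq, rule subset_null_augmentation(2)[OF G_sub])
  interpret G: matrix_sde M ?G B "?c b" "?c g" "?c f" X0 by (rule sde_G)
  obtain X where X: "G.admissible X" "\<forall>t\<ge>0. \<forall>\<omega>\<in>space M. X t \<omega> \<in> sym_mats"
    "sde_step M ?G B (?c b) (?c g) (?c f) X0 X X"
    using G.sde_exists by blast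
  have "sde_step M ?G B (mat_fun b) (mat_fun g) (mat_fun f) X0 X X"
    by (rule sde_step_transfer[OF X(3) subset_refl G.space_F G.space_F]) (use X(2) in simp_all)
  then have sol: "sde_solution M ?G B (mat_fun b) (mat_fun g) (mat_fun f) X0 X"
    using X(1,2) by (simp add: sde_solution_iff_sde_step G.admissible_def)
  have "indistinguishable M X Y" if "strong_solution M B (mat_fun b) (mat_fun g) (mat_fun f) X0 Y" for Y
    by (rule sde_solutions_indistinguishable[OF sde_G sol that[unfolded strong_solution_def]
          subset_refl G.space_F subset_refl G.space_F])
  moreover have "indistinguishable M X Y"
    if F: "brownian_filtration M F B" and Y: "sde_solution M F B (mat_fun b) (mat_fun g) (mat_fun f) X0 Y" for F Y
  proof -
    let ?H = "null_augmentation M F"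
    have sub: "subalgebra M (F t)" for t using F by (simp add: brownian_filtration_def)
    have "filtration (space M) F" using F by (simp add: brownian_filtration_def)
    note mono = filtration.sets_F_mono[OF this]
    have "matrix_sde M ?H B (?c b) (?c g) (?c f) X0"
      by (intro matrix_sde.intro matrix_sde_axioms.intro coeff X0 adapted_brownian_of_brownian_filtration[OF B F]
          adapted_brownian.axioms(1)[OF adapted_brownian_of_brownian_filtration[OF B F]]
          subset_null_augmentation(2)[where F=F, OF sub])
    moreover have "sets (?G t) \<subseteq> sets (?H t)" for t
    proof -
      have "natural_generator M B t \<subseteq> sets (F t)"
      proof
        fix a assume "a \<in> natural_generator M B t"
        then obtain s S where a: "a = B s -` S \<inter> space M" and s: "s \<in> {0..t}" and S: "S \<in> sets borel"
          unfolding natural_generator_def by blast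
        have "B s \<in> borel_measurable (F s)" using F s by (simp add: brownian_filtration_def)
        from measurable_sets[OF this S] have "a \<in> sets (F s)"
          using sub[of s] by (simp add: a subalgebra_def)
        then show "a \<in> sets (F t)" using mono[of s t] s by auto
      qed
      then have "sets (?N t) \<subseteq> sets (F t)"
        unfolding sets_natural_filtration using sets.sigma_sets_subset[of _ "F t"] sub[of t] by (simp add: subalgebra_def)
      then show ?thesis
        unfolding brownian_augmentation_eq sets_null_augmentation[where F=F, OF sub] sets_null_augmentation[where F="?N", OF G_sub]
        by (intro sigma_sets_mono') blast
    qed
    ultimately show ?thesis
      by (rule sde_solutions_indistinguishable[OF _ sol Y _ G.space_F
            subset_null_augmentation(1)[where F=F, OF sub]])
        (use sub in \<open>simp add: subalgebra_def\<close>)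
  qed
  ultimately show ?thesis using sol unfolding strong_solution_def by blast
qed

end
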